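(* Let $m$ be a $12$-th power free integer such that the polynomial $f(x)=x^{12}-m$ is irreducible over $\mathbb{Q}$, let $\theta$ be a complex root of $f(x)$, and let $K=\mathbb{Q}(\theta)$ with ring of integers $O_K$. Let $p$ be a prime number and put $d=\gcd(v_p(m),12)$. Then the following hold. \begin{enumerate} \item If $p\mid m$ and $p\nmid v_p(m)$, then $$v_p([O_K:\mathbb{Z}[\theta]])=\frac{1}{2}\big[11(v_p(m)-1)+(d-1)\big],$$ and the set $$S=\left\{\frac{\theta^i}{p^{\lfloor iv_p(m)/12\rfloor}}\ :\ 0\le i\le 11\right\}$$ is a $p$-integral basis of $K$. \item If $p=3$ and $3\nmid m$, then $$v_3([O_K:\mathbb{Z}[\theta]])=\begin{cases}4, & \text{if } m^2\equiv 1 \pmod 9,\\ 0, & \text{if } m^2\not\equiv 1\pmod 9,\end{cases}$$ and a $3$-integral basis of $K$ is $$\Big\{1,\theta,\theta^2,\dots,\theta^7,\ \tfrac{h(\theta)}{3},\ \tfrac{\theta h(\theta)}{3},\ \tfrac{\theta^2 h(\theta)}{3},\ \tfrac{\theta^3 h(\theta)}{3}\Big\}\quad\text{if } m^2\equiv 1\pmod 9,$$ and $\{1,\theta,\theta^2,\dots,\theta^{11}\}$ if $m^2\not\equiv 1\pmod 9$, where $h(\theta)=\theta^8+m\theta^4+1$. \item If $p=2$ and $2\nmid m$, then $$v_2([O_K:\mathbb{Z}[\theta]])=\begin{cases}9, & \text{if } m\equiv 1\pmod 8,\\ 6, & \text{if } m\equiv 5\pmod 8,\\ 0, & \text{if }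 m\equiv 3\pmod 4,\end{cases}$$ and a $2$-integral basis of $K$ is \begin{itemize} \item $\Big\{1,\theta,\theta^2,\theta^3,\theta^4,\theta^5,\frac{\theta^6-1}{2},\frac{\theta(\theta^6-1)}{2},\frac{\theta^2(\theta^6-1)}{2},\frac{g(\theta)}{2^2},\frac{\theta g(\theta)}{2^2},\frac{\theta^2 g(\theta)}{2^2}\Big\}$ if $m\equiv 1\pmod 8$, where $g(\theta)=\theta^9+\theta^6+\theta^3+1$; \item $\Big\{1,\theta,\theta^2,\theta^3,\theta^4,\theta^5,\frac{\theta^6-1}{2},\frac{\theta(\theta^6-1)}{2},\frac{\theta^2(\theta^6-1)}{2},\frac{\theta^3(\theta^6-1)}{2},\frac{\theta^4(\theta^6-1)}{2},\frac{\theta^5(\theta^6-1)}{2}\Big\}$ if $m\equiv 5\pmod 8$; \item $\{1,\theta,\theta^2,\dots,\theta^{11}\}$ if $m\equiv 3\pmod 4$. \end{itemize} \item If $p\nmid 12m$, then $v_p([O_K:\mathbb{Z}[\theta]])=0$ and $\{1,\theta,\theta^2,\dots,\theta^{11}\}$ is a $p$-integral basis of $K$. \end{enumerate}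
   Context: For a prime $p$ and a nonzero integer $t$, $v_p(t)$ denotes the exponent of the highest power of $p$ dividing $t$. $[O_K:\mathbb{Z}[\theta]]$ is the index of the additive subgroup $\mathbb{Z}[\theta]$ in $O_K$. Let $\mathbb{Z}_{(p)}$ be the localization of $\mathbb{Z}$ at the prime ideal $p\mathbb{Z}$ and $R_{(p)}$ the integral closure of $\mathbb{Z}_{(p)}$ in $K$; it is a free $\mathbb{Z}_{(p)}$-module of rank $12$, and a $p$-integral basis of $K$ is a $\mathbb{Z}_{(p)}$-basis of $R_{(p)}$. *)

theory Defs
  imports "HOL-Computational_Algebra.Computational_Algebra" "HOL-Number_Theory.Cong"
begin

definition subfield_of_complex :: "complex set \<Rightarrow> bool" where
  "subfield_of_complex F \<longleftrightarrow> 0 \<in> F \<and> 1 \<in> F \<and>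
     (\<forall>x\<in>F. \<forall>y\<in>F. x + y \<in> F \<and> x - y \<in> F \<and> x * y \<in> F) \<and>
     (\<forall>x\<in>F. x \<noteq> 0 \<longrightarrow> inverse x \<in> F)"

definition gen_field :: "complex \<Rightarrow> complex set" where
  "gen_field \<theta> = \<Inter> {F. subfield_of_complex F \<and> \<theta> \<in> F}"

definition integral_over :: "complex set \<Rightarrow> complex \<Rightarrow> bool" where
  "integral_over S x \<longleftrightarrow> (\<exists>q :: complex poly. lead_coeff q = 1 \<and> (\<forall>i. coeff q i \<in> S) \<and> poly q x = 0)"

definition Zloc :: "nat \<Rightarrow> complex set" where
  "Zloc p = {of_int a / of_int b | a b :: int. b \<noteq> 0 \<and> \<not> int p dvd b}"

definition ring_of_integers :: "complex set \<Rightarrow> complex set" where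
  "ring_of_integers K = {x \<in> K. integral_over \<int> x}"

definition loc_integral_closure :: "nat \<Rightarrow> complex set \<Rightarrow> complex set" where
  "loc_integral_closure p K = {x \<in> K. integral_over (Zloc p) x}"

text \<open>Z[theta] for theta of degree n: integer combinations of 1, theta, ..., theta^(n-1).\<close>
definition Zpow_basis_span :: "nat \<Rightarrow> complex \<Rightarrow> complex set" where
  "Zpow_basis_span n \<theta> = {\<Sum>i<n. of_int (a i) * \<theta> ^ i | a :: nat \<Rightarrow> int. True}"

definition subgroup_index :: "complex set \<Rightarrow> complex set \<Rightarrow> nat" where
  "subgroup_index A B = card ((\<lambda>x. {x + y | y. y \<in> B}) ` A)"

definition p_integral_basis :: "nat \<Rightarrow> complex set \<Rightarrow> nat \<Rightarrow> (nat \<Rightarrow> complex) \<Rightarrow> bool" where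
  "p_integral_basis p K n b \<longleftrightarrow>
     (\<forall>i<n. b i \<in> loc_integral_closure p K) \<and>
     (\<forall>x\<in>loc_integral_closure p K. \<exists>c. (\<forall>i<n. c i \<in> Zloc p) \<and> x = (\<Sum>i<n. c i * b i)) \<and>
     (\<forall>c. (\<forall>i<n. c i \<in> Zloc p) \<and> (\<Sum>i<n. c i * b i) = 0 \<longrightarrow> (\<forall>i<n. c i = 0))"

end

theory Submission
  imports "Jordan_Normal_Form.Char_Poly" "HOL-Computational_Algebra.Field_as_Ring" Defs
begin

text \<open>If $x = \sum_{i<12} a_i \theta^i$ is integral, so are its conjugates
  $\sum a_i \zeta^i \theta^i$ with $\zeta^{12} = 1$. Averaging over the $e$-th roots of unity, where
  $e \mid 12$ is prime to $p$, shows that the partial sums over the residue classes of $i$ modulo $e$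
  are integral at $p$. If $p \nmid v_p(m)$, the terms of such a partial sum have pairwise different
  valuations, so each of them is integral at $p$. If $p \in \{2, 3\}$ does not divide $m$, then up to
  a unit the partial sum lies in the quartic field of $\theta^3$ or in the cubic field of $\theta^4$,
  and the elementary symmetric functions of its conjugates give congruences for the coefficients.
  Finally the index: the $p$-integral basis consists of algebraic integers of the form
  $(\theta^i + \ldots)/p^{k_i}$, and adjoining these to $\mathbb{Z}[\theta]$ one at a time produces a
  subgroup of $O_K$ whose index is prime to $p$.\<close>

section \<open>Closure properties of algebraic integers\<close>

text \<open>Averaging over the e-th roots of unity costs a factor e, so e must avoid p; the p-part g
  of 12 cannot be averaged away, and each partial sum keeps g terms. If p does not divide v_p(m),
  then g is prime to v_p(m), which separates the valuations of these terms. If p does not divide m,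
  all powers of \<theta> are units at p, valuations say nothing, and denominators must be bounded by
  traces and norms. The numerators can be read off from the resulting congruences: A = C and B = m C
  modulo 3 say that (A + B \<theta>^4 + C \<theta>^8)/3 is an integral combination of 1, \<theta>^4
  and h(\<theta>)/3. The quotients are integral because h and g are geometric sums: h(\<theta>) =
  (y^3 - 1)/(y - 1) for y = \<theta>^8 with y^3 = m^2, and g(\<theta>) = (y^4 - 1)/(y - 1) for y =
  \<theta>^3 with y^4 = m. Prime ideals above p never appear: integrality at p means that some
  multiple by an integer prime to p is an algebraic integer, and positive valuation is replaced by
  nilpotence modulo p.\<close>

lemma algebraic_int_of_module:
  fixes x :: complex and b :: "'i \<Rightarrow> complex"
  assumes I: "finite I" and nz: "\<exists>i\<in>I. b i \<noteq> 0"
    and stable: "\<And>i. i \<in> I \<Longrightarrow> \<exists>c :: 'i \<Rightarrow> int. x * b i = (\<Sum>j\<in>I. of_int (c j) * b j)"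
  shows "algebraic_int x"
proof -
  obtain C :: "'i \<Rightarrow> 'i \<Rightarrow> int" where C: "\<And>i. i \<in> I \<Longrightarrow> x * b i = (\<Sum>j\<in>I. of_int (C i j) * b j)"
    using stable by metis
  define n where "n = card I"
  obtain e where e: "bij_betw e {0..<n} I"
    using ex_bij_betw_nat_finite[OF I] n_def by auto
  define A :: "int mat" where "A = Matrix.mat n n (\<lambda>(k, l). C (e k) (e l))"
  define w :: "complex Matrix.vec" where "w = Matrix.vec n (b \<circ> e)"
  have A: "A \<in> carrier_mat n n" and w: "w \<in> carrier_vec n" by (auto simp: A_def w_def)
  \<comment> \<open>Determinant trick: x acts on the family \<open>b\<close> by the integer matrix
    \<open>A\<close>, so the nonzero vector \<open>w\<close> is an eigenvector for x, and x is a
    root of a monic integral characteristic polynomial.\<close>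
  have "map_mat of_int A *\<^sub>v w = x \<cdot>\<^sub>v w"
  proof (rule eq_vecI)
    fix k assume "k < dim_vec (x \<cdot>\<^sub>v w)"
    then have k: "k < n" by (simp add: w_def)
    then have ek: "e k \<in> I" using e by (auto simp: bij_betw_def)
    have "vec_index (map_mat of_int A *\<^sub>v w) k = (\<Sum>l = 0..<n. of_int (C (e k) (e l)) * b (e l))"
      using k by (auto simp: A_def w_def scalar_prod_def intro!: sum.cong)
    also have "\<dots> = (\<Sum>j\<in>I. of_int (C (e k) j) * b j)"
      by (rule sum.reindex_bij_betw[OF e])
    also have "\<dots> = x * b (e k)" using C[OF ek] by simp
    finally show "vec_index (map_mat of_int A *\<^sub>v w) k = vec_index (x \<cdot>\<^sub>v w) k"
      using k by (simp add: w_def)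
  qed (auto simp: A_def w_def)
  moreover have "w \<noteq> 0\<^sub>v n"
  proof
    assume w0: "w = 0\<^sub>v n"
    obtain i where i: "i \<in> I" "b i \<noteq> 0" using nz by auto
    then obtain k where k: "k < n" "e k = i" using e by (force simp: bij_betw_def)
    have "vec_index w k = 0" using w0 k by simp
    then show False using k i by (simp add: w_def)
  qed
  ultimately have "eigenvalue (map_mat of_int A) x"
    using A w unfolding eigenvalue_def eigenvector_def by (intro exI[of _ w]) auto
  then have "poly (char_poly (map_mat of_int A)) x = 0"
    using A eigenvalue_root_char_poly[of "map_mat of_int A" n x] by auto
  then have "poly (map_poly of_int (char_poly A)) x = 0"
    using of_int_hom.char_poly_hom[OF A, where 'a = complex] by simp
  moreover have "lead_coeff (char_poly A) = 1"
    using degree_monic_char_poly[OF A] by simp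
  ultimately show ?thesis
    unfolding algebraic_int_altdef_ipoly by blast
qed

lemma algebraic_int_power_reduce:
  fixes x :: complex
  assumes "algebraic_int x"
  obtains n and c :: "nat \<Rightarrow> int" where "n > 0" "x ^ n = (\<Sum>i<n. of_int (c i) * x ^ i)"
proof -
  obtain q :: "int poly" where q: "poly (map_poly of_int q) x = 0" "lead_coeff q = 1"
    using assms unfolding algebraic_int_altdef_ipoly by auto
  define n where "n = degree q"
  have "n > 0"
  proof (rule ccontr)
    assume "\<not> n > 0"
    then obtain c where "q = [:c:]" by (auto simp: n_def elim: degree_eq_zeroE)
    then show False using q by auto
  qed
  have "0 = (\<Sum>i\<le>n. of_int (coeff q i) * x ^ i)"
    using q(1) by (simp add: poly_altdef n_def coeff_map_poly degree_map_poly)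
  also have "\<dots> = (\<Sum>i<n. of_int (coeff q i) * x ^ i) + x ^ n"
    using q(2) by (simp add: n_def flip: lessThan_Suc_atMost)
  finally have "x ^ n = (\<Sum>i<n. of_int (- coeff q i) * x ^ i)"
    by (simp add: sum_negf eq_neg_iff_add_eq_0 add.commute)
  then show thesis using that \<open>n > 0\<close> by metis
qed

text \<open>The monomials x^i y^j below the degrees n and k of monic relations for x and y span a
  finitely generated group that multiplication by x and by y maps into itself. It is therefore
  stable under x + y and x y, and the determinant trick applies to both.\<close>

lemma algebraic_int_add_mult:
  fixes x y :: complex
  assumes "algebraic_int x" "algebraic_int y"
  shows algebraic_int_add: "algebraic_int (x + y)" and algebraic_int_mult: "algebraic_int (x * y)"
proof -
  obtain n and c :: "nat \<Rightarrow> int" where n: "n > 0" "x ^ n = (\<Sum>i<n. of_int (c i) * x ^ i)"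
    using algebraic_int_power_reduce assms(1) by blast
  obtain k and d :: "nat \<Rightarrow> int" where k: "k > 0" "y ^ k = (\<Sum>i<k. of_int (d i) * y ^ i)"
    using algebraic_int_power_reduce assms(2) by blast
  define I where "I = {..<n} \<times> {..<k}"
  define b :: "nat \<times> nat \<Rightarrow> complex" where "b = (\<lambda>(i, j). x ^ i * y ^ j)"
  define S where "S = {\<Sum>j\<in>I. of_int (a j) * b j | a :: nat \<times> nat \<Rightarrow> int. True}"
  have I: "finite I" by (simp add: I_def)
  have zero: "0 \<in> S" unfolding S_def by (rule CollectI, rule exI[of _ "\<lambda>_. 0"]) simp
  have add: "u + v \<in> S" if "u \<in> S" "v \<in> S" for u v
  proof -
    from that obtain a a' :: "nat \<times> nat \<Rightarrow> int" where
      "u = (\<Sum>j\<in>I. of_int (a j) * b j)" "v = (\<Sum>j\<in>I. of_int (a' j) * b j)"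
      unfolding S_def by auto
    then have "u + v = (\<Sum>j\<in>I. of_int (a j + a' j) * b j)"
      by (simp add: sum.distrib ring_distribs)
    then show ?thesis unfolding S_def by (auto intro!: exI[of _ "\<lambda>j. a j + a' j"])
  qed
  have scale: "of_int t * u \<in> S" if "u \<in> S" for t u
  proof -
    from that obtain a :: "nat \<times> nat \<Rightarrow> int" where "u = (\<Sum>j\<in>I. of_int (a j) * b j)"
      unfolding S_def by auto
    then have "of_int t * u = (\<Sum>j\<in>I. of_int (t * a j) * b j)"
      by (simp add: sum_distrib_left mult.assoc)
    then show ?thesis unfolding S_def by (auto intro!: exI[of _ "\<lambda>j. t * a j"])
  qed
  have sum: "(\<Sum>j\<in>J. f j) \<in> S" if "\<And>j. j \<in> J \<Longrightarrow> f j \<in> S" for f :: "'z \<Rightarrow> complex" and J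
    using that by (induction J rule: infinite_finite_induct) (auto intro: zero add)
  have gen: "b j \<in> S" if "j \<in> I" for j
    unfolding S_def using I that
    by (auto intro!: exI[of _ "\<lambda>i. if i = j then 1 else 0"] simp: if_distrib[of of_int] if_distrib[of "\<lambda>t. t * _"] cong: if_cong)
  have x: "x * b j \<in> S" if "j \<in> I" for j
  proof -
    obtain i l where j: "j = (i, l)" by fastforce
    show ?thesis
    proof (cases "Suc i < n")
      case True
      then have "b (Suc i, l) \<in> S" using that by (intro gen) (auto simp: I_def j)
      then show ?thesis by (simp add: b_def j mult_ac)
    next
      case False
      then have "n = Suc i" using that by (auto simp: I_def j)
      then have "x * b j = (\<Sum>i'<n. of_int (c i') * b (i', l))"
        using arg_cong[OF n(2), of "\<lambda>t. t * y ^ l"]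
        by (simp add: b_def j sum_distrib_right mult.assoc del: sum.lessThan_Suc)
      also have "\<dots> \<in> S" using that by (intro sum scale gen) (auto simp: I_def j)
      finally show ?thesis .
    qed
  qed
  have y: "y * b j \<in> S" if "j \<in> I" for j
  proof -
    obtain i l where j: "j = (i, l)" by fastforce
    show ?thesis
    proof (cases "Suc l < k")
      case True
      then have "b (i, Suc l) \<in> S" using that by (intro gen) (auto simp: I_def j)
      then show ?thesis by (simp add: b_def j mult_ac)
    next
      case False
      then have "k = Suc l" using that by (auto simp: I_def j)
      then have "y * b j = x ^ i * y ^ k" by (simp add: b_def j mult_ac)
      also have "\<dots> = (\<Sum>l'<k. of_int (d l') * b (i, l'))"
        using arg_cong[OF k(2), of "\<lambda>t. x ^ i * t"]
        by (simp add: b_def sum_distrib_left mult_ac del: sum.lessThan_Suc)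
      also have "\<dots> \<in> S" using that by (intro sum scale gen) (auto simp: I_def j)
      finally show ?thesis .
    qed
  qed
  have x': "x * u \<in> S" if "u \<in> S" for u
  proof -
    from that obtain a :: "nat \<times> nat \<Rightarrow> int" where "u = (\<Sum>j\<in>I. of_int (a j) * b j)"
      unfolding S_def by auto
    then have "x * u = (\<Sum>j\<in>I. of_int (a j) * (x * b j))"
      by (simp add: sum_distrib_left mult_ac)
    also have "\<dots> \<in> S" by (intro sum scale x)
    finally show ?thesis .
  qed
  have nz: "\<exists>j\<in>I. b j \<noteq> 0"
    using n k by (intro bexI[of _ "(0, 0)"]) (auto simp: I_def b_def)
  show "algebraic_int (x + y)"
  proof (rule algebraic_int_of_module[OF I nz])
    fix j assume "j \<in> I"
    then have "(x + y) * b j \<in> S" using x y add by (simp add: ring_distribs)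
    then show "\<exists>c. (x + y) * b j = (\<Sum>j\<in>I. of_int (c j) * b j)"
      by (auto simp: S_def)
  qed
  show "algebraic_int (x * y)"
  proof (rule algebraic_int_of_module[OF I nz])
    fix j assume "j \<in> I"
    then have "(x * y) * b j \<in> S" using x' y by (simp add: mult.assoc)
    then show "\<exists>c. (x * y) * b j = (\<Sum>j\<in>I. of_int (c j) * b j)"
      by (auto simp: S_def)
  qed
qed

lemma algebraic_int_diff: "algebraic_int (x - y)" if "algebraic_int x" "algebraic_int y" for x y :: complex
  using algebraic_int_add[of x "- y"] that by simp

lemma algebraic_int_power: "algebraic_int (x ^ n)" if "algebraic_int x" for x :: complex
  using that by (induction n) (auto intro: algebraic_int_mult)

lemma algebraic_int_sum:
  fixes f :: "'i \<Rightarrow> complex"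
  assumes "\<And>i. i \<in> I \<Longrightarrow> algebraic_int (f i)"
  shows "algebraic_int (sum f I)"
  using assms by (induction I rule: infinite_finite_induct) (auto intro: algebraic_int_add)

lemma algebraic_int_of_power:
  fixes x :: complex
  assumes "algebraic_int (x ^ n)" "n > 0"
  shows "algebraic_int x"
  by (rule algebraic_int_root[OF assms(1), of "monom 1 n"])
     (use assms(2) in \<open>auto simp: poly_monom degree_monom_eq\<close>)

section \<open>Indices of subgroups of the complex numbers\<close>

definition add_subgroup :: "complex set \<Rightarrow> bool" where
  "add_subgroup S \<longleftrightarrow> 0 \<in> S \<and> (\<forall>x\<in>S. \<forall>y\<in>S. x - y \<in> S)"

abbreviation coset :: "complex set \<Rightarrow> complex \<Rightarrow> complex set" where
  "coset B x \<equiv> {x + y | y. y \<in> B}"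

definition adjoin :: "complex set \<Rightarrow> complex \<Rightarrow> complex set" where
  "adjoin B x = {of_int n * x + y | n y. y \<in> B}"

lemma add_subgroupD:
  assumes "add_subgroup S"
  shows "0 \<in> S" "\<And>x y. x \<in> S \<Longrightarrow> y \<in> S \<Longrightarrow> x - y \<in> S" "\<And>x. x \<in> S \<Longrightarrow> - x \<in> S"
    "\<And>x y. x \<in> S \<Longrightarrow> y \<in> S \<Longrightarrow> x + y \<in> S" "\<And>x n. x \<in> S \<Longrightarrow> of_int n * x \<in> S"
    "\<And>f I. (\<And>i. i \<in> I \<Longrightarrow> f i \<in> S) \<Longrightarrow> sum f I \<in> S"
proof -
  show 0: "0 \<in> S" and d: "\<And>x y. x \<in> S \<Longrightarrow> y \<in> S \<Longrightarrow> x - y \<in> S"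
    using assms by (auto simp: add_subgroup_def)
  show m: "- x \<in> S" if "x \<in> S" for x using d[OF 0 that] by simp
  show a: "x + y \<in> S" if "x \<in> S" "y \<in> S" for x y using d[OF that(1) m[OF that(2)]] by simp
  have n: "of_nat n * x \<in> S" if "x \<in> S" for x n
    using that by (induction n) (auto simp: 0 a ring_distribs)
  show "of_int n * x \<in> S" if "x \<in> S" for x n
  proof (cases n)
    case (nonneg k)
    then show ?thesis using n[OF that, of k] by simp
  next
    case (neg k)
    then have "of_int n * x = - (of_nat (Suc k) * x)" by (simp add: neg algebra_simps)
    then show ?thesis using m[OF n[OF that, of "Suc k"]] by simp
  qed
  show "sum f I \<in> S" if "\<And>i. i \<in> I \<Longrightarrow> f i \<in> S" for f :: "'z \<Rightarrow> complex" and I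
    using that by (induction I rule: infinite_finite_induct) (auto simp: 0 a)
qed

lemma coset_eq_iff:
  assumes "add_subgroup B"
  shows "coset B x = coset B y \<longleftrightarrow> x - y \<in> B"
proof
  assume "coset B x = coset B y"
  moreover have "x \<in> coset B x" using add_subgroupD(1)[OF assms] by force
  ultimately show "x - y \<in> B" by auto
next
  have *: "coset B x \<subseteq> coset B y" if "x - y \<in> B" for x y
  proof
    fix z assume "z \<in> coset B x"
    then obtain u where "z = x + u" "u \<in> B" by auto
    then show "z \<in> coset B y"
      using add_subgroupD(4)[OF assms that, of u] by (auto intro!: exI[of _ "x - y + u"])
  qed
  assume "x - y \<in> B"
  with *[of x y] *[of y x] add_subgroupD(3)[OF assms, of "x - y"]
  show "coset B x = coset B y" by auto
qed

lemma adjoin_subgroup: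
  assumes "add_subgroup B"
  shows "add_subgroup (adjoin B x)"
  unfolding add_subgroup_def
proof (intro conjI ballI)
  show "0 \<in> adjoin B x"
    using add_subgroupD(1)[OF assms] unfolding adjoin_def by (intro CollectI exI[of _ 0]) auto
  fix u v assume "u \<in> adjoin B x" "v \<in> adjoin B x"
  then obtain n y n' y' where "u = of_int n * x + y" "y \<in> B" "v = of_int n' * x + y'" "y' \<in> B"
    by (auto simp: adjoin_def)
  then show "u - v \<in> adjoin B x"
    using add_subgroupD(2)[OF assms] unfolding adjoin_def
    by (intro CollectI exI[of _ "n - n'"] exI[of _ "y - y'"]) (auto simp: algebra_simps)
qed

lemma subset_adjoin: "B \<subseteq> adjoin B x"
  by (auto simp: adjoin_def intro!: exI[of _ "0::int"])

lemma adjoin_subset: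
  assumes "add_subgroup A" "B \<subseteq> A" "x \<in> A"
  shows "adjoin B x \<subseteq> A"
  using add_subgroupD(4,5)[OF assms(1)] assms(2,3) by (auto simp: adjoin_def)

text \<open>Each coset of B + Zx splits into the N cosets of B obtained by the shifts 0, x, ..., (N
  - 1) x. Finiteness is carried along because an infinite quotient would have \<open>card\<close>
  equal to 0.\<close>

lemma subgroup_index_adjoin:
  assumes A: "add_subgroup A" and B: "add_subgroup B" and "B \<subseteq> A" "x \<in> A" and N: "N > 0"
    and order: "\<And>n :: int. of_int n * x \<in> B \<longleftrightarrow> int N dvd n"
    and fin: "finite (coset B ` A)"
  shows "subgroup_index A B = subgroup_index A (adjoin B x) * N"
    and "finite (coset (adjoin B x) ` A)"
proof -
  define B' where "B' = adjoin B x"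
  have B': "add_subgroup B'" and sub: "B \<subseteq> B'"
    using adjoin_subgroup[OF B] subset_adjoin by (auto simp: B'_def)
  define r where "r = inv_into A (coset B')"
  have r: "r D \<in> A" "coset B' (r D) = D" if "D \<in> coset B' ` A" for D
    using inv_into_into[OF that] f_inv_into_f[OF that] by (auto simp: r_def)
  \<comment> \<open>A coset of \<open>B\<close> is named by the coset of \<open>B'\<close>
    containing it, through its chosen representative, and a multiple of x below N.\<close>
  define h where "h = (\<lambda>(D, n::nat). coset B (r D + of_nat n * x))"
  have "bij_betw h (coset B' ` A \<times> {..<N}) (coset B ` A)"
    unfolding bij_betw_def
  proof
    show "inj_on h (coset B' ` A \<times> {..<N})"
    proof (rule inj_onI)
      fix P P' assume P: "P \<in> coset B' ` A \<times> {..<N}" "P' \<in> coset B' ` A \<times> {..<N}" "h P = h P'"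
      obtain D n D' n' where PD: "P = (D, n)" "P' = (D', n')" by fastforce
      with P have D: "D \<in> coset B' ` A" "D' \<in> coset B' ` A" and n: "n < N" "n' < N"
        by auto
      from P(3) have *: "r D + of_nat n * x - (r D' + of_nat n' * x) \<in> B"
        by (simp add: PD h_def coset_eq_iff[OF B])
      moreover have "of_int (int n' - int n) * x \<in> B'"
        using add_subgroupD(1)[OF B] unfolding B'_def adjoin_def
        by (intro CollectI exI[of _ "int n' - int n"] exI[of _ 0]) auto
      ultimately have "r D + of_nat n * x - (r D' + of_nat n' * x) + of_int (int n' - int n) * x \<in> B'"
        using add_subgroupD(4)[OF B'] sub by blast
      also have "r D + of_nat n * x - (r D' + of_nat n' * x) + of_int (int n' - int n) * x = r D - r D'"
        by (simp add: algebra_simps)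
      finally have "r D - r D' \<in> B'" .
      then have DD: "D = D'" using coset_eq_iff[OF B', of "r D" "r D'"] r(2)[OF D(1)] r(2)[OF D(2)] by simp
      have "r D + of_nat n * x - (r D' + of_nat n' * x) = of_int (int n - int n') * x"
        by (simp add: DD algebra_simps)
      with * have "of_int (int n - int n') * x \<in> B" by simp
      then have "int N dvd int n - int n'" using order by blast
      then have "int n mod int N = int n' mod int N" by (simp add: mod_eq_dvd_iff)
      then have "n = n'" using n by simp
      with DD show "P = P'" by (simp add: PD)
    qed
    show "h ` (coset B' ` A \<times> {..<N}) = coset B ` A"
    proof (intro equalityI subsetI)
      fix C assume "C \<in> h ` (coset B' ` A \<times> {..<N})"
      then obtain D n where "D \<in> coset B' ` A" "C = coset B (r D + of_nat n * x)"
        by (auto simp: h_def)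
      moreover have "r D + of_int (int n) * x \<in> A"
        using r[OF \<open>D \<in> _\<close>] add_subgroupD(4,5)[OF A] \<open>x \<in> A\<close> by blast
      ultimately show "C \<in> coset B ` A" by auto
    next
      fix C assume "C \<in> coset B ` A"
      then obtain a where a: "a \<in> A" "C = coset B a" by auto
      define D where "D = coset B' a"
      have D: "D \<in> coset B' ` A" using a by (auto simp: D_def)
      then have "a - r D \<in> B'" using r[OF D] coset_eq_iff[OF B', of a "r D"] by (simp add: D_def)
      then obtain n y where y: "a - r D = of_int n * x + y" "y \<in> B" by (auto simp: B'_def adjoin_def)
      define k where "k = nat (n mod int N)"
      have k: "k < N" "int k = n mod int N" using N by (auto simp: k_def nat_less_iff)
      have "int N dvd n - int k" by (simp add: k(2))
      then have "of_int (n - int k) * x \<in> B" using order by blast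
      then have "of_int (n - int k) * x + y \<in> B" using y add_subgroupD(4)[OF B] by blast
      moreover have "of_int (n - int k) * x + y = a - (r D + of_nat k * x)"
        using y(1) by (simp add: algebra_simps)
      ultimately have "C = h (D, k)"
        unfolding a(2) h_def by (simp add: coset_eq_iff[OF B])
      then show "C \<in> h ` (coset B' ` A \<times> {..<N})" using D k by auto
    qed
  qed
  then have "card (coset B' ` A \<times> {..<N}) = card (coset B ` A)"
    and fin': "finite (coset B' ` A \<times> {..<N})"
    using fin bij_betw_same_card bij_betw_finite by blast+
  then show "subgroup_index A B = subgroup_index A (adjoin B x) * N"
    by (simp add: subgroup_index_def card_cartesian_product B'_def)
  show "finite (coset (adjoin B x) ` A)"
    using finite_cartesian_productD1[OF fin'] N by (auto simp: B'_def lessThan_empty_iff)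
qed

lemma subgroup_index_pos:
  assumes "add_subgroup A" "finite (coset B ` A)"
  shows "subgroup_index A B > 0"
  using assms add_subgroupD(1)[OF assms(1)] by (auto simp: subgroup_index_def card_gt_0_iff)

text \<open>The integers n with n x in B form an ideal of Z. It contains s > 0, so its least
  positive element generates it.\<close>

lemma order_modulo_subgroup:
  assumes B: "add_subgroup B" and s: "of_nat s * x \<in> B" "s > 0"
  obtains N :: nat where "N > 0" "\<And>n :: int. of_int n * x \<in> B \<longleftrightarrow> int N dvd n"
proof -
  define N where "N = (LEAST n. n > 0 \<and> of_nat n * x \<in> B)"
  have N: "N > 0" "of_nat N * x \<in> B"
    using LeastI[of "\<lambda>n. n > 0 \<and> of_nat n * x \<in> B" s] s by (auto simp: N_def)
  have min: "N \<le> n" if "n > 0" "of_nat n * x \<in> B" for n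
    using that unfolding N_def by (intro Least_le) auto
  have "of_int n * x \<in> B \<longleftrightarrow> int N dvd n" for n
  proof
    assume "int N dvd n"
    then obtain k where "n = int N * k" by auto
    then show "of_int n * x \<in> B"
      using add_subgroupD(5)[OF B N(2), of k] by (simp add: mult_ac)
  next
    assume n: "of_int n * x \<in> B"
    have "of_int n * x - of_int (n div int N) * (of_nat N * x) \<in> B"
      by (intro add_subgroupD(2,5)[OF B] n N)
    also have "of_int n * x - of_int (n div int N) * (of_nat N * x) = of_int (n - n div int N * int N) * x"
      by (simp add: algebra_simps)
    also have "n - n div int N * int N = int (nat (n mod int N))"
      using N by (simp add: minus_div_mult_eq_mod)
    finally have *: "of_nat (nat (n mod int N)) * x \<in> B" by (simp only: of_int_of_nat_eq)
    have "nat (n mod int N) < N" using N by (simp add: nat_less_iff)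
    then have "nat (n mod int N) = 0" using min[OF _ *] by linarith
    moreover have "n mod int N \<ge> 0" using N by simp
    ultimately show "int N dvd n" by (simp add: dvd_eq_mod_eq_0)
  qed
  then show thesis using that N by blast
qed

text \<open>The quotient is exhausted by cyclic steps: adjoining some x outside B divides the index
  by the order of x modulo B. That order divides s, so it is prime to p, and induction on the index
  applies.\<close>

lemma subgroup_index_coprime:
  assumes A: "add_subgroup A" and "add_subgroup B" "B \<subseteq> A" "finite (coset B ` A)"
    and s: "s > 0" and "\<And>x. x \<in> A \<Longrightarrow> of_nat s * x \<in> B"
    and p: "prime (p :: nat)" "\<not> p dvd s"
  shows "\<not> p dvd subgroup_index A B"
  using assms(2-4,6)
proof (induction "subgroup_index A B" arbitrary: B rule: less_induct)
  case less
  note B = less.prems(1)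
  show ?case
  proof (cases "A \<subseteq> B")
    case True
    have "coset B ` A = {coset B 0}"
    proof (intro equalityI subsetI)
      fix C assume "C \<in> coset B ` A"
      then obtain a where "a \<in> A" "C = coset B a" by auto
      then show "C \<in> {coset B 0}" using True coset_eq_iff[OF B, of a 0] by auto
    qed (use add_subgroupD(1)[OF A] in blast)
    then have "subgroup_index A B = 1" by (simp add: subgroup_index_def)
    then show ?thesis using p by auto
  next
    case False
    then obtain x where x: "x \<in> A" "x \<notin> B" by auto
    obtain N :: nat where N: "N > 0" "\<And>n :: int. of_int n * x \<in> B \<longleftrightarrow> int N dvd n"
      using order_modulo_subgroup[OF B less.prems(4)[OF x(1)] s] by blast
    have "int N dvd int s" using N(2)[of "int s"] less.prems(4)[OF x(1)] by simp
    then have pN: "\<not> p dvd N" using p by (auto dest: dvd_trans)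
    have "N \<noteq> 1" using N(2)[of 1] x by auto
    with N have N1: "N > 1" by simp
    note st = subgroup_index_adjoin[OF A B less.prems(2) x(1) N less.prems(3)]
    have "\<not> p dvd subgroup_index A (adjoin B x)"
    proof (rule less.hyps)
      show "subgroup_index A (adjoin B x) < subgroup_index A B"
        using st(1) N1 subgroup_index_pos[OF A st(2)] by simp
      show "of_nat s * y \<in> adjoin B x" if "y \<in> A" for y
        using less.prems(4)[OF that] subset_adjoin by blast
    qed (use adjoin_subgroup[OF B] adjoin_subset[OF A less.prems(2) x(1)] st(2) in auto)
    then show ?thesis using st(1) pN p prime_dvd_mult_nat by metis
  qed
qed

text \<open>Coefficients can be reduced modulo D without changing the coset of B, so at most D^n
  cosets occur. The vectors \<open>e i\<close> may lie outside A, as the quotients \<theta>^i / (12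
  m) do in the application.\<close>

lemma finite_cosets:
  fixes e :: "nat \<Rightarrow> complex"
  assumes B: "add_subgroup B" and D: "D > 0" "\<And>i. i < n \<Longrightarrow> of_int D * e i \<in> B"
    and span: "\<And>x. x \<in> A \<Longrightarrow> \<exists>c :: nat \<Rightarrow> int. x = (\<Sum>i<n. of_int (c i) * e i)"
  shows "finite (coset B ` A)"
proof (rule finite_subset)
  let ?F = "\<lambda>r :: nat \<Rightarrow> int. coset B (\<Sum>i<n. of_int (r i) * e i)"
  show "finite (?F ` PiE {..<n} (\<lambda>_. {0..<D}))" by (intro finite_imageI finite_PiE) auto
  show "coset B ` A \<subseteq> ?F ` PiE {..<n} (\<lambda>_. {0..<D})"
  proof
    fix C assume "C \<in> coset B ` A"
    then obtain c :: "nat \<Rightarrow> int" where c: "C = coset B (\<Sum>i<n. of_int (c i) * e i)"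
      using span by blast
    define r where "r = restrict (\<lambda>i. c i mod D) {..<n}"
    have "(\<Sum>i<n. of_int (c i) * e i) - (\<Sum>i<n. of_int (r i) * e i)
        = (\<Sum>i<n. of_int (c i div D) * (of_int D * e i))"
      unfolding sum_subtractf[symmetric]
    proof (intro sum.cong refl)
      fix i assume "i \<in> {..<n}"
      then have "of_int (c i) * e i - of_int (r i) * e i = of_int (c i - c i mod D) * e i"
        by (simp add: r_def algebra_simps)
      also have "c i - c i mod D = c i div D * D" by (simp add: minus_mod_eq_div_mult)
      finally show "of_int (c i) * e i - of_int (r i) * e i = of_int (c i div D) * (of_int D * e i)"
        by (simp add: mult_ac)
    qed
    also have "\<dots> \<in> B"
      by (rule add_subgroupD(6)[OF B], rule add_subgroupD(5)[OF B]) (use D in auto)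
    finally have "C = ?F r" unfolding c coset_eq_iff[OF B] .
    moreover have "r \<in> PiE {..<n} (\<lambda>_. {0..<D})" using D by (auto simp: r_def)
    ultimately show "C \<in> ?F ` PiE {..<n} (\<lambda>_. {0..<D})" by blast
  qed
qed

section \<open>Integrality away from a prime\<close>

text \<open>Integrality over the localization of Z at p, with all denominators cleared by a single
  integer s prime to p; this keeps the arguments inside the ring of algebraic integers.\<close>

definition loc_int :: "nat \<Rightarrow> complex \<Rightarrow> bool" where
  "loc_int p x \<longleftrightarrow> (\<exists>s :: int. \<not> int p dvd s \<and> algebraic_int (of_int s * x))"

text \<open>With R the ring of algebraic numbers integral at p, this says that z is nilpotent modulo
  p R, that is, z lies in every prime of R above p. It is the substitute for positive
  valuation.\<close>

definition loc_nil :: "nat \<Rightarrow> complex \<Rightarrow> bool" where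
  "loc_nil p z \<longleftrightarrow> (\<exists>N > 0. loc_int p (z ^ N / of_nat p))"

lemma loc_int_cancel:
  assumes "prime p" "\<not> int p dvd s" "loc_int p (of_int s * x)"
  shows "loc_int p x"
proof -
  from assms(3) obtain t where "\<not> int p dvd t" "algebraic_int (of_int t * (of_int s * x))"
    by (auto simp: loc_int_def)
  then show ?thesis using assms(1,2) unfolding loc_int_def
    by (intro exI[of _ "t * s"]) (auto simp: prime_dvd_mult_iff mult.assoc)
qed

context
  fixes p :: nat
  assumes p: "prime p"
begin

lemma loc_int_algebraic_int: "algebraic_int x \<Longrightarrow> loc_int p x"
  using p unfolding loc_int_def by (intro exI[of _ 1]) (auto dest: prime_gt_1_nat)

lemma loc_int_of_int [simp]: "loc_int p (of_int n)"
  by (rule loc_int_algebraic_int) simp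

lemma loc_int_simps [simp]:
  "loc_int p 0" "loc_int p 1" "loc_int p (numeral k)" "loc_int p (of_nat n)" "loc_int p (- 1)"
  by (rule loc_int_algebraic_int; simp)+

lemma loc_int_add_mult:
  assumes "loc_int p x" "loc_int p y"
  shows loc_int_add: "loc_int p (x + y)" and loc_int_mult: "loc_int p (x * y)"
proof -
  from assms obtain s t where s: "\<not> int p dvd s" "algebraic_int (of_int s * x)"
    and t: "\<not> int p dvd t" "algebraic_int (of_int t * y)" by (auto simp: loc_int_def)
  have st: "\<not> int p dvd s * t" using s t p by (simp add: prime_dvd_mult_iff)
  have "algebraic_int (of_int t * (of_int s * x) + of_int s * (of_int t * y))"
    by (intro algebraic_int_add algebraic_int_mult s t) auto
  then have "algebraic_int (of_int (s * t) * (x + y))" by (simp add: algebra_simps)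
  then show "loc_int p (x + y)" using st loc_int_def by blast
  have "algebraic_int ((of_int s * x) * (of_int t * y))"
    by (intro algebraic_int_mult s t)
  then have "algebraic_int (of_int (s * t) * (x * y))" by (simp add: algebra_simps)
  then show "loc_int p (x * y)" using st loc_int_def by blast
qed

lemma loc_int_minus: "loc_int p x \<Longrightarrow> loc_int p (- x)"
  using loc_int_mult[of "- 1" x] by simp

lemma loc_int_diff: "loc_int p x \<Longrightarrow> loc_int p y \<Longrightarrow> loc_int p (x - y)"
  using loc_int_add[of x "- y"] loc_int_minus[of y] by simp

lemma loc_int_power: "loc_int p x \<Longrightarrow> loc_int p (x ^ n)"
  by (induction n) (auto intro: loc_int_mult)

lemma loc_int_sum: "(\<And>i. i \<in> I \<Longrightarrow> loc_int p (f i)) \<Longrightarrow> loc_int p (sum f I)"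
  by (induction I rule: infinite_finite_induct) (auto intro: loc_int_add)

lemma loc_int_of_power:
  assumes "loc_int p (x ^ n)" "n > 0"
  shows "loc_int p x"
proof -
  from assms obtain s where s: "\<not> int p dvd s" "algebraic_int (of_int s * x ^ n)"
    by (auto simp: loc_int_def)
  \<comment> \<open>The factor s^(n - 1) completes s x^n to the n-th power of s x.\<close>
  have "algebraic_int (of_int (s ^ (n - 1)) * (of_int s * x ^ n))"
    by (intro algebraic_int_mult s algebraic_int_of_int)
  also have "of_int (s ^ (n - 1)) * (of_int s * x ^ n) = (of_int s * x) ^ n"
    using assms(2) by (cases n) (auto simp: power_mult_distrib)
  finally have "algebraic_int (of_int s * x)" using assms(2) algebraic_int_of_power by blast
  then show ?thesis using s loc_int_def by blast
qed

lemma loc_int_divide: "loc_int p x \<Longrightarrow> \<not> int p dvd s \<Longrightarrow> loc_int p (x / of_int s)"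
  by (rule loc_int_cancel[OF p, of s]) auto

text \<open>The localization of Z at p is integrally closed: after multiplication by s the number is
  a rational algebraic integer, hence an integer. Norms and symmetric functions are turned into
  divisibilities this way.\<close>

lemma loc_int_rational_dvd:
  assumes "loc_int p (of_int n / of_nat p ^ k)"
  shows "int p ^ k dvd n"
proof -
  from assms obtain s where s: "\<not> int p dvd s"
    and *: "algebraic_int (of_int s * (of_int n / of_nat p ^ k :: complex))"
    by (auto simp: loc_int_def)
  have "of_int s * (of_int n / of_nat p ^ k :: complex) \<in> \<rat>" by auto
  from rational_algebraic_int_is_int[OF * this]
  obtain z where "of_int s * (of_int n / of_nat p ^ k :: complex) = of_int z"
    by (elim Ints_cases)
  then have "(of_int (s * n) :: complex) = of_int (int p ^ k * z)"
    using p by (auto simp: field_simps dest: prime_gt_0_nat)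
  then have "s * n = int p ^ k * z" by (simp only: of_int_eq_iff)
  then have "int p ^ k dvd s * n" by simp
  moreover have "coprime (int p ^ k) s"
    using s p by (simp add: prime_imp_coprime)
  ultimately show ?thesis by (simp add: coprime_dvd_mult_right_iff)
qed

lemma loc_int_of_integral_over_Zloc:
  assumes "integral_over (Zloc p) x"
  shows "loc_int p x"
proof -
  obtain q where q: "lead_coeff q = 1" "\<And>i. coeff q i \<in> Zloc p" "poly q x = 0"
    using assms by (auto simp: integral_over_def)
  have "\<forall>i. \<exists>a b :: int. \<not> int p dvd b \<and> coeff q i = of_int a / of_int b"
    using q(2) unfolding Zloc_def by blast
  then obtain a b where ab: "\<And>i. \<not> int p dvd b i" "\<And>i. coeff q i = of_int (a i) / of_int (b i)"
    by metis
  define n where "n = degree q"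
  define s where "s = (\<Prod>i<n. b i)"
  have s: "\<not> int p dvd s" using p ab(1) by (simp add: s_def prime_dvd_prod_iff)
  have sc: "of_int s * coeff q i \<in> \<int>" if "i < n" for i
  proof -
    have "b i \<noteq> 0" using ab(1)[of i] by auto
    moreover have "s = b i * (\<Prod>j\<in>{..<n}-{i}. b j)"
      using that by (simp add: s_def prod.remove)
    ultimately have "of_int s * coeff q i = of_int ((\<Prod>j\<in>{..<n}-{i}. b j) * a i)"
      by (simp add: ab(2))
    then show ?thesis by (simp only: Ints_of_int)
  qed
  \<comment> \<open>This is s^n q(X/s), a monic polynomial with root s x. Each coefficient below the
    leading one carries a positive power of s, which clears its denominator.\<close>
  define r where "r = Abs_poly (\<lambda>i. if i \<le> n then of_int s ^ (n - i) * coeff q i else 0)"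
  have cr: "coeff r i = (if i \<le> n then of_int s ^ (n - i) * coeff q i else 0)" for i
    unfolding r_def by (subst coeff_Abs_poly[of n]) auto
  have cn: "coeff r n = 1" using q(1) by (simp add: cr n_def)
  then have dr: "degree r = n"
    by (intro antisym le_degree degree_le) (auto simp: cr)
  have "algebraic_int (of_int s * x)"
  proof (rule algebraic_int.intros)
    show "lead_coeff r = 1" using cn dr by simp
    show "\<forall>i. coeff r i \<in> \<int>"
    proof
      fix i
      consider "i < n" | "i = n" | "i > n" by linarith
      then show "coeff r i \<in> \<int>"
      proof cases
        case 1
        then obtain k where "n - i = Suc k" by (metis Suc_diff_Suc)
        then have "coeff r i = of_int s ^ k * (of_int s * coeff q i)"
          using 1 by (simp add: cr)
        also have "\<dots> \<in> \<int>" by (intro Ints_mult Ints_power sc 1) auto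
        finally show ?thesis .
      qed (use q(1) in \<open>auto simp: cr n_def\<close>)
    qed
    have "poly r (of_int s * x) = (\<Sum>i\<le>n. of_int s ^ (n - i) * coeff q i * (of_int s * x) ^ i)"
      unfolding poly_altdef dr by (intro sum.cong) (auto simp: cr)
    also have "\<dots> = (\<Sum>i\<le>n. of_int s ^ n * (coeff q i * x ^ i))"
      by (intro sum.cong) (auto simp: power_mult_distrib mult_ac simp flip: power_add)
    also have "\<dots> = of_int s ^ n * poly q x"
      by (simp add: poly_altdef n_def sum_distrib_left)
    finally show "poly r (of_int s * x) = 0" using q(3) by simp
  qed
  then show ?thesis using s loc_int_def by blast
qed

section \<open>Elements nilpotent modulo p, and sums of terms with distinct valuations\<close>

lemma loc_nil_imp_loc_int:
  assumes "loc_nil p z"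
  shows "loc_int p z"
proof -
  obtain N where N: "N > 0" "loc_int p (z ^ N / of_nat p)" using assms by (auto simp: loc_nil_def)
  have "loc_int p (of_nat p * (z ^ N / of_nat p))" by (intro loc_int_mult N) auto
  then have "loc_int p (z ^ N)" using p by (auto dest: prime_gt_0_nat)
  then show ?thesis using N loc_int_of_power by blast
qed

lemma loc_nil_mult:
  assumes "loc_int p x" "loc_nil p z"
  shows "loc_nil p (x * z)"
proof -
  obtain N where N: "N > 0" "loc_int p (z ^ N / of_nat p)" using assms by (auto simp: loc_nil_def)
  have "loc_int p (x ^ N * (z ^ N / of_nat p))" by (intro loc_int_mult N loc_int_power assms)
  then show ?thesis using N unfolding loc_nil_def
    by (intro exI[of _ N]) (auto simp: power_mult_distrib)
qed

text \<open>Every term of the binomial expansion of (x + y)^(N + M) contains x^N or y^M as a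
  factor.\<close>

lemma loc_nil_add:
  assumes "loc_nil p x" "loc_nil p y"
  shows "loc_nil p (x + y)"
proof -
  obtain N where N: "N > 0" "loc_int p (x ^ N / of_nat p)" using assms by (auto simp: loc_nil_def)
  obtain M where M: "M > 0" "loc_int p (y ^ M / of_nat p)" using assms by (auto simp: loc_nil_def)
  have x: "loc_int p x" and y: "loc_int p y" using assms loc_nil_imp_loc_int by auto
  have "loc_int p (\<Sum>k\<le>N + M. of_nat (N + M choose k) * x ^ k * y ^ (N + M - k) / of_nat p)"
  proof (rule loc_int_sum)
    fix k assume "k \<in> {..N + M}"
    show "loc_int p (of_nat (N + M choose k) * x ^ k * y ^ (N + M - k) / of_nat p)"
    proof (cases "N \<le> k")
      case True
      have "loc_int p (of_nat (N + M choose k) * x ^ (k - N) * y ^ (N + M - k) * (x ^ N / of_nat p))"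
        by (intro loc_int_mult loc_int_power x y N) auto
      also have "of_nat (N + M choose k) * x ^ (k - N) * y ^ (N + M - k) * (x ^ N / of_nat p)
        = of_nat (N + M choose k) * (x ^ (k - N) * x ^ N) * y ^ (N + M - k) / of_nat p"
        by (simp add: mult_ac)
      finally show ?thesis using True by (simp flip: power_add)
    next
      case False
      have "loc_int p (of_nat (N + M choose k) * x ^ k * y ^ (N - k) * (y ^ M / of_nat p))"
        by (intro loc_int_mult loc_int_power x y M) auto
      also have "of_nat (N + M choose k) * x ^ k * y ^ (N - k) * (y ^ M / of_nat p)
        = of_nat (N + M choose k) * x ^ k * (y ^ (N - k) * y ^ M) / of_nat p"
        by (simp add: mult_ac)
      finally show ?thesis using False by (simp flip: power_add)
    qed
  qed
  also have "(\<Sum>k\<le>N + M. of_nat (N + M choose k) * x ^ k * y ^ (N + M - k) / of_nat p)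
      = (x + y) ^ (N + M) / of_nat p"
    by (simp add: binomial_ring sum_divide_distrib)
  finally show ?thesis using N unfolding loc_nil_def by (intro exI[of _ "N + M"]) auto
qed

lemma loc_nil_0 [simp]: "loc_nil p 0"
  unfolding loc_nil_def by (intro exI[of _ 1]) auto

lemma loc_nil_sum: "(\<And>i. i \<in> I \<Longrightarrow> loc_nil p (f i)) \<Longrightarrow> loc_nil p (sum f I)"
  by (induction I rule: infinite_finite_induct) (auto intro: loc_nil_add)

text \<open>Otherwise 1/p would be integral at p.\<close>

lemma not_loc_nil_1: "\<not> loc_nil p 1"
proof
  assume "loc_nil p 1"
  then have "loc_int p (of_int 1 / of_nat p ^ 1)" by (auto simp: loc_nil_def)
  then show False using loc_int_rational_dvd[of 1 1] p by (auto dest: prime_gt_1_nat)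
qed

lemma loc_nil_of_power_eq:
  assumes "z ^ n = of_nat p powi w * (of_int a / of_int b)" "w > 0" "\<not> int p dvd b" "n > 0"
  shows "loc_nil p z"
  unfolding loc_nil_def
proof (intro exI conjI)
  have "of_nat p \<noteq> (0::complex)" using p by (auto dest: prime_gt_0_nat)
  moreover obtain k where "w = int (Suc k)" using assms(2) by (cases w rule: int_cases3) (auto dest: gr0_implies_Suc)
  ultimately have "z ^ n / of_nat p = of_nat p ^ k * of_int a / of_int b"
    using assms(1) by (simp add: power_int_def nat_add_distrib)
  moreover have "loc_int p (of_nat p ^ k * of_int a / of_int b)"
    by (intro loc_int_divide loc_int_mult loc_int_power assms) auto
  ultimately show "loc_int p (z ^ n / of_nat p)" by simp
qed (fact assms)

text \<open>If the term of least valuation were not integral, dividing by it would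
  exhibit 1 as a sum of elements of positive valuation.\<close>
lemma distinct_valuations_nonneg:
  fixes t :: "'i \<Rightarrow> complex" and w :: "'i \<Rightarrow> int"
  assumes fin: "finite I" and n: "n > 0" and inj: "inj_on w I" and sum: "loc_int p (sum t I)"
    and pow: "\<And>i. i \<in> I \<Longrightarrow> \<exists>a b. \<not> int p dvd a \<and> \<not> int p dvd b \<and> t i ^ n = of_nat p powi w i * (of_int a / of_int b)"
    and i: "i \<in> I"
  shows "w i \<ge> 0"
proof (rule ccontr)
  assume neg: "\<not> w i \<ge> 0"
  have p0: "of_nat p \<noteq> (0::complex)" using p by (auto dest: prime_gt_0_nat)
  obtain a b where ab: "\<And>i. i \<in> I \<Longrightarrow> \<not> int p dvd a i" "\<And>i. i \<in> I \<Longrightarrow> \<not> int p dvd b i"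
    "\<And>i. i \<in> I \<Longrightarrow> t i ^ n = of_nat p powi w i * (of_int (a i) / of_int (b i))"
    using pow by metis
  \<comment> \<open>\<open>w i\<close> is n times the valuation of \<open>t i\<close>; the factor n
    keeps it an integer. The minimum at j is attained only there, by injectivity of
    \<open>w\<close>.\<close>
  obtain j where j: "j \<in> I" "\<And>k. k \<in> I \<Longrightarrow> w j \<le> w k"
    using ex_min_if_finite[of "w ` I"] fin i by (force simp: not_less)
  have a0: "a k \<noteq> 0" "b k \<noteq> 0" if "k \<in> I" for k using ab(1,2)[OF that] by auto
  have tj: "t j \<noteq> 0" using ab(3)[OF j(1)] a0[OF j(1)] n p0 by (auto simp: power_0_left)
  have inv: "loc_nil p (1 / t j)"
  proof (rule loc_nil_of_power_eq)
    show "(1 / t j) ^ n = of_nat p powi (- w j) * (of_int (b j) / of_int (a j))"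
      unfolding power_one_over ab(3)[OF j(1)] by (simp add: power_int_minus field_class.field_divide_inverse)
    show "- w j > 0" using neg j(2)[OF i] by simp
  qed (use ab j n in auto)
  have quot: "loc_nil p (t k / t j)" if "k \<in> I - {j}" for k
  proof (rule loc_nil_of_power_eq)
    show "(t k / t j) ^ n = of_nat p powi (w k - w j) * (of_int (a k * b j) / of_int (b k * a j))"
      using ab(3)[of k] ab(3)[OF j(1)] that p0 by (simp add: power_divide power_int_diff mult_ac)
    show "w k - w j > 0" using j(2)[of k] inj_onD[OF inj, of k j] that j(1) by force
    show "\<not> int p dvd b k * a j" using ab that j p by (auto simp: prime_dvd_mult_iff)
  qed (fact n)
  have "loc_nil p (sum t I * (1 / t j) + (- 1) * (\<Sum>k\<in>I - {j}. t k / t j))"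
    by (intro loc_nil_add loc_nil_mult loc_nil_sum sum inv quot) auto
  also have "sum t I * (1 / t j) + (- 1) * (\<Sum>k\<in>I - {j}. t k / t j) = 1"
    using tj by (simp add: sum.remove[OF fin j(1)] add_divide_distrib sum_divide_distrib)
  finally show False using not_loc_nil_1 by simp
qed

end

section \<open>Pure extensions of degree 12\<close>

abbreviation rpoly :: "rat poly \<Rightarrow> complex \<Rightarrow> complex" where
  "rpoly P x \<equiv> poly (map_poly of_rat P) x"

declare poly_monom [simp]

lemma rpoly_simps [simp]:
  "rpoly 0 x = 0" "rpoly 1 x = 1" "rpoly (P + Q) x = rpoly P x + rpoly Q x"
  "rpoly (P - Q) x = rpoly P x - rpoly Q x" "rpoly (P * Q) x = rpoly P x * rpoly Q x"
  "rpoly (monom c n) x = of_rat c * x ^ n" "rpoly [:c:] x = of_rat c"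
  "rpoly (pcompose P Q) x = rpoly P (rpoly Q x)"
proof -
  interpret h: map_poly_comm_ring_hom "of_rat :: rat \<Rightarrow> complex" ..
  show "rpoly 0 x = 0" "rpoly 1 x = 1" "rpoly (P + Q) x = rpoly P x + rpoly Q x"
    "rpoly (P - Q) x = rpoly P x - rpoly Q x" "rpoly (P * Q) x = rpoly P x * rpoly Q x"
    "rpoly (monom c n) x = of_rat c * x ^ n"
    by (auto simp: h.hom_add h.hom_minus h.hom_mult map_poly_monom poly_monom)
  show "rpoly [:c:] x = of_rat c"
    by (subst Polynomial.map_poly_pCons) auto
  show "rpoly (pcompose P Q) x = rpoly P (rpoly Q x)"
    by (simp add: of_rat_hom.map_poly_pcompose poly_pcompose)
qed

lemma rpoly_sum: "rpoly (sum f I) x = (\<Sum>i\<in>I. rpoly (f i) x)"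
  by (induction I rule: infinite_finite_induct) auto

lemma subfield_closed:
  assumes "subfield_of_complex F"
  shows "0 \<in> F" "1 \<in> F" "\<And>x y. x \<in> F \<Longrightarrow> y \<in> F \<Longrightarrow> x + y \<in> F" "\<And>x y. x \<in> F \<Longrightarrow> y \<in> F \<Longrightarrow> x - y \<in> F"
    "\<And>x y. x \<in> F \<Longrightarrow> y \<in> F \<Longrightarrow> x * y \<in> F" "\<And>x y. x \<in> F \<Longrightarrow> y \<in> F \<Longrightarrow> x / y \<in> F"
    "of_nat n \<in> F" "of_int k \<in> F" "\<And>x n. x \<in> F \<Longrightarrow> x ^ n \<in> F"
    "\<And>f I. (\<And>i. i \<in> I \<Longrightarrow> f i \<in> F) \<Longrightarrow> sum f I \<in> F"
proof -
  show 0: "0 \<in> F" and 1: "1 \<in> F" and add: "\<And>x y. x \<in> F \<Longrightarrow> y \<in> F \<Longrightarrow> x + y \<in> F"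
    and diff: "\<And>x y. x \<in> F \<Longrightarrow> y \<in> F \<Longrightarrow> x - y \<in> F" and mult: "\<And>x y. x \<in> F \<Longrightarrow> y \<in> F \<Longrightarrow> x * y \<in> F"
    using assms by (auto simp: subfield_of_complex_def)
  show "x / y \<in> F" if "x \<in> F" "y \<in> F" for x y
    using assms that mult[of x "inverse y"] 0
    by (cases "y = 0") (auto simp: subfield_of_complex_def divide_inverse)
  show n: "of_nat n \<in> F" for n by (induction n) (auto simp: 0 1 add)
  show "of_int k \<in> F"
    using n diff[OF 0 n[of "nat (- k)"]] n[of "nat k"] by (cases "k \<ge> 0") auto
  show "x ^ n \<in> F" if "x \<in> F" for x n using that by (induction n) (auto simp: 1 mult)
  show "sum f I \<in> F" if "\<And>i. i \<in> I \<Longrightarrow> f i \<in> F" for f :: "'z \<Rightarrow> complex" and I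
    using that by (induction I rule: infinite_finite_induct) (auto simp: 0 add)
qed

lemma gen_field_subfield: "subfield_of_complex (gen_field \<theta>)"
  unfolding gen_field_def subfield_of_complex_def by blast

lemma gen_field_generator: "\<theta> \<in> gen_field \<theta>"
  unfolding gen_field_def by blast

text \<open>The geometric sum of a root of unity vanishes unless the root is 1. Taken at k = i - r,
  this filter singles out the exponents i in the residue class of r modulo e.\<close>

lemma sum_powers_root_of_unity:
  assumes e: "e > 0"
  defines "\<zeta> \<equiv> cis (2 * pi / real e)"
  shows "\<zeta> ^ e = 1" "(\<Sum>j<e. \<zeta> ^ (k * j)) = (if e dvd k then of_nat e else 0)"
proof -
  have pow: "\<zeta> ^ k = cis (2 * pi * real k / real e)" for k
    by (simp add: \<zeta>_def DeMoivre mult_ac)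
  show e1: "\<zeta> ^ e = 1" using e by (simp add: pow)
  have mod: "\<zeta> ^ k = \<zeta> ^ (k mod e)" for k
  proof -
    have "\<zeta> ^ k = (\<zeta> ^ e) ^ (k div e) * \<zeta> ^ (k mod e)"
      by (simp flip: power_mult power_add)
    then show ?thesis using e1 by simp
  qed
  have one: "\<zeta> ^ k = 1 \<longleftrightarrow> e dvd k"
  proof
    assume "\<zeta> ^ k = 1"
    then have "cis (2 * pi * real (k mod e) / real e) = cis (2 * pi * real 0 / real e)"
      using mod[of k] pow by simp
    moreover have "inj_on (\<lambda>k. cis (2 * pi * real k / real e)) {..<e}"
      using bij_betw_roots_unity[OF e] by (simp add: bij_betw_def)
    ultimately have "k mod e = 0" using e by (auto dest!: inj_onD[of _ _ "k mod e" 0])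
    then show "e dvd k" by (simp add: dvd_eq_mod_eq_0)
  next
    assume "e dvd k" then show "\<zeta> ^ k = 1" using mod[of k] by simp
  qed
  show "(\<Sum>j<e. \<zeta> ^ (k * j)) = (if e dvd k then of_nat e else 0)"
  proof (cases "e dvd k")
    case True
    then show ?thesis using one by (simp add: power_mult)
  next
    case False
    have "(\<zeta> ^ k - 1) * (\<Sum>j<e. (\<zeta> ^ k) ^ j) = (\<zeta> ^ k) ^ e - 1"
      using power_diff_1_eq[of "\<zeta> ^ k" e] by simp
    also have "\<dots> = (\<zeta> ^ e) ^ k - 1" by (simp flip: power_mult add: mult.commute)
    finally show ?thesis using e1 one False by (simp add: power_mult)
  qed
qed

section \<open>The field generated by \<theta>, its coordinates and its conjugates\<close>

locale pure12 =
  fixes m :: int and \<theta> :: complex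
  assumes irr: "irreducible (monom (1 :: rat) 12 - [:of_int m:])"
    and root: "\<theta> ^ 12 = of_int m"
begin

definition f :: "rat poly" where "f = monom 1 12 - [:of_int m:]"

lemma degree_f: "degree f = 12"
proof -
  have "f = monom 1 12 + [:- of_int m:]" by (simp add: f_def)
  then show ?thesis by (simp add: degree_add_eq_left degree_monom_eq)
qed

lemma rpoly_f: "rpoly f x = x ^ 12 - of_int m"
  by (simp add: f_def poly_monom)

text \<open>Irreducible elements of Q[X] are prime, so f is coprime to whatever it does not divide.
  Both the minimality of f and the inverses in the field come from this identity.\<close>

lemma bezout_f:
  assumes "\<not> f dvd P"
  obtains u v where "u * f + v * P = 1"
proof -
  have "prime_elem f" using field_poly_irreducible_imp_prime[OF irr] by (simp only: f_def)
  then have "coprime f P" using assms by (rule prime_elem_imp_coprime)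
  then have "fst (bezout_coefficients f P) * f + snd (bezout_coefficients f P) * P = 1"
    by (simp add: bezout_coefficients_fst_snd)
  then show thesis using that by blast
qed

lemma f_dvd_iff: "f dvd P \<longleftrightarrow> rpoly P \<theta> = 0"
proof
  assume "f dvd P"
  then obtain Q where "P = f * Q" by auto
  then show "rpoly P \<theta> = 0" by (simp add: rpoly_f root)
next
  assume P: "rpoly P \<theta> = 0"
  show "f dvd P"
  proof (rule ccontr)
    assume "\<not> f dvd P"
    then obtain u v where "u * f + v * P = 1" using bezout_f by blast
    then have "rpoly (u * f + v * P) \<theta> = 1" by simp
    then show False using P by (simp add: rpoly_f root)
  qed
qed

lemma theta_nonzero: "\<theta> \<noteq> 0"
proof
  assume "\<theta> = 0"
  then have "rpoly (monom 1 1) \<theta> = 0" by (simp add: poly_monom)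
  then have "f dvd monom 1 1" using f_dvd_iff by blast
  then have "degree f \<le> 1" by (metis dvd_imp_degree_le degree_monom_le le_trans monom_eq_0_iff one_neq_zero)
  then show False by (simp add: degree_f)
qed

lemma m_nonzero: "m \<noteq> 0"
  using root theta_nonzero by (metis of_int_0 power_eq_0_iff)

lemma powers_independent:
  assumes "(\<Sum>i<12. of_rat (a i) * \<theta> ^ i) = 0" "i < 12"
  shows "a i = 0"
proof -
  define P where "P = (\<Sum>i<12. monom (a i) i)"
  have "rpoly P \<theta> = 0" using assms(1) by (simp add: P_def rpoly_sum)
  then have dvd: "f dvd P" using f_dvd_iff by blast
  have "degree P < 12"
  proof -
    have "degree P \<le> 11" unfolding P_def
      by (intro degree_sum_le) (auto intro: order.trans[OF degree_monom_le])
    then show ?thesis by simp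
  qed
  with dvd have "P = 0" using degree_f by (auto dest: dvd_imp_degree_le)
  moreover have "coeff P i = a i" using assms(2) by (simp add: P_def coeff_sum)
  ultimately show ?thesis by simp
qed

text \<open>As \<open>gen_field\<close> is an intersection of subfields, it suffices that the values
  of rational polynomials at \<theta> form a field containing \<theta>; \<open>bezout_f\<close>
  supplies the inverses. Reduction modulo f leaves twelve coordinates.\<close>

lemma gen_field_coords:
  assumes "x \<in> gen_field \<theta>"
  obtains a :: "nat \<Rightarrow> rat" where "x = (\<Sum>i<12. of_rat (a i) * \<theta> ^ i)"
proof -
  let ?F = "range (\<lambda>P. rpoly P \<theta>)"
  have "subfield_of_complex ?F"
    unfolding subfield_of_complex_def
  proof (intro conjI ballI impI)
    show "0 \<in> ?F" by (rule range_eqI[of _ _ 0]) simp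
    show "1 \<in> ?F" by (rule range_eqI[of _ _ 1]) simp
    fix x assume "x \<in> ?F"
    then obtain P where P: "x = rpoly P \<theta>" by auto
    show "inverse x \<in> ?F" if "x \<noteq> 0"
    proof -
      have "\<not> f dvd P" using that P f_dvd_iff by simp
      then obtain u v where "u * f + v * P = 1" using bezout_f by blast
      then have "rpoly (u * f + v * P) \<theta> = 1" by simp
      then have "rpoly v \<theta> * x = 1" by (simp add: P rpoly_f root)
      then have "inverse x = rpoly v \<theta>" using that by (simp add: field_simps)
      then show ?thesis by blast
    qed
    fix y assume "y \<in> ?F"
    then obtain Q where Q: "y = rpoly Q \<theta>" by auto
    show "x + y \<in> ?F" "x - y \<in> ?F" "x * y \<in> ?F"
      by (rule range_eqI[of _ _ "P + Q"] range_eqI[of _ _ "P - Q"] range_eqI[of _ _ "P * Q"], simp add: P Q)+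
  qed
  moreover have "\<theta> \<in> ?F" by (rule range_eqI[of _ _ "monom 1 1"]) (simp add: poly_monom)
  ultimately have "x \<in> ?F" using assms unfolding gen_field_def by blast
  then obtain P where P: "x = rpoly P \<theta>" by auto
  define R where "R = P mod f"
  have "P = P div f * f + R" by (simp add: R_def)
  then have "rpoly P \<theta> = rpoly (P div f * f + R) \<theta>" by simp
  then have x: "x = rpoly R \<theta>" by (simp add: P rpoly_f root)
  have "f \<noteq> 0" using degree_f by auto
  then have "degree R < 12" using degree_mod_less'[of f P] degree_f
    by (cases "R = 0") (auto simp: R_def)
  then have "x = (\<Sum>i<12. of_rat (coeff R i) * \<theta> ^ i)"
    unfolding x poly_altdef
    by (intro sum.mono_neutral_cong_left) (auto simp: coeff_eq_0)
  then show thesis using that by blast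
qed

text \<open>An annihilating polynomial of an element of the field also annihilates its conjugates.\<close>
lemma algebraic_int_conjugate:
  assumes "algebraic_int (rpoly P \<theta>)" "\<zeta> ^ 12 = 1"
  shows "algebraic_int (rpoly P (\<zeta> * \<theta>))"
proof -
  obtain q :: "int poly" where q: "poly (map_poly of_int q) (rpoly P \<theta>) = 0" "lead_coeff q = 1"
    using assms(1) unfolding algebraic_int_altdef_ipoly by auto
  define q' :: "rat poly" where "q' = map_poly of_int q"
  have q': "rpoly q' x = poly (map_poly of_int q) x" for x
    by (simp add: q'_def map_poly_map_poly o_def)
  have "rpoly (pcompose q' P) \<theta> = 0" using q by (simp add: q')
  then obtain Q where "pcompose q' P = f * Q" using f_dvd_iff by blast
  then have "rpoly (pcompose q' P) (\<zeta> * \<theta>) = rpoly (f * Q) (\<zeta> * \<theta>)" by simp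
  also have "\<dots> = 0" using assms(2) root by (simp add: rpoly_f power_mult_distrib)
  finally have "poly (map_poly of_int q) (rpoly P (\<zeta> * \<theta>)) = 0" by (simp add: q')
  then show ?thesis using q(2) unfolding algebraic_int_altdef_ipoly by blast
qed

lemma algebraic_int_theta: "algebraic_int \<theta>"
  using algebraic_int_of_power[of \<theta> 12] by (simp add: root)

text \<open>The factor e is kept rather than divided out, so that the result serves two ends: e = 12
  gives a global bound on denominators, and e prime to p gives the local decomposition.\<close>

lemma algebraic_int_piece:
  assumes alg: "algebraic_int (\<Sum>i<12. of_rat (a i) * \<theta> ^ i)" and e: "e dvd 12" "r < e"
  shows "algebraic_int (of_nat e * (\<Sum>i | i < 12 \<and> i mod e = r. of_rat (a i) * \<theta> ^ i))"
proof -
  have e0: "e > 0" using e by simp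
  define \<zeta> where "\<zeta> = cis (2 * pi / real e)"
  note \<zeta> = sum_powers_root_of_unity[OF e0, folded \<zeta>_def]
  have "\<zeta> ^ 12 = 1" using \<zeta>(1) e(1) by (metis dvdE power_mult power_one)
  then have \<zeta>12: "(\<zeta> ^ j) ^ 12 = 1" for j by (metis power_mult mult.commute power_one)
  have alg\<zeta>: "algebraic_int \<zeta>"
    using algebraic_int_of_power[of \<zeta> e] \<zeta>(1) e0 by simp
  define P where "P = (\<Sum>i<12. monom (a i) i)"
  have "algebraic_int (rpoly P (\<zeta> ^ j * \<theta>))" for j
    by (rule algebraic_int_conjugate) (use alg \<zeta>12 in \<open>auto simp: P_def rpoly_sum\<close>)
  \<comment> \<open>The weight stands for \<zeta>^(- j r), written with a nonnegative exponent by
    means of \<zeta>^e = 1.\<close>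
  then have "algebraic_int (\<Sum>j<e. \<zeta> ^ (j * (e - r)) * rpoly P (\<zeta> ^ j * \<theta>))"
    by (intro algebraic_int_sum algebraic_int_mult algebraic_int_power alg\<zeta>)
  also have "(\<Sum>j<e. \<zeta> ^ (j * (e - r)) * rpoly P (\<zeta> ^ j * \<theta>))
    = (\<Sum>j<e. \<Sum>i<12. of_rat (a i) * \<theta> ^ i * \<zeta> ^ ((i + (e - r)) * j))"
    by (simp add: P_def rpoly_sum sum_distrib_left power_mult_distrib power_add algebra_simps flip: power_mult)
  also have "\<dots> = (\<Sum>i<12. of_rat (a i) * \<theta> ^ i * (\<Sum>j<e. \<zeta> ^ ((i + (e - r)) * j)))"
    by (subst sum.swap) (simp add: sum_distrib_left)
  also have "\<dots> = (\<Sum>i<12. if i mod e = r then of_nat e * (of_rat (a i) * \<theta> ^ i) else 0)"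
  proof (intro sum.cong refl)
    fix i :: nat
    have "e dvd i + (e - r) \<longleftrightarrow> i mod e = r"
    proof -
      have "int e dvd int (i + (e - r)) \<longleftrightarrow> int e dvd int i - int r + int e"
        using e(2) by (simp add: of_nat_diff algebra_simps)
      also have "\<dots> \<longleftrightarrow> int e dvd int i - int r" by simp
      also have "\<dots> \<longleftrightarrow> int i mod int e = int r mod int e" by (simp add: mod_eq_dvd_iff)
      also have "\<dots> \<longleftrightarrow> i mod e = r mod e" by (simp flip: of_nat_mod)
      finally show ?thesis using e(2) by (simp only: int_dvd_int_iff) simp
    qed
    then show "of_rat (a i) * \<theta> ^ i * (\<Sum>j<e. \<zeta> ^ ((i + (e - r)) * j))
      = (if i mod e = r then of_nat e * (of_rat (a i) * \<theta> ^ i) else 0)"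
      by (simp add: \<zeta>(2))
  qed
  also have "\<dots> = of_nat e * (\<Sum>i | i < 12 \<and> i mod e = r. of_rat (a i) * \<theta> ^ i)"
    by (simp add: sum_distrib_left sum.If_cases Int_def)
  finally show ?thesis .
qed

text \<open>For e = 12 the partial sum is a single term, and \<theta>^(12 - i) turns it into the
  rational number 12 m a_i. Hence 12 m O_K lies in Z[\<theta>], which makes the index
  finite.\<close>

lemma algebraic_int_coord:
  assumes "algebraic_int (\<Sum>i<12. of_rat (a i) * \<theta> ^ i)" "i < 12"
  obtains n :: int where "12 * of_int m * a i = of_int n"
proof -
  have "algebraic_int (of_nat 12 * (\<Sum>j | j < 12 \<and> j mod 12 = i. of_rat (a j) * \<theta> ^ j))"
    using assms by (intro algebraic_int_piece) auto
  also have "{j. j < 12 \<and> j mod 12 = i} = {i}" using assms(2) by auto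
  finally have "algebraic_int (12 * (of_rat (a i) * \<theta> ^ i))" by simp
  then have "algebraic_int (12 * (of_rat (a i) * \<theta> ^ i) * \<theta> ^ (12 - i))"
    by (rule algebraic_int_mult) (intro algebraic_int_power algebraic_int_theta)
  also have "12 * (of_rat (a i) * \<theta> ^ i) * \<theta> ^ (12 - i) = 12 * of_rat (a i) * (\<theta> ^ i * \<theta> ^ (12 - i))"
    by (simp only: mult.assoc)
  also have "\<theta> ^ i * \<theta> ^ (12 - i) = of_int m"
    using assms(2) root by (simp flip: power_add)
  also have "12 * of_rat (a i) * of_int m = (of_rat (12 * of_int m * a i) :: complex)"
    by (simp add: of_rat_mult)
  finally have "(of_rat (12 * of_int m * a i) :: complex) \<in> \<int>"
    by (rule rational_algebraic_int_is_int) (rule Rats_of_rat)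
  then obtain n where "(of_rat (12 * of_int m * a i) :: complex) = of_int n" by (elim Ints_cases)
  then have "of_rat (12 * of_int m * a i) = (of_rat (of_int n) :: complex)" by simp
  then have "12 * of_int m * a i = of_int n" by (simp only: of_rat_eq_iff)
  then show thesis using that by blast
qed

context
  fixes p :: nat
  assumes p: "prime p"
begin

lemma loc_int_theta: "loc_int p \<theta>"
  by (rule loc_int_algebraic_int[OF p algebraic_int_theta])

lemma loc_int_conjugate:
  assumes "loc_int p (rpoly P \<theta>)" "\<zeta> ^ 12 = 1"
  shows "loc_int p (rpoly P (\<zeta> * \<theta>))"
proof -
  obtain s where s: "\<not> int p dvd s" "algebraic_int (of_int s * rpoly P \<theta>)"
    using assms(1) by (auto simp: loc_int_def)
  have "algebraic_int (rpoly ([:of_int s:] * P) (\<zeta> * \<theta>))"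
    by (rule algebraic_int_conjugate[OF _ assms(2)]) (simp add: s del: mult_pCons_left)
  then show ?thesis using s(1) unfolding loc_int_def
    by (intro exI[of _ s]) (simp del: mult_pCons_left)
qed

text \<open>The factor e of \<open>algebraic_int_piece\<close> is a unit at p and can be absorbed
  into the multiplier s.\<close>

lemma loc_int_piece:
  assumes int: "loc_int p (\<Sum>i<12. of_rat (a i) * \<theta> ^ i)" and e: "e dvd 12" "r < e" "\<not> p dvd e"
  shows "loc_int p (\<Sum>i | i < 12 \<and> i mod e = r. of_rat (a i) * \<theta> ^ i)"
proof -
  obtain s where s: "\<not> int p dvd s" "algebraic_int (of_int s * (\<Sum>i<12. of_rat (a i) * \<theta> ^ i))"
    using int by (auto simp: loc_int_def)
  then have "algebraic_int (\<Sum>i<12. of_rat (of_int s * a i) * \<theta> ^ i)"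
    by (simp add: sum_distrib_left of_rat_mult mult_ac)
  note algebraic_int_piece[OF this e(1,2)]
  also have "of_nat e * (\<Sum>i | i < 12 \<and> i mod e = r. of_rat (of_int s * a i) * \<theta> ^ i)
    = of_int (int e * s) * (\<Sum>i | i < 12 \<and> i mod e = r. of_rat (a i) * \<theta> ^ i)"
    by (simp add: sum_distrib_left of_rat_mult mult_ac)
  finally show ?thesis unfolding loc_int_def
    using s(1) e(3) p by (intro exI[of _ "int e * s"]) (simp add: prime_dvd_mult_iff)
qed

end

end

section \<open>From a triangular local basis to the index\<close>

lemma common_denominator:
  fixes a :: "nat \<Rightarrow> rat"
  obtains D :: int and c :: "nat \<Rightarrow> int" where "D \<noteq> 0" "\<And>i. i < n \<Longrightarrow> a i = of_int (c i) / of_int D"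
proof -
  have "\<exists>u v :: int. v \<noteq> 0 \<and> a i = of_int u / of_int v" for i
  proof (cases "a i" rule: Rat_cases)
    case (Fract u v)
    then show ?thesis by (intro exI[of _ u] exI[of _ v]) (simp add: Fract_of_int_quotient)
  qed
  then obtain u v where uv: "\<And>i. v i \<noteq> (0::int)" "\<And>i. a i = of_int (u i) / of_int (v i)"
    by metis
  define D where "D = (\<Prod>i<n. v i)"
  show thesis
  proof (rule that[of D "\<lambda>i. u i * (\<Prod>j\<in>{..<n}-{i}. v j)"])
    show "D \<noteq> 0" using uv(1) by (simp add: D_def)
    fix i assume "i < n"
    then have D: "D = v i * (\<Prod>j\<in>{..<n}-{i}. v j)" by (simp add: D_def prod.remove)
    have "(\<Prod>j\<in>{..<n}-{i}. v j) \<noteq> 0" using uv(1) by simp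
    then show "a i = of_int (u i * (\<Prod>j\<in>{..<n}-{i}. v j)) / of_int D"
      unfolding D uv(2)[of i] using uv(1)[of i] by (simp del: of_int_prod)
  qed
qed

lemma prime_power_decomposition:
  fixes D :: int
  assumes "prime p" "D \<noteq> 0"
  obtains s T where "D = int p ^ T * s" "\<not> int p dvd s"
proof -
  have "\<not> is_unit (int p)" using assms(1) by (auto dest: prime_gt_1_nat)
  then show thesis using multiplicity_decompose'[OF assms(2), of "int p"] that by metis
qed

lemma ring_of_integers_iff: "x \<in> ring_of_integers K \<longleftrightarrow> x \<in> K \<and> algebraic_int x"
  unfolding ring_of_integers_def integral_over_def algebraic_int.simps by auto

lemma integral_over_Zloc_of_algebraic_int:
  assumes "prime p" "algebraic_int x"
  shows "integral_over (Zloc p) x"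
proof -
  have "\<int> \<subseteq> Zloc p"
  proof
    fix y :: complex assume "y \<in> \<int>"
    then obtain n where "y = of_int n" by (elim Ints_cases)
    then show "y \<in> Zloc p" using prime_gt_1_nat[OF assms(1)]
      unfolding Zloc_def by (intro CollectI exI[of _ n] exI[of _ 1]) auto
  qed
  then show ?thesis using assms(2) unfolding integral_over_def algebraic_int.simps by blast
qed

lemma add_subgroup_Zpow_basis_span: "add_subgroup (Zpow_basis_span n \<theta>)"
  unfolding add_subgroup_def
proof (intro conjI ballI)
  show "0 \<in> Zpow_basis_span n \<theta>"
    unfolding Zpow_basis_span_def by (intro CollectI exI[of _ "\<lambda>_. 0"]) auto
  fix x y assume "x \<in> Zpow_basis_span n \<theta>" "y \<in> Zpow_basis_span n \<theta>"
  then obtain a c :: "nat \<Rightarrow> int" where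
    "x = (\<Sum>i<n. of_int (a i) * \<theta> ^ i)" "y = (\<Sum>i<n. of_int (c i) * \<theta> ^ i)"
    unfolding Zpow_basis_span_def by auto
  then show "x - y \<in> Zpow_basis_span n \<theta>"
    unfolding Zpow_basis_span_def
    by (intro CollectI exI[of _ "\<lambda>i. a i - c i"]) (auto simp: sum_subtractf ring_distribs)
qed

lemma power_in_Zpow_basis_span: "i < n \<Longrightarrow> \<theta> ^ i \<in> Zpow_basis_span n \<theta>"
  unfolding Zpow_basis_span_def
  by (intro CollectI exI[of _ "\<lambda>j. if j = i then 1 else 0"])
     (auto simp: if_distrib[of of_int] if_distrib[of "\<lambda>t. t * _"] cong: if_cong)

text \<open>Common interface of all cases: \<open>b i\<close> has leading term \<theta>^i / p^(k i),
  so \<open>k\<close> alone determines the p-part of the index. \<open>b_int\<close> asks for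
  algebraic integers, stronger than integrality at p, so that the \<open>b i\<close> can be adjoined
  inside O_K. \<open>b_span\<close> treats p-power denominators; the remaining part of a denominator
  is a unit at p and is cleared in \<open>loc_int_span\<close>.\<close>

locale pure12_triangular = pure12 +
  fixes p :: nat and b :: "nat \<Rightarrow> complex" and B :: "nat \<Rightarrow> nat \<Rightarrow> int" and k :: "nat \<Rightarrow> nat"
  assumes p: "prime p"
    and b_def: "\<And>i. i < 12 \<Longrightarrow> b i = ((\<Sum>j<i. of_int (B i j) * \<theta> ^ j) + \<theta> ^ i) / of_nat p ^ k i"
    and b_int: "\<And>i. i < 12 \<Longrightarrow> algebraic_int (b i)"
    and b_span: "\<And>\<alpha> T. loc_int p (\<Sum>i<12. of_int (\<alpha> i) / of_nat p ^ T * \<theta> ^ i) \<Longrightarrow>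
      \<exists>c :: nat \<Rightarrow> int. (\<Sum>i<12. of_int (\<alpha> i) / of_nat p ^ T * \<theta> ^ i) = (\<Sum>i<12. of_int (c i) * b i)"
begin

definition \<beta> :: "nat \<Rightarrow> nat \<Rightarrow> rat" where
  "\<beta> i j = (if j < i then of_int (B i j) else if j = i then 1 else 0) / of_nat p ^ k i"

lemma p_nonzero: "of_nat p \<noteq> (0::'z::semiring_char_0)"
  using prime_gt_0_nat[OF p] by simp

lemma b_coords:
  assumes "i < 12"
  shows "b i = (\<Sum>j<12. of_rat (\<beta> i j) * \<theta> ^ j)"
proof -
  have "(\<Sum>j<12. of_rat (\<beta> i j) * \<theta> ^ j) = (\<Sum>j<Suc i. of_rat (\<beta> i j) * \<theta> ^ j)"
    using assms by (intro sum.mono_neutral_right) (auto simp: \<beta>_def)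
  also have "\<dots> = (\<Sum>j<i. of_int (B i j) * \<theta> ^ j / of_nat p ^ k i) + \<theta> ^ i / of_nat p ^ k i"
    by (simp add: \<beta>_def of_rat_divide of_rat_power)
  also have "\<dots> = b i" by (simp add: b_def[OF assms] add_divide_distrib sum_divide_distrib)
  finally show ?thesis by simp
qed

lemma b_comb_coords: "(\<Sum>i<12. of_rat (r i) * b i) = (\<Sum>j<12. of_rat (\<Sum>i<12. r i * \<beta> i j) * \<theta> ^ j)"
proof -
  have "(\<Sum>i<12. of_rat (r i) * b i) = (\<Sum>i<12. \<Sum>j<12. of_rat (r i * \<beta> i j) * \<theta> ^ j)"
    by (intro sum.cong refl) (simp add: b_coords sum_distrib_left of_rat_mult mult.assoc)
  also have "\<dots> = (\<Sum>j<12. \<Sum>i<12. of_rat (r i * \<beta> i j) * \<theta> ^ j)" by (rule sum.swap)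
  finally show ?thesis by (simp only: of_rat_sum sum_distrib_right)
qed

text \<open>By triangularity only \<open>b j\<close> contributes to \<theta>^j once the later
  coefficients vanish. Both the independence of the \<open>b i\<close> and the order of
  \<open>b j\<close> modulo its predecessors rest on this comparison.\<close>

lemma top_coeff:
  assumes eq: "(\<Sum>i<12. of_rat (r i) * b i) = (\<Sum>i<12. of_rat (a i) * \<theta> ^ i)"
    and j: "j < 12" "\<And>i. j < i \<Longrightarrow> i < 12 \<Longrightarrow> r i = 0"
  shows "r j = a j * of_nat p ^ k j"
proof -
  have "(\<Sum>i<12. of_rat ((\<Sum>l<12. r l * \<beta> l i) - a i) * \<theta> ^ i) = 0"
    using eq unfolding b_comb_coords by (simp only: of_rat_diff left_diff_distrib sum_subtractf) simp
  from powers_independent[OF this j(1)] have "(\<Sum>l<12. r l * \<beta> l j) = a j" by simp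
  also have "(\<Sum>l<12. r l * \<beta> l j) = (\<Sum>l\<in>{j}. r l * \<beta> l j)"
    using j by (intro sum.mono_neutral_right) (auto simp: \<beta>_def not_less_iff_gr_or_eq)
  finally have "r j * \<beta> j j = a j" by simp
  then show ?thesis using p_nonzero[where 'z = rat] by (auto simp: \<beta>_def field_simps)
qed

lemma b_independent:
  assumes "(\<Sum>i<12. of_rat (r i) * b i) = 0" "i < 12"
  shows "r i = 0"
proof (rule ccontr)
  assume i: "r i \<noteq> 0"
  define S where "S = {i. i < 12 \<and> r i \<noteq> 0}"
  have S: "finite S" "S \<noteq> {}" using i assms(2) by (auto simp: S_def)
  define j where "j = Max S"
  have j: "j \<in> S" "\<And>i. i \<in> S \<Longrightarrow> i \<le> j" using S by (auto simp: j_def)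
  have "r j = 0 * of_nat p ^ k j"
  proof (rule top_coeff)
    show "(\<Sum>i<12. of_rat (r i) * b i) = (\<Sum>i<12. of_rat 0 * \<theta> ^ i)" using assms(1) by simp
    fix i assume "j < i" "i < 12"
    then show "r i = 0" using j(2)[of i] by (auto simp: S_def)
  qed (use j in \<open>auto simp: S_def\<close>)
  then show False using j by (simp add: S_def)
qed

lemma b_in_field:
  assumes "i < 12"
  shows "b i \<in> gen_field \<theta>"
proof -
  note F = subfield_closed[OF gen_field_subfield[of \<theta>]]
  have "of_int (B i j) * \<theta> ^ j \<in> gen_field \<theta>" for j
    by (rule F(5)[OF F(8) F(9)[OF gen_field_generator]])
  then have "(\<Sum>j<i. of_int (B i j) * \<theta> ^ j) + \<theta> ^ i \<in> gen_field \<theta>"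
    by (rule F(3)[OF F(10) F(9)[OF gen_field_generator]])
  then show ?thesis unfolding b_def[OF assms] by (rule F(6)[OF _ F(9)[OF F(7)]])
qed

text \<open>The common denominator of the coordinates is split into a power of p, which stays in the
  coefficients, and a part s prime to p, which moves to the left-hand side.\<close>

lemma loc_int_span:
  assumes "x \<in> gen_field \<theta>" "loc_int p x"
  obtains s and c :: "nat \<Rightarrow> int" where "\<not> int p dvd s" "of_int s * x = (\<Sum>i<12. of_int (c i) * b i)"
proof -
  obtain a where a: "x = (\<Sum>i<12. of_rat (a i) * \<theta> ^ i)" using gen_field_coords assms(1) by blast
  obtain D c where D: "D \<noteq> 0" "\<And>i. i < 12 \<Longrightarrow> a i = of_int (c i) / of_int D"
    using common_denominator[of 12 a] by blast
  obtain s T where s: "D = int p ^ T * s" "\<not> int p dvd s"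
    using prime_power_decomposition[OF p D(1)] by blast
  have "s \<noteq> 0" using s by auto
  have "of_int s * x = (\<Sum>i<12. of_int (c i) / of_nat p ^ T * \<theta> ^ i)"
    unfolding a sum_distrib_left
    using \<open>s \<noteq> 0\<close> by (intro sum.cong) (auto simp: D(2) s(1) of_rat_divide of_rat_mult of_rat_power)
  moreover have "loc_int p (of_int s * x)" by (intro loc_int_mult[OF p] assms loc_int_of_int[OF p])
  ultimately obtain c' :: "nat \<Rightarrow> int" where "of_int s * x = (\<Sum>i<12. of_int (c' i) * b i)"
    using b_span[of c T] by auto
  then show thesis using that s by blast
qed

lemma p_integral_basis: "p_integral_basis p (gen_field \<theta>) 12 b"
  unfolding p_integral_basis_def
proof (intro conjI allI impI ballI)
  fix i :: nat assume "i < 12"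
  then show "b i \<in> loc_integral_closure p (gen_field \<theta>)"
    unfolding loc_integral_closure_def
    using b_in_field b_int integral_over_Zloc_of_algebraic_int[OF p] by blast
next
  fix x assume "x \<in> loc_integral_closure p (gen_field \<theta>)"
  then have "x \<in> gen_field \<theta>" "loc_int p x"
    using loc_int_of_integral_over_Zloc[OF p] by (auto simp: loc_integral_closure_def)
  then obtain s and c :: "nat \<Rightarrow> int" where s: "\<not> int p dvd s" "of_int s * x = (\<Sum>i<12. of_int (c i) * b i)"
    using loc_int_span by blast
  have "s \<noteq> 0" using s by auto
  have "x = (of_int s * x) / of_int s" using \<open>s \<noteq> 0\<close> by simp
  also have "\<dots> = (\<Sum>i<12. of_int (c i) / of_int s * b i)"
    unfolding s(2) by (simp add: sum_divide_distrib)
  finally have "x = (\<Sum>i<12. of_int (c i) / of_int s * b i)" .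
  moreover have "of_int (c i) / of_int s \<in> Zloc p" for i
    using s(1) \<open>s \<noteq> 0\<close> unfolding Zloc_def by blast
  ultimately show "\<exists>c. (\<forall>i<12. c i \<in> Zloc p) \<and> x = (\<Sum>i<12. c i * b i)"
    by (intro exI[of _ "\<lambda>i. of_int (c i) / of_int s"]) auto
next
  fix c i assume c: "(\<forall>i<12. c i \<in> Zloc p) \<and> (\<Sum>i<12. c i * b i) = 0" and i: "i < (12::nat)"
  have "\<exists>r. c i = of_rat r" if "i < 12" for i
  proof -
    have "c i \<in> Zloc p" using c that by blast
    then obtain u v :: int where "c i = of_int u / of_int v" unfolding Zloc_def by auto
    then show ?thesis by (intro exI[of _ "of_int u / of_int v"]) (simp add: of_rat_divide)
  qed
  then obtain r where r: "\<And>i. i < 12 \<Longrightarrow> c i = of_rat (r i)" by metis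
  then have "(\<Sum>i<12. of_rat (r i) * b i) = 0" using c by simp
  then show "c i = 0" using b_independent i r by simp
qed

section \<open>The p-part of the index, by successive adjunction\<close>

abbreviation "O\<^sub>K \<equiv> ring_of_integers (gen_field \<theta>)"
abbreviation "Z\<theta> \<equiv> Zpow_basis_span 12 \<theta>"

text \<open>Adjoining one \<open>b j\<close> at a time makes each intermediate index the order of a
  single element, p^(k j), so that the exponents simply add up.\<close>

primrec M :: "nat \<Rightarrow> complex set" where
  "M 0 = Z\<theta>"
| "M (Suc j) = adjoin (M j) (b j)"

lemma M_subgroup: "add_subgroup (M j)"
  by (induction j) (auto simp: add_subgroup_Zpow_basis_span adjoin_subgroup)

lemma Z\<theta>_subset_M: "Z\<theta> \<subseteq> M j"
  by (induction j) (use subset_adjoin in auto)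

lemma M_coords:
  assumes "x \<in> M j"
  obtains a c :: "nat \<Rightarrow> int" where "x = (\<Sum>i<12. of_int (a i) * \<theta> ^ i) + (\<Sum>i<j. of_int (c i) * b i)"
  using assms
proof (induction j arbitrary: x thesis)
  case 0
  then show ?case by (auto simp: Zpow_basis_span_def)
next
  case (Suc j)
  from Suc.prems(2) obtain n y where y: "x = of_int n * b j + y" "y \<in> M j" by (auto simp: adjoin_def)
  obtain a c :: "nat \<Rightarrow> int" where "y = (\<Sum>i<12. of_int (a i) * \<theta> ^ i) + (\<Sum>i<j. of_int (c i) * b i)"
    using Suc.IH y(2) by blast
  then have "x = (\<Sum>i<12. of_int (a i) * \<theta> ^ i) + (\<Sum>i<Suc j. of_int ((c(j := n)) i) * b i)"
    using y(1) by simp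
  then show ?case using Suc.prems(1) by blast
qed

lemma b_in_M: "i < j \<Longrightarrow> b i \<in> M j"
proof (induction j)
  case (Suc j)
  show ?case
  proof (cases "i < j")
    case True
    then show ?thesis using Suc.IH subset_adjoin by auto
  next
    case False
    then have "i = j" using Suc.prems by simp
    moreover have "b j \<in> adjoin (M j) (b j)"
      using add_subgroupD(1)[OF M_subgroup[of j]] unfolding adjoin_def
      by (intro CollectI exI[of _ 1] exI[of _ 0]) auto
    ultimately show ?thesis by simp
  qed
qed auto

lemma O_subgroup: "add_subgroup O\<^sub>K"
  unfolding add_subgroup_def
proof (intro conjI ballI)
  show "0 \<in> O\<^sub>K" by (simp add: ring_of_integers_iff subfield_closed(1)[OF gen_field_subfield])
  fix x y assume "x \<in> O\<^sub>K" "y \<in> O\<^sub>K"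
  then show "x - y \<in> O\<^sub>K"
    unfolding ring_of_integers_iff using subfield_closed(4)[OF gen_field_subfield] algebraic_int_diff by blast
qed

lemma theta_power_in_O: "\<theta> ^ i \<in> O\<^sub>K"
  unfolding ring_of_integers_iff
  using subfield_closed(9)[OF gen_field_subfield gen_field_generator] algebraic_int_power[OF algebraic_int_theta]
  by simp

text \<open>The numerator of \<open>b j\<close> lies in Z[\<theta>], so p^(k j) suffices.
  Conversely, a relation over \<open>M j\<close> involves only earlier \<open>b i\<close> besides an
  element of Z[\<theta>], and comparing the coefficients of \<theta>^j shows that n / p^(k j) is an
  integer.\<close>

lemma b_order:
  assumes "j < 12"
  shows "of_int n * b j \<in> M j \<longleftrightarrow> int (p ^ k j) dvd n"
proof
  assume "int (p ^ k j) dvd n"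
  then obtain q where q: "n = int p ^ k j * q" by auto
  have "of_int n * b j = (of_int q :: complex) * ((\<Sum>l<j. of_int (B j l) * \<theta> ^ l) + \<theta> ^ j)"
    using p_nonzero[where 'z = complex] by (simp add: b_def[OF assms] q)
  also have "\<dots> \<in> Z\<theta>"
    using assms
    by (intro add_subgroupD(5)[OF add_subgroup_Zpow_basis_span] add_subgroupD(4)[OF add_subgroup_Zpow_basis_span]
        add_subgroupD(6)[OF add_subgroup_Zpow_basis_span] power_in_Zpow_basis_span) auto
  finally show "of_int n * b j \<in> M j" using Z\<theta>_subset_M by blast
next
  assume "of_int n * b j \<in> M j"
  then obtain a c :: "nat \<Rightarrow> int" where ac: "of_int n * b j = (\<Sum>i<12. of_int (a i) * \<theta> ^ i) + (\<Sum>i<j. of_int (c i) * b i)"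
    using M_coords by blast
  define r :: "nat \<Rightarrow> rat" where "r i = (if i < j then - of_int (c i) else if i = j then of_int n else 0)" for i
  have "(\<Sum>i<12. of_rat (r i) * b i) = (\<Sum>i<Suc j. of_rat (r i) * b i)"
    using assms by (intro sum.mono_neutral_right) (auto simp: r_def)
  also have "\<dots> = of_int n * b j - (\<Sum>i<j. of_int (c i) * b i)"
    by (simp add: r_def of_rat_minus sum_negf)
  also have "\<dots> = (\<Sum>i<12. of_rat (of_int (a i)) * \<theta> ^ i)" by (simp add: ac)
  finally have "r j = of_int (a j) * of_nat p ^ k j"
    by (rule top_coeff) (use assms in \<open>auto simp: r_def\<close>)
  then have "(of_int n :: rat) = of_int (a j * int p ^ k j)" by (simp add: r_def)
  then have "n = a j * int p ^ k j" by (simp only: of_int_eq_iff)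
  then show "int (p ^ k j) dvd n" by simp
qed

lemma O_coords:
  assumes "x \<in> O\<^sub>K"
  obtains c :: "nat \<Rightarrow> int" where "of_int (12 * m) * x = (\<Sum>i<12. of_int (c i) * \<theta> ^ i)"
proof -
  have x: "x \<in> gen_field \<theta>" "algebraic_int x" using assms by (auto simp: ring_of_integers_iff)
  obtain a where a: "x = (\<Sum>i<12. of_rat (a i) * \<theta> ^ i)" using gen_field_coords x(1) by blast
  have "\<exists>n :: int. 12 * of_int m * a i = of_int n" if "i < 12" for i
    using algebraic_int_coord[OF x(2)[unfolded a] that] by metis
  then obtain c :: "nat \<Rightarrow> int" where c: "\<And>i. i < 12 \<Longrightarrow> 12 * of_int m * a i = of_int (c i)" by metis
  have "of_int (12 * m) * x = (\<Sum>i<12. of_rat (12 * of_int m * a i) * \<theta> ^ i)"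
    by (simp add: a sum_distrib_left of_rat_mult mult.assoc)
  also have "\<dots> = (\<Sum>i<12. of_int (c i) * \<theta> ^ i)" by (intro sum.cong) (auto simp: c)
  finally show thesis using that by blast
qed

lemma finite_cosets_Z\<theta>: "finite (coset Z\<theta> ` O\<^sub>K)"
proof (rule finite_cosets[OF add_subgroup_Zpow_basis_span, of "\<bar>12 * m\<bar>" 12 "\<lambda>i. \<theta> ^ i / of_int (12 * m)"])
  show "\<bar>12 * m\<bar> > 0" using m_nonzero by simp
  show "of_int \<bar>12 * m\<bar> * (\<theta> ^ i / of_int (12 * m)) \<in> Z\<theta>" if "i < 12" for i
  proof -
    have "of_int \<bar>12 * m\<bar> * (\<theta> ^ i / of_int (12 * m)) = of_int (sgn m) * \<theta> ^ i"
      using m_nonzero by (cases "m > 0") auto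
    then show ?thesis
      using add_subgroupD(5)[OF add_subgroup_Zpow_basis_span power_in_Zpow_basis_span[OF that]] by simp
  qed
  fix x assume "x \<in> O\<^sub>K"
  then obtain c :: "nat \<Rightarrow> int" where c: "of_int (12 * m) * x = (\<Sum>i<12. of_int (c i) * \<theta> ^ i)"
    using O_coords by blast
  have "x = (of_int (12 * m) * x) / of_int (12 * m)" using m_nonzero by simp
  then show "\<exists>c :: nat \<Rightarrow> int. x = (\<Sum>i<12. of_int (c i) * (\<theta> ^ i / of_int (12 * m)))"
    unfolding c by (auto simp: sum_divide_distrib)
qed

lemma M_index:
  assumes "j \<le> 12"
  shows "M j \<subseteq> O\<^sub>K \<and> finite (coset (M j) ` O\<^sub>K) \<and>
    subgroup_index O\<^sub>K Z\<theta> = subgroup_index O\<^sub>K (M j) * p ^ (\<Sum>i<j. k i)"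
  using assms
proof (induction j)
  case 0
  have "Z\<theta> \<subseteq> O\<^sub>K"
  proof
    fix x assume "x \<in> Z\<theta>"
    then obtain a :: "nat \<Rightarrow> int" where x: "x = (\<Sum>i<12. of_int (a i) * \<theta> ^ i)"
      unfolding Zpow_basis_span_def by auto
    show "x \<in> O\<^sub>K" unfolding x
      by (rule add_subgroupD(6)[OF O_subgroup], rule add_subgroupD(5)[OF O_subgroup], rule theta_power_in_O)
  qed
  then show ?case using finite_cosets_Z\<theta> by simp
next
  case (Suc j)
  then have j: "j < 12" and IH: "M j \<subseteq> O\<^sub>K" "finite (coset (M j) ` O\<^sub>K)"
    "subgroup_index O\<^sub>K Z\<theta> = subgroup_index O\<^sub>K (M j) * p ^ (\<Sum>i<j. k i)" by auto
  have b: "b j \<in> O\<^sub>K" using b_in_field[OF j] b_int[OF j] by (simp add: ring_of_integers_iff)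
  have "p ^ k j > 0" using p by (auto dest: prime_gt_0_nat)
  note st = subgroup_index_adjoin[OF O_subgroup M_subgroup IH(1) b this b_order[OF j] IH(2)]
  show ?case
  proof (intro conjI)
    show "M (Suc j) \<subseteq> O\<^sub>K" using adjoin_subset[OF O_subgroup IH(1) b] by simp
    show "finite (coset (M (Suc j)) ` O\<^sub>K)" using st(2) by simp
    have "subgroup_index O\<^sub>K Z\<theta> = subgroup_index O\<^sub>K (M (Suc j)) * p ^ k j * p ^ (\<Sum>i<j. k i)"
      unfolding IH(3) st(1) by simp
    then show "subgroup_index O\<^sub>K Z\<theta> = subgroup_index O\<^sub>K (M (Suc j)) * p ^ (\<Sum>i<Suc j. k i)"
      by (simp add: power_add mult_ac)
  qed
qed

lemma multiplicity_index: "multiplicity p (subgroup_index O\<^sub>K Z\<theta>) = (\<Sum>i<12. k i)"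
proof -
  note M = M_index[OF order.refl]
  obtain s T where s: "12 * m = int p ^ T * s" "\<not> int p dvd s"
    using prime_power_decomposition[OF p, of "12 * m"] m_nonzero by (metis mult_eq_0_iff zero_neq_numeral)
  have "s \<noteq> 0" using s by auto
  \<comment> \<open>Multiplication by s takes O_K into \<open>M 12\<close>: of the denominator 12 m
    = p^T s only p^T remains, and \<open>b_span\<close> applies. So an integer prime to p kills the
    quotient of O_K by \<open>M 12\<close>.\<close>
  have "\<not> p dvd subgroup_index O\<^sub>K (M 12)"
  proof (rule subgroup_index_coprime[OF O_subgroup M_subgroup])
    show "M 12 \<subseteq> O\<^sub>K" "finite (coset (M 12) ` O\<^sub>K)" using M by blast+
    show "nat \<bar>s\<bar> > 0" using \<open>s \<noteq> 0\<close> by simp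
    show "\<not> p dvd nat \<bar>s\<bar>" using s(2) by (simp flip: int_dvd_int_iff)
    fix x assume x: "x \<in> O\<^sub>K"
    then obtain c :: "nat \<Rightarrow> int" where c: "of_int (12 * m) * x = (\<Sum>i<12. of_int (c i) * \<theta> ^ i)"
      using O_coords by blast
    have "of_int s * x = (of_int (12 * m) * x) / of_nat p ^ T"
      using p_nonzero[where 'z = complex] by (simp add: s(1))
    also have "\<dots> = (\<Sum>i<12. of_int (c i) / of_nat p ^ T * \<theta> ^ i)"
      unfolding c by (simp add: sum_divide_distrib)
    finally have sx: "of_int s * x = (\<Sum>i<12. of_int (c i) / of_nat p ^ T * \<theta> ^ i)" .
    have "loc_int p (of_int s * x)"
      using x by (intro loc_int_mult[OF p] loc_int_of_int[OF p] loc_int_algebraic_int[OF p])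
        (simp add: ring_of_integers_iff)
    from b_span[OF this[unfolded sx]]
    obtain c' :: "nat \<Rightarrow> int" where "of_int s * x = (\<Sum>i<12. of_int (c' i) * b i)"
      unfolding sx by blast
    also have "\<dots> \<in> M 12"
      by (rule add_subgroupD(6)[OF M_subgroup], rule add_subgroupD(5)[OF M_subgroup], rule b_in_M) simp
    finally have "of_int (sgn s) * (of_int s * x) \<in> M 12" by (rule add_subgroupD(5)[OF M_subgroup])
    moreover have "of_int (sgn s) * (of_int s * x) = of_nat (nat \<bar>s\<bar>) * x"
      by (cases "s > 0") (auto simp: sgn_if)
    ultimately show "of_nat (nat \<bar>s\<bar>) * x \<in> M 12" by simp
  qed (rule p)
  moreover have "subgroup_index O\<^sub>K Z\<theta> = subgroup_index O\<^sub>K (M 12) * p ^ (\<Sum>i<12. k i)"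
    using M by blast
  ultimately have "multiplicity p (subgroup_index O\<^sub>K Z\<theta>) = multiplicity p (p ^ (\<Sum>i<12. k i))"
    using multiplicity_prime_elem_times_other[OF prime_imp_prime_elem[OF p]] by metis
  also have "\<dots> = (\<Sum>i<12. k i)"
    by (rule multiplicity_same_power) (use p not_prime_unit in auto)
  finally show ?thesis .
qed

end

section \<open>Tamely ramified primes\<close>

lemma sum_residue_class:
  fixes g :: "nat \<Rightarrow> 'a::comm_monoid_add"
  assumes "e * n = N" "r < e"
  shows "(\<Sum>i | i < N \<and> i mod e = r. g i) = (\<Sum>k<n. g (r + e * k))"
proof (rule sum.reindex_bij_witness[of _ "\<lambda>k. r + e * k" "\<lambda>i. i div e"])
  fix k assume k: "k \<in> {..<n}"
  have "r + e * k < e * Suc k" using assms(2) by simp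
  also have "\<dots> \<le> e * n" using k by (intro mult_le_mono) auto
  finally show "r + e * k \<in> {i. i < N \<and> i mod e = r}" using assms by simp
  show "(r + e * k) div e = k" using assms(2) by simp
next
  fix i assume "i \<in> {i. i < N \<and> i mod e = r}"
  then have i: "i < N" "i mod e = r" by auto
  show *: "r + e * (i div e) = i" using i(2) mod_mult_div_eq[of i e] by simp
  show "i div e \<in> {..<n}" using i(1) assms(1) by (simp add: less_mult_imp_div_less mult.commute)
  show "g (r + e * (i div e)) = g i" using * by simp
qed

context pure12
begin

text \<open>The twelvefold valuation of the j-th term is 12 E_j - 12 T + j v. If it agrees for j and
  l, then g divides v (j - l), hence j - l as g is prime to v. Within a residue class modulo e also
  e divides j - l, so 12 does and j = l. Thus \<open>distinct_valuations_nonneg\<close> bounds each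
  term separately.\<close>

lemma distinct_valuations_coord:
  assumes p: "prime p" and e: "e * g = 12" "coprime e g" "\<not> p dvd e"
    and v: "v = multiplicity (int p) m" "coprime g v"
    and int: "loc_int p (\<Sum>i<12. of_int (\<alpha> i) / of_nat p ^ T * \<theta> ^ i)" and i: "i < 12"
  shows "int p ^ T dvd \<alpha> i * int p ^ (i * v div 12)"
proof (cases "\<alpha> i = 0")
  case False
  have e0: "e > 0" using e(1) by (cases e) auto
  have pc: "of_nat p \<noteq> (0::complex)" using prime_gt_0_nat[OF p] by simp
  have np: "\<not> is_unit (int p)" using prime_gt_1_nat[OF p] by auto
  define r where "r = i mod e"
  have r: "r < e" using e0 by (simp add: r_def)
  define I where "I = {j. j < 12 \<and> j mod e = r \<and> \<alpha> j \<noteq> 0}"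
  define t where "t j = of_int (\<alpha> j) / of_nat p ^ T * \<theta> ^ j" for j
  define E where "E j = multiplicity (int p) (\<alpha> j)" for j
  define w where "w j = 12 * int (E j) - 12 * int T + int (j * v)" for j
  obtain \<mu> where \<mu>: "m = int p ^ v * \<mu>" "\<not> int p dvd \<mu>"
    using multiplicity_decompose'[OF m_nonzero np] v(1) by metis
  have "loc_int p (\<Sum>i<12. of_rat (of_int (\<alpha> i) / of_nat p ^ T) * \<theta> ^ i)"
    using int by (simp add: of_rat_divide of_rat_power)
  moreover have "e dvd 12" by (metis dvd_triv_left e(1))
  ultimately have "loc_int p (\<Sum>i | i < 12 \<and> i mod e = r. of_rat (of_int (\<alpha> i) / of_nat p ^ T) * \<theta> ^ i)"
    by (rule loc_int_piece[OF p _ _ r e(3)])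
  then have "loc_int p (\<Sum>i | i < 12 \<and> i mod e = r. t i)"
    by (simp add: t_def of_rat_divide of_rat_power)
  also have "(\<Sum>i | i < 12 \<and> i mod e = r. t i) = sum t I"
    by (intro sum.mono_neutral_right) (auto simp: I_def t_def)
  finally have sum: "loc_int p (sum t I)" .
  have "w i \<ge> 0"
  proof (rule distinct_valuations_nonneg[OF p, where I = I and w = w and t = t and n = 12])
    show "inj_on w I"
    proof (rule inj_onI)
      fix j l assume j: "j \<in> I" "l \<in> I" and "w j = w l"
      then have "int v * (int j - int l) = 12 * (int (E l) - int (E j))"
        by (simp add: w_def algebra_simps)
      also have "\<dots> = int g * (int e * (int (E l) - int (E j)))"
        using e(1) by (simp flip: of_nat_mult add: mult.assoc[symmetric] mult.commute[of g e])
      finally have "int g dvd int v * (int j - int l)" by simp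
      then have g: "int g dvd int j - int l"
        using v(2) by (simp add: coprime_dvd_mult_right_iff)
      have "int j mod int e = int l mod int e"
        using j by (simp add: I_def flip: of_nat_mod)
      then have "int e dvd int j - int l" by (simp add: mod_eq_dvd_iff)
      with g have "int e * int g dvd int j - int l"
        using e(2) by (simp add: divides_mult)
      also have "int e * int g = 12" using e(1) by (simp flip: of_nat_mult)
      finally have "12 dvd int j - int l" .
      moreover have "j < 12" "l < 12" using j by (auto simp: I_def)
      ultimately show "j = l" by presburger
    qed
    fix j assume j: "j \<in> I"
    then have "\<alpha> j \<noteq> 0" by (simp add: I_def)
    then obtain u where u: "\<alpha> j = int p ^ E j * u" "\<not> int p dvd u"
      using multiplicity_decompose'[OF _ np] unfolding E_def by metis
    have "t j ^ 12 = of_int (\<alpha> j) ^ 12 * of_int m ^ j / of_nat p ^ (12 * T)"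
      by (simp add: t_def power_divide power_mult_distrib power_mult[symmetric] root[symmetric] mult.commute)
    also have "\<dots> = of_nat p ^ (12 * E j + j * v) / of_nat p ^ (12 * T) * of_int (u ^ 12 * \<mu> ^ j)"
      by (simp add: u(1) \<mu>(1) power_mult_distrib power_add power_mult[symmetric] mult_ac)
    finally have "t j ^ 12 = of_nat p ^ (12 * E j + j * v) / of_nat p ^ (12 * T) * of_int (u ^ 12 * \<mu> ^ j)" .
    moreover have "of_nat p ^ (12 * E j + j * v) / of_nat p ^ (12 * T) = (of_nat p :: complex) powi w j"
    proof -
      have "w j = int (12 * E j + j * v) - int (12 * T)" by (simp add: w_def)
      then show ?thesis by (simp only: power_int_diff[OF disjI1[OF pc]] power_int_of_nat)
    qed
    moreover have "\<not> int p dvd u ^ 12 * \<mu> ^ j"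
      using u(2) \<mu>(2) p by (meson prime_dvd_mult_iff prime_dvd_power prime_nat_int_transfer)
    ultimately show "\<exists>a b. \<not> int p dvd a \<and> \<not> int p dvd b \<and> t j ^ 12 = of_nat p powi w j * (of_int a / of_int b)"
      using np by (intro exI[of _ "u ^ 12 * \<mu> ^ j"] exI[of _ 1]) auto
  qed (use sum i False in \<open>auto simp: I_def r_def\<close>)
  then have "int (12 * T) \<le> int (12 * E i + i * v)" by (simp add: w_def)
  then have "12 * T \<le> 12 * E i + i * v" by (simp only: of_nat_le_iff)
  \<comment> \<open>T - E is an integer, so division by 12 rounds i v / 12 down; this is the origin
    of the floor in the basis.\<close>
  then have "T \<le> E i + i * v div 12" by linarith
  then have "int p ^ T dvd int p ^ (E i + i * v div 12)" by (rule le_imp_power_dvd)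
  also have "\<dots> dvd \<alpha> i * int p ^ (i * v div 12)"
    unfolding power_add by (intro mult_dvd_mono) (auto simp: E_def multiplicity_dvd)
  finally show ?thesis .
qed auto

lemma tame_basis:
  assumes p: "prime p" and e: "e * g = 12" "coprime e g" "\<not> p dvd e"
    and v: "v = multiplicity (int p) m" "coprime g v"
  shows "pure12_triangular m \<theta> p (\<lambda>i. \<theta> ^ i / of_nat p ^ (i * v div 12)) (\<lambda>_ _. 0) (\<lambda>i. i * v div 12)"
proof
  have pc: "of_nat p \<noteq> (0::complex)" using prime_gt_0_nat[OF p] by simp
  show "prime p" by (fact p)
  fix i :: nat assume i: "i < 12"
  show "\<theta> ^ i / of_nat p ^ (i * v div 12) = ((\<Sum>j<i. of_int 0 * \<theta> ^ j) + \<theta> ^ i) / of_nat p ^ (i * v div 12)"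
    by simp
  \<comment> \<open>Integrality is checked on the 12-th power m^i / p^(12 k) with k the floor of i v
    / 12, an integer because p^v divides m.\<close>
  have "int p ^ (12 * (i * v div 12)) dvd int p ^ (i * v)" by (intro le_imp_power_dvd) simp
  also have "int p ^ (i * v) = (int p ^ v) ^ i" by (simp add: mult.commute flip: power_mult)
  also have "\<dots> dvd m ^ i"
    unfolding v(1) by (intro dvd_power_same multiplicity_dvd)
  finally obtain n where "m ^ i = int p ^ (12 * (i * v div 12)) * n" by auto
  then have "(of_int m :: complex) ^ i = of_nat p ^ (12 * (i * v div 12)) * of_int n"
    by (metis of_int_mult of_int_power of_int_of_nat_eq)
  moreover have "(\<theta> ^ i / of_nat p ^ (i * v div 12)) ^ 12 = of_int m ^ i / of_nat p ^ (12 * (i * v div 12))"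
    by (simp add: power_divide power_mult[symmetric] root[symmetric] mult.commute)
  ultimately have "(\<theta> ^ i / of_nat p ^ (i * v div 12)) ^ 12 = of_int n" using pc by simp
  then show "algebraic_int (\<theta> ^ i / of_nat p ^ (i * v div 12))"
    using algebraic_int_of_power[of _ 12] by simp
next
  have pc: "of_nat p \<noteq> (0::complex)" using prime_gt_0_nat[OF p] by simp
  fix \<alpha> :: "nat \<Rightarrow> int" and T
  assume "loc_int p (\<Sum>i<12. of_int (\<alpha> i) / of_nat p ^ T * \<theta> ^ i)"
  then have "\<exists>c. \<alpha> i * int p ^ (i * v div 12) = int p ^ T * c" if "i < 12" for i
    using distinct_valuations_coord[OF p e v] that by blast
  then obtain c where c: "\<And>i. i < 12 \<Longrightarrow> \<alpha> i * int p ^ (i * v div 12) = int p ^ T * c i" by metis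
  have "of_int (\<alpha> i) / of_nat p ^ T * \<theta> ^ i = of_int (c i) * (\<theta> ^ i / of_nat p ^ (i * v div 12))" if "i < 12" for i
  proof -
    have "(of_int (\<alpha> i) * of_nat p ^ (i * v div 12) :: complex) = of_nat p ^ T * of_int (c i)"
      using arg_cong[OF c[OF that], of of_int] by simp
    then show ?thesis using pc by (simp add: field_simps)
  qed
  then show "\<exists>c :: nat \<Rightarrow> int. (\<Sum>i<12. of_int (\<alpha> i) / of_nat p ^ T * \<theta> ^ i)
      = (\<Sum>i<12. of_int (c i) * (\<theta> ^ i / of_nat p ^ (i * v div 12)))"
    by (intro exI[of _ c] sum.cong) auto
qed

text \<open>Away from m, \<theta>^r is a unit with inverse \<theta>^(12 - r) / m. The partial sum
  over the class of r can therefore be shifted to the class of 0, where it lies in the subfield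
  generated by \<theta>^e.\<close>

lemma unit_piece:
  assumes p: "prime p" and m: "\<not> int p dvd m" and e: "e * g = 12" "\<not> p dvd e" "r < e"
    and int: "loc_int p (\<Sum>i<12. of_int (\<alpha> i) / of_nat p ^ T * \<theta> ^ i)"
  shows "loc_int p (\<Sum>k<g. of_int (\<alpha> (r + e * k)) / of_nat p ^ T * \<theta> ^ (e * k))"
proof (rule loc_int_cancel[OF p m])
  let ?a = "\<lambda>i. of_int (\<alpha> i) / of_nat p ^ T :: complex"
  have a: "of_rat (of_int (\<alpha> i) / of_nat p ^ T) = ?a i" for i by (simp add: of_rat_divide of_rat_power)
  have "e dvd 12" by (metis dvd_triv_left e(1))
  then have "loc_int p (\<Sum>i | i < 12 \<and> i mod e = r. ?a i * \<theta> ^ i)"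
    using loc_int_piece[OF p, of "\<lambda>i. of_int (\<alpha> i) / of_nat p ^ T" e r] int e by (auto simp: a)
  then have "loc_int p (\<Sum>k<g. ?a (r + e * k) * \<theta> ^ (r + e * k))"
    using sum_residue_class[OF e(1,3), of "\<lambda>i. ?a i * \<theta> ^ i"] by simp
  then have "loc_int p ((\<Sum>k<g. ?a (r + e * k) * \<theta> ^ (r + e * k)) * \<theta> ^ (12 - r))"
    by (intro loc_int_mult[OF p] loc_int_power[OF p] loc_int_theta[OF p])
  also have "(\<Sum>k<g. ?a (r + e * k) * \<theta> ^ (r + e * k)) * \<theta> ^ (12 - r)
    = (\<Sum>k<g. ?a (r + e * k) * \<theta> ^ (e * k) * (\<theta> ^ r * \<theta> ^ (12 - r)))"
    unfolding sum_distrib_right power_add by (intro sum.cong refl) (simp only: mult_ac)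
  also have "\<theta> ^ r * \<theta> ^ (12 - r) = of_int m"
  proof -
    have "r \<le> 12" using e by (metis dvd_imp_le dvd_triv_left less_imp_le le_trans zero_less_numeral)
    then show ?thesis using root by (simp flip: power_add)
  qed
  finally show "loc_int p (of_int m * (\<Sum>k<g. ?a (r + e * k) * \<theta> ^ (e * k)))"
    by (simp add: sum_distrib_left mult_ac)
qed

end

section \<open>The wild primes 2 and 3\<close>

lemma three_dvd_cube_minus: "(3::int) dvd x ^ 3 - x"
proof -
  define q r where "q = x div 3" and "r = x mod 3"
  have x: "x = 3 * q + r" and r: "r = 0 \<or> r = 1 \<or> r = 2" unfolding q_def r_def by presburger+
  have "x ^ 3 - x = 3 * (9 * q ^ 3 + 9 * q\<^sup>2 * r + 3 * q * r\<^sup>2 - q) + (r ^ 3 - r)"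
    unfolding x by (simp add: algebra_simps power2_eq_square power3_eq_cube)
  moreover have "3 dvd r ^ 3 - r" using r by auto
  ultimately show ?thesis by (metis dvd_add dvd_triv_left)
qed

lemma three_dvd_square_minus_one:
  assumes "\<not> (3::int) dvd x" shows "3 dvd x\<^sup>2 - 1"
proof -
  have "x * (x\<^sup>2 - 1) = x ^ 3 - x" by (simp add: algebra_simps power2_eq_square power3_eq_cube)
  then have "3 dvd x * (x\<^sup>2 - 1)" using three_dvd_cube_minus by simp
  then show ?thesis using assms by (simp add: prime_dvd_mult_iff)
qed

text \<open>The hypotheses express integrality of the second symmetric function and of the norm of
  (A + B x + C x^2)/3 with x^3 = m. Modulo 3 the norm condition reads A + m B + C = 0, and then the
  other one becomes (m B - C)^2 = 0; this fixes A and B in terms of C. A second look at the norm,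
  now modulo 27, decides about C.\<close>

lemma cubic_congruences:
  fixes A B C m :: int
  assumes m: "\<not> 3 dvd m" and 1: "3 dvd A\<^sup>2 - m * B * C"
    and 2: "27 dvd A ^ 3 + m * B ^ 3 + m\<^sup>2 * C ^ 3 - 3 * m * A * B * C"
  shows "3 dvd A - C" "3 dvd B - m * C" "\<not> 9 dvd m\<^sup>2 - 1 \<Longrightarrow> 3 dvd C"
proof -
  obtain k where k: "m\<^sup>2 = 1 + 3 * k" using three_dvd_square_minus_one[OF m] by (auto simp: dvd_def algebra_simps)
  obtain a b c where cubes: "A ^ 3 = A + 3 * a" "B ^ 3 = B + 3 * b" "C ^ 3 = C + 3 * c"
    using three_dvd_cube_minus[of A] three_dvd_cube_minus[of B] three_dvd_cube_minus[of C]
    by (auto simp: dvd_def algebra_simps)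
  obtain n where n: "A ^ 3 + m * B ^ 3 + m\<^sup>2 * C ^ 3 - 3 * m * A * B * C = 27 * n" using 2 by auto
  \<comment> \<open>Since t^3 = t and m^2 = 1 modulo 3, the norm is linear modulo 3; l collects the
    multiples of 3.\<close>
  define l where "l = 9 * n + m * A * B * C - a - m * b - c - k * C - 3 * k * c"
  have A: "A = 3 * l - m * B - C" using n unfolding cubes k l_def by Groebner_Basis.algebra
  have "A\<^sup>2 - m * B * C = (m * B - C)\<^sup>2 + 3 * (3 * l\<^sup>2 - 2 * l * (m * B + C) + m * B * C)"
    unfolding A by Groebner_Basis.algebra
  then have "3 dvd (m * B - C)\<^sup>2" using 1 by (metis dvd_add_left_iff dvd_triv_left)
  then have d: "3 dvd m * B - C" by (simp add: prime_dvd_power_iff)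
  have "m * (m * B - C) = B - m * C + 3 * (k * B)" using k by Groebner_Basis.algebra
  then show B: "3 dvd B - m * C" using d by (metis dvd_add_left_iff dvd_mult dvd_triv_left)
  have "3 dvd 3 * (l - C) - (m * B - C)" by (rule dvd_diff[OF dvd_triv_left d])
  also have "3 * (l - C) - (m * B - C) = A - C" unfolding A by simp
  finally show AC: "3 dvd A - C" .
  obtain s where s: "A = C + 3 * s" using AC by (auto simp: dvd_def algebra_simps)
  obtain t where t: "B = m * C + 3 * t" using B by (auto simp: dvd_def algebra_simps)
  \<comment> \<open>At A = C, B = m C the norm form equals (m^2 - 1)^2 C^3 = 9 k^2 C^3, and all
    corrections by s and t are multiples of 27.\<close>
  have "27 * n = 9 * (k\<^sup>2 * C ^ 3) + 27 * (C * s\<^sup>2 + s ^ 3 + m\<^sup>2 * C * t\<^sup>2 + m * t ^ 3 - m * C * s * t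
      - k * s * C\<^sup>2 + k * m * t * C\<^sup>2)"
    unfolding n[symmetric] s t using k by Groebner_Basis.algebra
  moreover have "3 dvd P" if "27 * n = 9 * P + 27 * Q" for P Q :: int using that by presburger
  ultimately have "3 dvd k\<^sup>2 * C ^ 3" by blast
  then have "3 dvd k \<or> 3 dvd C"
    by (auto simp: prime_dvd_mult_iff prime_dvd_power_iff)
  then show "3 dvd C" if "\<not> 9 dvd m\<^sup>2 - 1"
    using that unfolding k by auto
qed

lemma odd_square:
  fixes z :: int
  assumes "odd z"
  obtains q where "z\<^sup>2 = 8 * q + 1"
proof -
  obtain k where k: "z = 2 * k + 1" using assms by (rule oddE)
  have "even (k * (k + 1))" by simp
  then obtain q where q: "k * (k + 1) = 2 * q" by (rule evenE)
  have "z\<^sup>2 = 8 * q + 1" using k q by Groebner_Basis.algebra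
  then show thesis by (rule that)
qed

text \<open>The hypothesis is integrality of the norm of (A + C sqrt m)/2. Parities agree because m
  is odd; for m = 3 modulo 4, odd A and C would give 1 - 3 = 2 modulo 4 up to sign.\<close>

lemma even_of_four_dvd:
  fixes A C m :: int
  assumes "4 dvd A\<^sup>2 - m * C\<^sup>2" "odd m"
  shows "even A \<longleftrightarrow> even C" and "m mod 4 = 3 \<Longrightarrow> even A \<and> even C"
proof -
  have "even (A\<^sup>2 - m * C\<^sup>2)" using assms(1) by (rule dvd_trans[rotated]) simp
  then show par: "even A \<longleftrightarrow> even C" using assms(2) by simp
  show "even A \<and> even C" if m: "m mod 4 = 3"
  proof (rule ccontr)
    assume "\<not> (even A \<and> even C)"
    then have "odd A" "odd C" using par by auto
    then obtain q q' where q: "A\<^sup>2 = 8 * q + 1" "C\<^sup>2 = 8 * q' + 1" by (metis odd_square)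
    define n where "n = m div 4"
    have n: "m = 4 * n + 3" using m unfolding n_def by presburger
    have "A\<^sup>2 - m * C\<^sup>2 = 4 * (2 * q - 8 * (n * q') - n - 6 * q') - 2" unfolding q n by (simp add: algebra_simps)
    moreover have "\<not> 4 dvd P" if "P = 4 * Q - 2" for P Q :: int using that by presburger
    ultimately show False using assms(1) by blast
  qed
qed

text \<open>Let \<phi> = \<theta>^3 and z = (A + B \<phi> + C \<phi>^2 + D \<phi>^3)/4. The first
  two hypotheses come from the traces of z and z/\<phi> to the quadratic field of \<phi>^2; the
  others say that the relative norm of z is (x + y \<phi>^2)/2 and that this is integral. The
  quadratic case makes all six numbers even, and the halved equations yield one more factor
  2.\<close>

lemma quartic_congruences_3_mod_4:
  fixes A B C D m x y :: int
  assumes AC: "4 dvd A\<^sup>2 - m * C\<^sup>2" and BD: "4 dvd B\<^sup>2 - m * D\<^sup>2" and xy: "4 dvd x\<^sup>2 - m * y\<^sup>2"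
    and X: "A\<^sup>2 + m * C\<^sup>2 - 2 * m * B * D = 8 * x" and Y: "2 * A * C - B\<^sup>2 - m * D\<^sup>2 = 8 * y"
    and m: "m mod 4 = 3"
  shows "4 dvd A \<and> 4 dvd B \<and> 4 dvd C \<and> 4 dvd D"
proof -
  have odd: "odd m" using m by presburger
  define n where "n = m div 4"
  have n: "m = 4 * n + 3" using m unfolding n_def by presburger
  have "even A" "even C" "even B" "even D" "even x" "even y"
    using even_of_four_dvd(2)[OF AC odd m] even_of_four_dvd(2)[OF BD odd m] even_of_four_dvd(2)[OF xy odd m] by auto
  then obtain s t u w x' y' where d: "A = 2 * s" "C = 2 * t" "B = 2 * u" "D = 2 * w" "x = 2 * x'" "y = 2 * y'"
    by (auto elim!: evenE)
  have X': "s\<^sup>2 + m * t\<^sup>2 - 2 * (m * u * w) = 4 * x'" using X unfolding d by (simp add: algebra_simps power2_eq_square)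
  have Y': "2 * (s * t) - u\<^sup>2 - m * w\<^sup>2 = 4 * y'" using Y unfolding d by (simp add: algebra_simps power2_eq_square)
  have "even (s\<^sup>2 + m * t\<^sup>2 - 2 * (m * u * w))" "even (2 * (s * t) - u\<^sup>2 - m * w\<^sup>2)" unfolding X' Y' by auto
  then have st: "even s \<longleftrightarrow> even t" and uw: "even u \<longleftrightarrow> even w" using odd by auto
  have "even s \<and> even u"
  proof (cases "even s")
    case True
    then obtain s' t' where "s = 2 * s'" "t = 2 * t'" using st by (auto elim!: evenE)
    then have "2 * (m * u * w) = 2 * (2 * (s'\<^sup>2 + m * t'\<^sup>2 - x'))"
      using X' by (simp add: algebra_simps power2_eq_square)
    then have "m * u * w = 2 * (s'\<^sup>2 + m * t'\<^sup>2 - x')" by simp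
    then have "even (m * u * w)" by simp
    then show ?thesis using True odd uw by auto
  next
    case False
    then obtain q q' where q: "s\<^sup>2 = 8 * q + 1" "t\<^sup>2 = 8 * q' + 1" using st by (metis odd_square)
    \<comment> \<open>Odd s and t give s^2 + m t^2 = 1 + 3 = 0 modulo 4, which makes u and w even;
      the second equation then makes s t even, a contradiction.\<close>
    have "2 * (m * u * w) = 2 * (2 * (2 * q + 8 * (n * q') + n + 6 * q' + 1 - x'))"
      using X' unfolding q by (simp add: n algebra_simps)
    then have "m * u * w = 2 * (2 * q + 8 * (n * q') + n + 6 * q' + 1 - x')" by simp
    then have "even (m * u * w)" by simp
    then obtain u' w' where "u = 2 * u'" "w = 2 * w'" using odd uw by (auto elim!: evenE)
    then have "2 * (s * t) = 2 * (2 * (y' + u'\<^sup>2 + m * w'\<^sup>2))"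
      using Y' by (simp add: algebra_simps power2_eq_square)
    then have "s * t = 2 * (y' + u'\<^sup>2 + m * w'\<^sup>2)" by simp
    then have "even (s * t)" by simp
    then show ?thesis using False st by simp
  qed
  then show ?thesis using st uw unfolding d by auto
qed

text \<open>The hypotheses have the same origin as for m = 3 modulo 4; even n means m = 1 and odd n
  means m = 5 modulo 8. Odd numerators can occur only for even n. Excluding them for odd n uses the
  norm down to Q: it forces x = y modulo 2, hence X = Y modulo 16.\<close>

lemma quartic_congruences_1_mod_4:
  fixes A B C D n x y :: int
  defines "m \<equiv> 4 * n + 1"
  assumes AC: "4 dvd A\<^sup>2 - m * C\<^sup>2" and BD: "4 dvd B\<^sup>2 - m * D\<^sup>2" and xy: "4 dvd x\<^sup>2 - m * y\<^sup>2"
    and X: "A\<^sup>2 + m * C\<^sup>2 - 2 * m * B * D = 8 * x" and Y: "2 * A * C - B\<^sup>2 - m * D\<^sup>2 = 8 * y"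
  shows "even n \<Longrightarrow> 4 dvd B - D \<and> 2 dvd C - D \<and> 4 dvd A + C - 2 * D"
    and "odd n \<Longrightarrow> 2 dvd C \<and> 2 dvd D \<and> 4 dvd A + C \<and> 4 dvd B + D"
proof -
  have odd: "odd m" by (simp add: m_def)
  note par = even_of_four_dvd(1)[OF AC odd] even_of_four_dvd(1)[OF BD odd] even_of_four_dvd(1)[OF xy odd]
  have "(even n \<longrightarrow> 4 dvd B - D \<and> 2 dvd C - D \<and> 4 dvd A + C - 2 * D) \<and>
    (odd n \<longrightarrow> 2 dvd C \<and> 2 dvd D \<and> 4 dvd A + C \<and> 4 dvd B + D)"
  proof (cases "even A")
    case True
    then obtain s t where st: "A = 2 * s" "C = 2 * t" using par by (auto elim!: evenE)
    have "even B"
    proof (rule ccontr)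
      assume "odd B"
      then obtain q q' where q: "B\<^sup>2 = 8 * q + 1" "D\<^sup>2 = 8 * q' + 1" using par by (metis odd_square)
      \<comment> \<open>With A and C even, 8 divides 2 A C, whereas odd B and D give B^2 + m D^2 = 2
        modulo 4.\<close>
      have "2 * (1 + 2 * n) = 8 * (s * t - q - 4 * (n * q') - q' - y)"
        using Y unfolding q st by (simp add: m_def algebra_simps)
      moreover have "2 * (1 + 2 * n) \<noteq> 8 * Q" for Q :: int by presburger
      ultimately show False by blast
    qed
    then obtain u w where uw: "B = 2 * u" "D = 2 * w" using par by (auto elim!: evenE)
    have "s\<^sup>2 + m * t\<^sup>2 - 2 * (m * u * w) = 2 * x" using X unfolding st uw by (simp add: algebra_simps power2_eq_square)
    then have "even (s\<^sup>2 + m * t\<^sup>2 - 2 * (m * u * w))" by simp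
    then have 1: "even (s + t)" using odd by auto
    have "2 * (s * t) - u\<^sup>2 - m * w\<^sup>2 = 2 * y" using Y unfolding st uw by (simp add: algebra_simps power2_eq_square)
    then have "even (2 * (s * t) - u\<^sup>2 - m * w\<^sup>2)" by simp
    then have 2: "even (u + w)" using odd by auto
    from 1 2 show ?thesis unfolding st uw by presburger
  next
    case False
    then obtain s t where st: "A = 2 * s + 1" "C = 2 * t + 1" using par by (auto elim!: oddE)
    have "odd B"
    proof
      assume "even B"
      then obtain u w where uw: "B = 2 * u" "D = 2 * w" using par by (auto elim!: evenE)
      have "2 * (A * C) = 2 * (2 * (2 * y + u\<^sup>2 + m * w\<^sup>2))" using Y unfolding uw by (simp add: algebra_simps power2_eq_square)
      then have "A * C = 2 * (2 * y + u\<^sup>2 + m * w\<^sup>2)" by simp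
      then have "even (A * C)" by simp
      then show False using False par by simp
    qed
    then obtain u w where uw: "B = 2 * u + 1" "D = 2 * w + 1" using par by (auto elim!: oddE)
    obtain s1 t1 u1 w1 where sq: "A\<^sup>2 = 8 * s1 + 1" "C\<^sup>2 = 8 * t1 + 1" "B\<^sup>2 = 8 * u1 + 1" "D\<^sup>2 = 8 * w1 + 1"
      using False par \<open>odd B\<close> by (metis odd_square)
    have even: "even P" if "4 * P = 8 * Q" for P Q :: int using that by presburger
    have Y': "4 * (s + t - n) = 8 * (y - s * t + u1 + 4 * (n * w1) + w1)"
      using Y unfolding sq by (simp add: m_def st algebra_simps)
    then have 1: "even (s + t - n)" by (rule even)
    have X': "4 * (n + u + w) = 8 * (s1 + 4 * (n * t1) + t1 - 4 * (n * u * w) - 2 * (n * u) - 2 * (n * w) - u * w - x)"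
      using X unfolding sq by (simp add: m_def uw algebra_simps)
    then have 2: "even (n + u + w)" by (rule even)
    have "even n"
    proof (rule ccontr)
      assume n: "odd n"
      \<comment> \<open>For odd n both A - C and B - D are 2 modulo 4, so the sum of their squares
        is 8 modulo 16.\<close>
      obtain g h where gh: "s = t + 2 * g + 1" "u = w + 2 * h + 1"
      proof -
        have "odd (s - t)" "odd (u - w)" using 1 2 n by presburger+
        then obtain g h where "s - t = 2 * g + 1" "u - w = 2 * h + 1" by (meson oddE)
        then show thesis using that[of g h] by simp
      qed
      \<comment> \<open>Equal parity of x and y makes X - Y = 8 (x - y) a multiple of 16, against
        the residue 8 found below.\<close>
      have "even (x - y)" using par by simp
      then obtain z where z: "x - y = 2 * z" by (rule evenE)
      have "16 * z = (A\<^sup>2 + m * C\<^sup>2 - 2 * m * B * D) - (2 * A * C - B\<^sup>2 - m * D\<^sup>2)"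
        unfolding X Y using z by simp
      also have "\<dots> = (A - C)\<^sup>2 + (B - D)\<^sup>2 + 4 * n * (C\<^sup>2 + D\<^sup>2 - 2 * B * D)"
        by (simp add: m_def algebra_simps power2_eq_square)
      also have "\<dots> = 8 + 16 * (g\<^sup>2 + g + h\<^sup>2 + h + n * (2 * t1 + 2 * w1 - 2 * u * w - u - w))"
        unfolding sq by (simp add: st uw gh algebra_simps power2_eq_square)
      finally have "16 * z = 8 + 16 * (g\<^sup>2 + g + h\<^sup>2 + h + n * (2 * t1 + 2 * w1 - 2 * u * w - u - w))" .
      moreover have "16 * z \<noteq> 8 + 16 * Q" for Q :: int by presburger
      ultimately show False by blast
    qed
    then show ?thesis using 1 2 unfolding st uw by presburger
  qed
  then show "even n \<Longrightarrow> 4 dvd B - D \<and> 2 dvd C - D \<and> 4 dvd A + C - 2 * D"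
    and "odd n \<Longrightarrow> 2 dvd C \<and> 2 dvd D \<and> 4 dvd A + C \<and> 4 dvd B + D" by blast+
qed

lemma three_is_prime_nat: "prime (3::nat)"
proof (rule prime_nat_naiveI)
  fix n :: nat assume n: "n dvd 3"
  then have "n \<le> 3" using dvd_imp_le zero_less_numeral by blast
  then consider "n = 0" | "n = 1" | "n = 2" | "n = 3" by linarith
  then show "n = 1 \<or> n = 3" using n by cases auto
qed auto

section \<open>Conjugates, traces and norms of the partial sums\<close>

context pure12
begin

lemma loc_int_scaled:
  assumes p: "prime p" and "loc_int p (of_nat p ^ s * (of_int \<alpha> / of_nat p ^ T))"
  obtains A :: int where "of_int \<alpha> / of_nat p ^ T = (of_int A / of_nat p ^ s :: complex)"
proof -
  have pc: "of_nat p \<noteq> (0::complex)" using prime_gt_0_nat[OF p] by simp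
  have "loc_int p (of_int (int p ^ s * \<alpha>) / of_nat p ^ T)"
    using assms(2) by (simp only: of_int_mult of_int_power of_int_of_nat_eq times_divide_eq_right)
  then have "int p ^ T dvd int p ^ s * \<alpha>" by (rule loc_int_rational_dvd[OF p])
  then obtain A where "int p ^ s * \<alpha> = int p ^ T * A" by (rule dvdE)
  from arg_cong[OF this, of "of_int :: int \<Rightarrow> complex"]
  have "of_int \<alpha> * of_nat p ^ s = (of_int A * of_nat p ^ T :: complex)"
    by (simp only: of_int_mult of_int_power of_int_of_nat_eq mult.commute)
  then have "of_int \<alpha> / of_nat p ^ T = (of_int A / of_nat p ^ s :: complex)"
    by (rule frac_eq_eq[OF power_not_zero[OF pc] power_not_zero[OF pc], THEN iffD2])
  then show thesis by (rule that)
qed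

text \<open>The field of \<theta>^4 is a pure cubic field. The trace and the two Lagrange resolvents
  isolate 3 a, 3 b and 3 c up to units, which bounds the denominators by 3; the second symmetric
  function and the norm supply the hypotheses of \<open>cubic_congruences\<close>.\<close>

lemma cubic_piece:
  fixes \<alpha> \<beta> \<gamma> :: int and T :: nat
  assumes m: "\<not> 3 dvd m"
  defines "a \<equiv> of_int \<alpha> / 3 ^ T :: complex" and "b \<equiv> of_int \<beta> / 3 ^ T :: complex" and "c \<equiv> of_int \<gamma> / 3 ^ T :: complex"
  assumes int: "loc_int 3 (a + b * \<theta> ^ 4 + c * \<theta> ^ 8)"
  shows "\<exists>A B C :: int. a = of_int A / 3 \<and> b = of_int B / 3 \<and> c = of_int C / 3 \<and>
    3 dvd A - C \<and> 3 dvd B - m * C \<and> (\<not> 9 dvd m\<^sup>2 - 1 \<longrightarrow> 3 dvd C)"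
proof -
  have p: "prime (3::nat)" by (rule three_is_prime_nat)
  have m': "\<not> int 3 dvd m" using m by simp
  note ring = loc_int_mult[OF p] loc_int_add[OF p] loc_int_power[OF p]
  define \<omega> where "\<omega> = cis (2 * pi / real 3)"
  have \<omega>3: "\<omega> ^ 3 = 1" using sum_powers_root_of_unity(1)[of 3, folded \<omega>_def] by simp
  have "(\<Sum>j<3. \<omega> ^ j) = 0"
    using sum_powers_root_of_unity(2)[of 3 1, folded \<omega>_def] by simp
  then have \<omega>: "1 + \<omega> + \<omega>\<^sup>2 = 0" by (simp add: numeral_3_eq_3 power2_eq_square)
  have \<omega>i: "loc_int 3 \<omega>"
    by (rule loc_int_of_power[OF p, of _ 3]) (simp_all add: \<omega>3 loc_int_simps[OF p])
  define P :: "rat poly" where "P = monom (of_int \<alpha> / 3 ^ T) 0 + monom (of_int \<beta> / 3 ^ T) 4 + monom (of_int \<gamma> / 3 ^ T) 8"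
  have P: "rpoly P x = a + b * x ^ 4 + c * x ^ 8" for x
    by (simp add: P_def a_def b_def c_def of_rat_divide of_rat_power)
  have conj: "loc_int 3 (a + b * (\<zeta> * \<theta>) ^ 4 + c * (\<zeta> * \<theta>) ^ 8)" if "\<zeta> ^ 12 = 1" for \<zeta>
    using loc_int_conjugate[OF p, of P \<zeta>] int that by (simp add: P)
  define u where "u = b * \<theta> ^ 4"
  define w where "w = c * \<theta> ^ 8"
  have \<omega>4: "\<omega> ^ 4 = \<omega>" "\<omega> ^ 8 = \<omega>\<^sup>2" "\<omega> ^ 16 = \<omega>" "\<omega> ^ 12 = 1" "\<omega> ^ 24 = 1"
    using \<omega>3 by Groebner_Basis.algebra+
  \<comment> \<open>Replacing \<theta> by \<omega> \<theta> multiplies u by \<omega>^4 = \<omega>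
    and w by \<omega>^8 = \<omega>^2.\<close>
  define x0 where "x0 = a + u + w"
  define x1 where "x1 = a + \<omega> * u + \<omega>\<^sup>2 * w"
  define x2 where "x2 = a + \<omega>\<^sup>2 * u + \<omega> * w"
  have x0: "loc_int 3 x0" using int by (simp add: x0_def u_def w_def)
  have x1: "loc_int 3 x1" using conj[of \<omega>] by (simp add: x1_def u_def w_def \<omega>4 power_mult_distrib mult_ac)
  have x2: "loc_int 3 x2" using conj[of "\<omega>\<^sup>2"] by (simp add: x2_def u_def w_def \<omega>4 power_mult_distrib mult_ac)
  have "loc_int 3 (x0 + x1 + x2)" by (intro ring x0 x1 x2)
  also have "x0 + x1 + x2 = 3 * a" using \<omega> unfolding x0_def x1_def x2_def by Groebner_Basis.algebra
  finally have 3: "loc_int 3 (of_nat 3 ^ 1 * a)" by simp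
  \<comment> \<open>A Lagrange resolvent isolates 3 u; the factor \<theta>^8 turns u = b \<theta>^4
    into b m, and m is a unit at 3.\<close>
  have "loc_int 3 ((x0 + \<omega>\<^sup>2 * x1 + \<omega> * x2) * \<theta> ^ 8)" by (intro ring x0 x1 x2 \<omega>i loc_int_theta[OF p])
  also have "x0 + \<omega>\<^sup>2 * x1 + \<omega> * x2 = 3 * u" using \<omega> unfolding x0_def x1_def x2_def by Groebner_Basis.algebra
  also have "3 * u * \<theta> ^ 8 = of_int m * (of_nat 3 ^ 1 * b)"
    unfolding u_def root[symmetric] of_nat_numeral by Groebner_Basis.algebra
  finally have 4: "loc_int 3 (of_nat 3 ^ 1 * b)" using loc_int_cancel[OF p m'] by blast
  have "loc_int 3 ((x0 + \<omega> * x1 + \<omega>\<^sup>2 * x2) * \<theta> ^ 4)" by (intro ring x0 x1 x2 \<omega>i loc_int_theta[OF p])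
  also have "x0 + \<omega> * x1 + \<omega>\<^sup>2 * x2 = 3 * w" using \<omega> unfolding x0_def x1_def x2_def by Groebner_Basis.algebra
  also have "3 * w * \<theta> ^ 4 = of_int m * (of_nat 3 ^ 1 * c)"
    unfolding w_def root[symmetric] of_nat_numeral by Groebner_Basis.algebra
  finally have 5: "loc_int 3 (of_nat 3 ^ 1 * c)" using loc_int_cancel[OF p m'] by blast
  obtain A :: int where A: "a = of_int A / 3" using loc_int_scaled[OF p, of 1 \<alpha> T] 3 unfolding a_def by auto
  obtain B :: int where B: "b = of_int B / 3" using loc_int_scaled[OF p, of 1 \<beta> T] 4 unfolding b_def by auto
  obtain C :: int where C: "c = of_int C / 3" using loc_int_scaled[OF p, of 1 \<gamma> T] 5 unfolding c_def by auto
  have uw: "u * w = b * c * of_int m" "u ^ 3 = b ^ 3 * of_int m" "w ^ 3 = c ^ 3 * of_int m ^ 2"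
    unfolding u_def w_def root[symmetric] by Groebner_Basis.algebra+
  have "loc_int 3 (x0 * x1 + x0 * x2 + x1 * x2)" by (intro ring x0 x1 x2)
  also have "x0 * x1 + x0 * x2 + x1 * x2 = 3 * a\<^sup>2 - 3 * (u * w)" using \<omega> unfolding x0_def x1_def x2_def by Groebner_Basis.algebra
  also have "\<dots> = of_int (A\<^sup>2 - m * B * C) / of_nat 3 ^ 1" by (simp add: uw A B C field_simps power2_eq_square)
  finally have 6: "3 dvd A\<^sup>2 - m * B * C" using loc_int_rational_dvd[OF p] by fastforce
  have "loc_int 3 (x0 * x1 * x2)" by (intro ring x0 x1 x2)
  also have "x0 * x1 * x2 = a ^ 3 + u ^ 3 + w ^ 3 - 3 * a * (u * w)" using \<omega> unfolding x0_def x1_def x2_def by Groebner_Basis.algebra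
  also have "\<dots> = of_int (A ^ 3 + m * B ^ 3 + m\<^sup>2 * C ^ 3 - 3 * m * A * B * C) / of_nat 3 ^ 3"
    unfolding uw by (simp add: A B C field_simps power2_eq_square power3_eq_cube)
  finally have 7: "27 dvd A ^ 3 + m * B ^ 3 + m\<^sup>2 * C ^ 3 - 3 * m * A * B * C"
    using loc_int_rational_dvd[OF p, of _ 3] by fastforce
  show ?thesis using A B C cubic_congruences[OF m 6 7] by blast
qed

text \<open>The sum and the difference of the two conjugates bound both denominators by 2, as
  \<theta>^6 is a unit at 2; their product is the norm, with denominator 4.\<close>

lemma quadratic_piece:
  fixes x y :: int
  assumes m: "odd m"
    and 1: "loc_int 2 (of_int x / 2 ^ T + of_int y / 2 ^ T * \<theta> ^ 6)"
    and 2: "loc_int 2 (of_int x / 2 ^ T - of_int y / 2 ^ T * \<theta> ^ 6)"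
  shows "\<exists>X Y :: int. (of_int x / 2 ^ T :: complex) = of_int X / 2 \<and> (of_int y / 2 ^ T :: complex) = of_int Y / 2
    \<and> 4 dvd X\<^sup>2 - m * Y\<^sup>2"
proof -
  have p: "prime (2::nat)" by (rule two_is_prime_nat)
  have m': "\<not> int 2 dvd m" using m by simp
  define u :: complex where "u = of_int x / 2 ^ T"
  define w :: complex where "w = of_int y / 2 ^ T"
  note 1 = 1[folded u_def w_def] and 2 = 2[folded u_def w_def]
  have 3: "loc_int 2 (of_nat 2 ^ 1 * u)" using loc_int_add[OF p 1 2] by simp
  have "loc_int 2 ((u + w * \<theta> ^ 6 - (u - w * \<theta> ^ 6)) * \<theta> ^ 6)"
    by (intro loc_int_mult[OF p] loc_int_diff[OF p 1 2] loc_int_power[OF p] loc_int_theta[OF p])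
  also have "(u + w * \<theta> ^ 6 - (u - w * \<theta> ^ 6)) * \<theta> ^ 6 = of_int m * (of_nat 2 ^ 1 * w)"
    unfolding root[symmetric] of_nat_numeral by Groebner_Basis.algebra
  finally have 4: "loc_int 2 (of_nat 2 ^ 1 * w)" using loc_int_cancel[OF p m'] by blast
  obtain X :: int where X: "u = of_int X / 2" using loc_int_scaled[OF p, of 1 x T] 3 unfolding u_def by auto
  obtain Y :: int where Y: "w = of_int Y / 2" using loc_int_scaled[OF p, of 1 y T] 4 unfolding w_def by auto
  have "loc_int 2 ((u + w * \<theta> ^ 6) * (u - w * \<theta> ^ 6))" by (rule loc_int_mult[OF p 1 2])
  also have "(u + w * \<theta> ^ 6) * (u - w * \<theta> ^ 6) = u\<^sup>2 - w\<^sup>2 * of_int m"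
    unfolding root[symmetric] by Groebner_Basis.algebra
  also have "\<dots> = of_int (X\<^sup>2 - m * Y\<^sup>2) / of_nat 2 ^ 2"
    by (simp add: X Y field_simps power2_eq_square)
  finally have "4 dvd X\<^sup>2 - m * Y\<^sup>2" using loc_int_rational_dvd[OF p, of _ 2] by fastforce
  then show ?thesis using X Y unfolding u_def w_def by blast
qed

text \<open>The quadratic case is applied to three elements of the field of \<theta>^6: the relative
  trace of the piece, that of the piece divided by \<theta>^3, and the relative norm. The traces
  bound the denominators by 4, and the norm supplies the finer congruences.\<close>

lemma quartic_piece:
  fixes \<alpha> \<beta> \<gamma> \<delta> :: int and T :: nat
  assumes m: "odd m"
  defines "a \<equiv> of_int \<alpha> / 2 ^ T :: complex" and "b \<equiv> of_int \<beta> / 2 ^ T :: complex"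
    and "c \<equiv> of_int \<gamma> / 2 ^ T :: complex" and "d \<equiv> of_int \<delta> / 2 ^ T :: complex"
  assumes int: "loc_int 2 (a + b * \<theta> ^ 3 + c * \<theta> ^ 6 + d * \<theta> ^ 9)"
  shows "\<exists>A B C D :: int. a = of_int A / 4 \<and> b = of_int B / 4 \<and> c = of_int C / 4 \<and> d = of_int D / 4 \<and>
    (m mod 4 = 3 \<longrightarrow> 4 dvd A \<and> 4 dvd B \<and> 4 dvd C \<and> 4 dvd D) \<and>
    (m mod 8 = 1 \<longrightarrow> 4 dvd B - D \<and> 2 dvd C - D \<and> 4 dvd A + C - 2 * D) \<and>
    (m mod 8 = 5 \<longrightarrow> 2 dvd C \<and> 2 dvd D \<and> 4 dvd A + C \<and> 4 dvd B + D)"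
proof -
  have p: "prime (2::nat)" by (rule two_is_prime_nat)
  have m': "\<not> int 2 dvd m" using m by simp
  note ring = loc_int_mult[OF p] loc_int_add[OF p] loc_int_power[OF p]
  define P :: "rat poly" where "P = monom (of_int \<alpha> / 2 ^ T) 0 + monom (of_int \<beta> / 2 ^ T) 3
    + monom (of_int \<gamma> / 2 ^ T) 6 + monom (of_int \<delta> / 2 ^ T) 9"
  have P: "rpoly P x = a + b * x ^ 3 + c * x ^ 6 + d * x ^ 9" for x
    by (simp add: P_def a_def b_def c_def d_def of_rat_divide of_rat_power)
  have conj: "loc_int 2 (a + b * (\<zeta> * \<theta>) ^ 3 + c * (\<zeta> * \<theta>) ^ 6 + d * (\<zeta> * \<theta>) ^ 9)" if "\<zeta> ^ 12 = 1" for \<zeta>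
    using loc_int_conjugate[OF p, of P \<zeta>] int that by (simp add: P)
  have ipow: "\<i> ^ 3 = - \<i>" "\<i> ^ 6 = - 1" "\<i> ^ 9 = \<i>" "\<i> ^ 12 = 1"
    using i_squared by Groebner_Basis.algebra+
  define u where "u = b * \<theta> ^ 3"
  define w where "w = c * \<theta> ^ 6"
  define t where "t = d * \<theta> ^ 9"
  \<comment> \<open>The images under replacing \<theta> by \<theta>, \<i> \<theta>, - \<theta> and -
    \<i> \<theta>; for the second one, \<theta>^3 is multiplied by \<i>^3 = - \<i>.\<close>
  define x0 where "x0 = a + u + w + t"
  define x1 where "x1 = a - \<i> * u - w + \<i> * t"
  define x2 where "x2 = a - u + w - t"
  define x3 where "x3 = a + \<i> * u - w - \<i> * t"
  have x0: "loc_int 2 x0" using int by (simp add: x0_def u_def w_def t_def)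
  have x2: "loc_int 2 x2" using conj[of "- 1"] by (simp add: x2_def u_def w_def t_def power_mult_distrib)
  have x1: "loc_int 2 x1" using conj[of \<i>] by (simp add: x1_def u_def w_def t_def ipow power_mult_distrib mult_ac)
  have x3: "loc_int 2 x3" using conj[of "- \<i>"] by (simp add: x3_def u_def w_def t_def ipow power_mult_distrib mult_ac)
  have i: "loc_int 2 \<i>" by (rule loc_int_algebraic_int[OF p]) simp
  have "loc_int 2 (x0 + x2)" "loc_int 2 (x1 + x3)" by (intro ring x0 x1 x2 x3)+
  then have "loc_int 2 (of_int (2 * \<alpha>) / 2 ^ T + of_int (2 * \<gamma>) / 2 ^ T * \<theta> ^ 6)"
    "loc_int 2 (of_int (2 * \<alpha>) / 2 ^ T - of_int (2 * \<gamma>) / 2 ^ T * \<theta> ^ 6)"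
    by (simp_all add: x0_def x1_def x2_def x3_def w_def a_def c_def mult.assoc)
  from quadratic_piece[OF m this] obtain A C :: int where
    AC: "a = of_int A / 4" "c = of_int C / 4" "4 dvd A\<^sup>2 - m * C\<^sup>2"
    by (auto simp: a_def c_def field_simps)
  \<comment> \<open>Up to the unit \<theta>^12 = m, multiplication by \<theta>^9 is division by
    \<theta>^3. The factor \<i> in the second element removes the \<i> left in x1 - x3.\<close>
  have "loc_int 2 ((x0 + (- 1) * x2) * \<theta> ^ 9)" "loc_int 2 ((\<i> * x1 + (- 1) * \<i> * x3) * \<theta> ^ 9)"
    by (intro ring x0 x1 x2 x3 i loc_int_theta[OF p] loc_int_simps[OF p])+
  moreover have "(x0 + (- 1) * x2) * \<theta> ^ 9 = of_int m * (of_int (2 * \<beta>) / 2 ^ T + of_int (2 * \<delta>) / 2 ^ T * \<theta> ^ 6)"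
  proof -
    have "(x0 + (- 1) * x2) * \<theta> ^ 9 = \<theta> ^ 12 * (2 * b + 2 * d * \<theta> ^ 6)"
      unfolding x0_def x2_def u_def t_def by Groebner_Basis.algebra
    then show ?thesis by (simp add: root b_def d_def)
  qed
  moreover have "(\<i> * x1 + (- 1) * \<i> * x3) * \<theta> ^ 9 = of_int m * (of_int (2 * \<beta>) / 2 ^ T - of_int (2 * \<delta>) / 2 ^ T * \<theta> ^ 6)"
  proof -
    have "(\<i> * x1 + (- 1) * \<i> * x3) * \<theta> ^ 9 = \<theta> ^ 12 * (2 * b - 2 * d * \<theta> ^ 6)"
      using i_squared unfolding x1_def x3_def u_def t_def by Groebner_Basis.algebra
    then show ?thesis by (simp add: root b_def d_def)
  qed
  ultimately have "loc_int 2 (of_int (2 * \<beta>) / 2 ^ T + of_int (2 * \<delta>) / 2 ^ T * \<theta> ^ 6)"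
    "loc_int 2 (of_int (2 * \<beta>) / 2 ^ T - of_int (2 * \<delta>) / 2 ^ T * \<theta> ^ 6)"
    using loc_int_cancel[OF p m'] by metis+
  from quadratic_piece[OF m this] obtain B D :: int where
    BD: "b = of_int B / 4" "d = of_int D / 4" "4 dvd B\<^sup>2 - m * D\<^sup>2"
    by (auto simp: b_def d_def field_simps)
  \<comment> \<open>X and Y are 16 times the coordinates of the relative norm x0 x2 with respect to
    1 and \<theta>^6; x1 x3 is its conjugate.\<close>
  define X where "X = A\<^sup>2 + m * C\<^sup>2 - 2 * m * B * D"
  define Y where "Y = 2 * A * C - B\<^sup>2 - m * D\<^sup>2"
  have pq: "a\<^sup>2 + c\<^sup>2 * of_int m - 2 * b * d * of_int m = of_int X / 2 ^ 4"
    "2 * a * c - b\<^sup>2 - d\<^sup>2 * of_int m = of_int Y / 2 ^ 4"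
    by (simp_all add: X_def Y_def AC BD field_simps power2_eq_square)
  have "loc_int 2 (x0 * x2)" "loc_int 2 (x1 * x3)" by (intro ring x0 x1 x2 x3)+
  moreover have "x0 * x2 = of_int X / 2 ^ 4 + of_int Y / 2 ^ 4 * \<theta> ^ 6"
    unfolding pq[symmetric] x0_def x2_def u_def w_def t_def root[symmetric] by Groebner_Basis.algebra
  moreover have "x1 * x3 = of_int X / 2 ^ 4 - of_int Y / 2 ^ 4 * \<theta> ^ 6"
    unfolding pq[symmetric] x1_def x3_def u_def w_def t_def root[symmetric] using i_squared by Groebner_Basis.algebra
  ultimately have "loc_int 2 (of_int X / 2 ^ 4 + of_int Y / 2 ^ 4 * \<theta> ^ 6)"
    "loc_int 2 (of_int X / 2 ^ 4 - of_int Y / 2 ^ 4 * \<theta> ^ 6)" by auto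
  from quadratic_piece[OF m this] obtain x y :: int where
    "(of_int X / 2 ^ 4 :: complex) = of_int x / 2" "(of_int Y / 2 ^ 4 :: complex) = of_int y / 2"
    and xy: "4 dvd x\<^sup>2 - m * y\<^sup>2" by blast
  then have "(of_int X :: complex) = of_int (8 * x)" "(of_int Y :: complex) = of_int (8 * y)" by auto
  then have X: "X = 8 * x" and Y: "Y = 8 * y" by (simp_all only: of_int_eq_iff)
  note X = X[unfolded X_def] and Y = Y[unfolded Y_def]
  have 3: "4 dvd A \<and> 4 dvd B \<and> 4 dvd C \<and> 4 dvd D" if "m mod 4 = 3"
    by (rule quartic_congruences_3_mod_4[OF AC(3) BD(3) xy X Y that])
  define n where "n = m div 4"
  have n: "m = 4 * n + 1" if "m mod 4 = 1" using that unfolding n_def by presburger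
  have 1: "4 dvd B - D \<and> 2 dvd C - D \<and> 4 dvd A + C - 2 * D" if "m mod 8 = 1"
  proof -
    have "m mod 4 = 1" "even n" using that unfolding n_def by presburger+
    then show ?thesis
      using quartic_congruences_1_mod_4(1)[of A n C B D x y] n AC(3) BD(3) xy X Y by metis
  qed
  have 5: "2 dvd C \<and> 2 dvd D \<and> 4 dvd A + C \<and> 4 dvd B + D" if "m mod 8 = 5"
  proof -
    have "m mod 4 = 1" "odd n" using that unfolding n_def by presburger+
    then show ?thesis
      using quartic_congruences_1_mod_4(2)[of A n C B D x y] n AC(3) BD(3) xy X Y by metis
  qed
  show ?thesis using AC(1,2) BD(1,2) 1 3 5 by blast
qed

end

section \<open>Local bases\<close>

text \<open>Degree four fits every use: relations of degree 2 and 3 are multiplied up by a power of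
  the element.\<close>

lemma algebraic_int_monic_quartic:
  fixes z :: complex and a b c d :: int
  assumes "z ^ 4 = of_int a * z ^ 3 + of_int b * z\<^sup>2 + of_int c * z + of_int d"
  shows "algebraic_int z"
proof (rule algebraic_int.intros)
  let ?q = "[:of_int (- d), of_int (- c), of_int (- b), of_int (- a), 1:] :: complex poly"
  show "lead_coeff ?q = 1" by simp
  show "\<forall>i. coeff ?q i \<in> \<int>" by (auto simp: coeff_pCons split: nat.splits)
  have "poly ?q z = z ^ 4 - (of_int a * z ^ 3 + of_int b * z\<^sup>2 + of_int c * z + of_int d)"
    by (simp add: algebra_simps power2_eq_square power3_eq_cube power4_eq_xxxx)
  then show "poly ?q z = 0" using assms by simp
qed

lemma sum_lessThan_12:
  fixes g :: "nat \<Rightarrow> 'a::comm_monoid_add"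
  shows "(\<Sum>i<12. g i) = (\<Sum>r<4. g r + g (r + 4) + g (r + 8))"
    and "(\<Sum>i<12. g i) = (\<Sum>r<3. g r + g (r + 3) + g (r + 6) + g (r + 9))"
proof -
  have sets: "{..<12::nat} = {0, 1, 2, 3, 4, 5, 6, 7, 8, 9, 10, 11}" "{..<4::nat} = {0, 1, 2, 3}" "{..<3::nat} = {0, 1, 2}"
    by (simp_all add: set_eq_iff) arith+
  show "(\<Sum>i<12. g i) = (\<Sum>r<4. g r + g (r + 4) + g (r + 8))"
    and "(\<Sum>i<12. g i) = (\<Sum>r<3. g r + g (r + 3) + g (r + 6) + g (r + 9))"
    unfolding sets by (simp_all add: ac_simps)
qed

text \<open>With y for \<theta> and x for \<theta>^r, the congruences for A and B leave a multiple
  of h/3 as the only fractional part; this is where h comes from.\<close>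

lemma cubic_combination:
  fixes A B C m s t x y :: complex
  assumes "A = C + 3 * s" "B = m * C + 3 * t"
  shows "A / 3 * x + B / 3 * (x * y ^ 4) + C / 3 * (x * y ^ 8)
    = s * x + t * (x * y ^ 4) + C * (x * (y ^ 8 + m * y ^ 4 + 1) / 3)"
  using assms by Groebner_Basis.algebra

text \<open>Here A = - C and B = - D modulo 4 with C and D even, so the fractional part consists of
  multiples of (y^6 - 1)/2 and y^3 (y^6 - 1)/2.\<close>

lemma quartic_combination_5:
  fixes A B C D s t u v x y :: complex
  assumes "A = 4 * s - 2 * u" "B = 4 * t - 2 * v" "C = 2 * u" "D = 2 * v"
  shows "A / 4 * x + B / 4 * (x * y ^ 3) + C / 4 * (x * y ^ 6) + D / 4 * (x * y ^ 9)
    = s * x + t * (x * y ^ 3) + u * (x * (y ^ 6 - 1) / 2) + v * (x * y ^ 3 * (y ^ 6 - 1) / 2)"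
  using assms by Groebner_Basis.algebra

text \<open>Removing D g / 4 leaves the coefficient (C - D)/4 = u/2 at y^6, which u copies of (y^6 -
  1)/2 absorb; the two lower coefficients are then integers.\<close>

lemma quartic_combination_1:
  fixes A B C D s t u x y :: complex
  assumes "A = 4 * s + D - 2 * u" "B = D + 4 * t" "C = D + 2 * u"
  shows "A / 4 * x + B / 4 * (x * y ^ 3) + C / 4 * (x * y ^ 6) + D / 4 * (x * y ^ 9)
    = s * x + t * (x * y ^ 3) + u * (x * (y ^ 6 - 1) / 2) + D * (x * (y ^ 9 + y ^ 6 + y ^ 3 + 1) / 2 ^ 2)"
  using assms by Groebner_Basis.algebra

section \<open>Triangular bases at 3 and at 2\<close>

context pure12
begin

lemma power_basis:
  assumes p: "prime p"
    and int: "\<And>\<alpha> T i. loc_int p (\<Sum>i<12. of_int (\<alpha> i) / of_nat p ^ T * \<theta> ^ i) \<Longrightarrow> i < 12 \<Longrightarrow>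
      \<exists>n :: int. of_int (\<alpha> i) / of_nat p ^ T = (of_int n :: complex)"
  shows "pure12_triangular m \<theta> p (\<lambda>i. \<theta> ^ i) (\<lambda>_ _. 0) (\<lambda>_. 0)"
proof
  show "prime p" by (fact p)
  show "algebraic_int (\<theta> ^ i)" for i by (rule algebraic_int_power[OF algebraic_int_theta])
  fix \<alpha> :: "nat \<Rightarrow> int" and T :: nat
  assume "loc_int p (\<Sum>i<12. of_int (\<alpha> i) / of_nat p ^ T * \<theta> ^ i)"
  then obtain c :: "nat \<Rightarrow> int" where "\<And>i. i < 12 \<Longrightarrow> of_int (\<alpha> i) / of_nat p ^ T = (of_int (c i) :: complex)"
    using int by metis
  then show "\<exists>c :: nat \<Rightarrow> int. (\<Sum>i<12. of_int (\<alpha> i) / of_nat p ^ T * \<theta> ^ i) = (\<Sum>i<12. of_int (c i) * \<theta> ^ i)"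
    by (intro exI[of _ c] sum.cong) auto
qed simp

lemma cubic_coords:
  fixes \<alpha> :: "nat \<Rightarrow> int"
  assumes m: "\<not> 3 dvd m" and int: "loc_int 3 (\<Sum>i<12. of_int (\<alpha> i) / of_nat 3 ^ T * \<theta> ^ i)" and r: "r < 4"
  obtains A B C :: int where
    "of_int (\<alpha> r) / of_nat 3 ^ T = (of_int A / 3 :: complex)"
    "of_int (\<alpha> (r + 4)) / of_nat 3 ^ T = (of_int B / 3 :: complex)"
    "of_int (\<alpha> (r + 8)) / of_nat 3 ^ T = (of_int C / 3 :: complex)"
    "3 dvd A - C" "3 dvd B - m * C" "\<not> 9 dvd m\<^sup>2 - 1 \<longrightarrow> 3 dvd C"
proof -
  have "loc_int 3 (\<Sum>k<3. of_int (\<alpha> (r + 4 * k)) / of_nat 3 ^ T * \<theta> ^ (4 * k))"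
    by (rule unit_piece[OF three_is_prime_nat _ _ _ r int]) (use m in auto)
  also have "(\<Sum>k<3. of_int (\<alpha> (r + 4 * k)) / of_nat 3 ^ T * \<theta> ^ (4 * k))
    = of_int (\<alpha> r) / 3 ^ T + of_int (\<alpha> (r + 4)) / 3 ^ T * \<theta> ^ 4 + of_int (\<alpha> (r + 8)) / 3 ^ T * \<theta> ^ 8"
    by (simp add: lessThan_nat_numeral lessThan_Suc)
  finally have "loc_int 3 \<dots>" .
  from cubic_piece[OF m this] obtain A B C :: int where
    "of_int (\<alpha> r) / 3 ^ T = (of_int A / 3 :: complex)" "of_int (\<alpha> (r + 4)) / 3 ^ T = (of_int B / 3 :: complex)"
    "of_int (\<alpha> (r + 8)) / 3 ^ T = (of_int C / 3 :: complex)"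
    "3 dvd A - C" "3 dvd B - m * C" "\<not> 9 dvd m\<^sup>2 - 1 \<longrightarrow> 3 dvd C" by blast
  then show thesis by (intro that[of A B C]) (simp_all only: of_nat_numeral)
qed

lemma quartic_coords:
  fixes \<alpha> :: "nat \<Rightarrow> int"
  assumes m: "odd m" and int: "loc_int 2 (\<Sum>i<12. of_int (\<alpha> i) / of_nat 2 ^ T * \<theta> ^ i)" and r: "r < 3"
  obtains A B C D :: int where
    "of_int (\<alpha> r) / of_nat 2 ^ T = (of_int A / 4 :: complex)"
    "of_int (\<alpha> (r + 3)) / of_nat 2 ^ T = (of_int B / 4 :: complex)"
    "of_int (\<alpha> (r + 6)) / of_nat 2 ^ T = (of_int C / 4 :: complex)"
    "of_int (\<alpha> (r + 9)) / of_nat 2 ^ T = (of_int D / 4 :: complex)"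
    "m mod 4 = 3 \<longrightarrow> 4 dvd A \<and> 4 dvd B \<and> 4 dvd C \<and> 4 dvd D"
    "m mod 8 = 1 \<longrightarrow> 4 dvd B - D \<and> 2 dvd C - D \<and> 4 dvd A + C - 2 * D"
    "m mod 8 = 5 \<longrightarrow> 2 dvd C \<and> 2 dvd D \<and> 4 dvd A + C \<and> 4 dvd B + D"
proof -
  have "loc_int 2 (\<Sum>k<4. of_int (\<alpha> (r + 3 * k)) / of_nat 2 ^ T * \<theta> ^ (3 * k))"
    by (rule unit_piece[OF two_is_prime_nat _ _ _ r int]) (use m in auto)
  also have "(\<Sum>k<4. of_int (\<alpha> (r + 3 * k)) / of_nat 2 ^ T * \<theta> ^ (3 * k))
    = of_int (\<alpha> r) / 2 ^ T + of_int (\<alpha> (r + 3)) / 2 ^ T * \<theta> ^ 3 + of_int (\<alpha> (r + 6)) / 2 ^ T * \<theta> ^ 6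
      + of_int (\<alpha> (r + 9)) / 2 ^ T * \<theta> ^ 9"
    by (simp add: lessThan_nat_numeral lessThan_Suc)
  finally have "loc_int 2 \<dots>" .
  from quartic_piece[OF m this] obtain A B C D :: int where
    "of_int (\<alpha> r) / 2 ^ T = (of_int A / 4 :: complex)" "of_int (\<alpha> (r + 3)) / 2 ^ T = (of_int B / 4 :: complex)"
    "of_int (\<alpha> (r + 6)) / 2 ^ T = (of_int C / 4 :: complex)" "of_int (\<alpha> (r + 9)) / 2 ^ T = (of_int D / 4 :: complex)"
    "m mod 4 = 3 \<longrightarrow> 4 dvd A \<and> 4 dvd B \<and> 4 dvd C \<and> 4 dvd D"
    "m mod 8 = 1 \<longrightarrow> 4 dvd B - D \<and> 2 dvd C - D \<and> 4 dvd A + C - 2 * D"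
    "m mod 8 = 5 \<longrightarrow> 2 dvd C \<and> 2 dvd D \<and> 4 dvd A + C \<and> 4 dvd B + D" by blast
  then show thesis by (intro that[of A B C D]) (simp_all only: of_nat_numeral)
qed

lemma power_basis_3:
  assumes m: "\<not> 3 dvd m" "\<not> 9 dvd m\<^sup>2 - 1"
  shows "pure12_triangular m \<theta> 3 (\<lambda>i. \<theta> ^ i) (\<lambda>_ _. 0) (\<lambda>_. 0)"
proof (rule power_basis[OF three_is_prime_nat])
  fix \<alpha> :: "nat \<Rightarrow> int" and T i :: nat
  assume int: "loc_int 3 (\<Sum>i<12. of_int (\<alpha> i) / of_nat 3 ^ T * \<theta> ^ i)" and "i < 12"
  define r where "r = i mod 4"
  have r: "r < 4" "i = r \<or> i = r + 4 \<or> i = r + 8" using \<open>i < 12\<close> unfolding r_def by presburger+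
  obtain A B C :: int where c: "of_int (\<alpha> r) / of_nat 3 ^ T = (of_int A / 3 :: complex)"
    "of_int (\<alpha> (r + 4)) / of_nat 3 ^ T = (of_int B / 3 :: complex)"
    "of_int (\<alpha> (r + 8)) / of_nat 3 ^ T = (of_int C / 3 :: complex)"
    and d: "3 dvd A - C" "3 dvd B - m * C" "\<not> 9 dvd m\<^sup>2 - 1 \<longrightarrow> 3 dvd C"
    by (rule cubic_coords[OF m(1) int r(1)])
  have C: "3 dvd C" using d(3) m(2) by blast
  have A: "3 dvd A" using dvd_add[OF d(1) C] by simp
  have B: "3 dvd B" using dvd_add[OF d(2) dvd_mult[OF C, of m]] by simp
  have ex: "\<exists>n :: int. of_int x / 3 = (of_int n :: complex)" if "3 dvd x" for x :: int
    using that by (auto elim!: dvdE)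
  show "\<exists>n :: int. of_int (\<alpha> i) / of_nat 3 ^ T = (of_int n :: complex)"
    using r(2) ex[OF A] ex[OF B] ex[OF C] unfolding c[symmetric] by blast
qed

lemma power_basis_2:
  assumes m: "m mod 4 = 3"
  shows "pure12_triangular m \<theta> 2 (\<lambda>i. \<theta> ^ i) (\<lambda>_ _. 0) (\<lambda>_. 0)"
proof (rule power_basis[OF two_is_prime_nat])
  have odd: "odd m" using m by presburger
  fix \<alpha> :: "nat \<Rightarrow> int" and T i :: nat
  assume int: "loc_int 2 (\<Sum>i<12. of_int (\<alpha> i) / of_nat 2 ^ T * \<theta> ^ i)" and "i < 12"
  define r where "r = i mod 3"
  have r: "r < 3" "i = r \<or> i = r + 3 \<or> i = r + 6 \<or> i = r + 9" using \<open>i < 12\<close> unfolding r_def by presburger+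
  obtain A B C D :: int where c: "of_int (\<alpha> r) / of_nat 2 ^ T = (of_int A / 4 :: complex)"
    "of_int (\<alpha> (r + 3)) / of_nat 2 ^ T = (of_int B / 4 :: complex)"
    "of_int (\<alpha> (r + 6)) / of_nat 2 ^ T = (of_int C / 4 :: complex)"
    "of_int (\<alpha> (r + 9)) / of_nat 2 ^ T = (of_int D / 4 :: complex)"
    and d: "m mod 4 = 3 \<longrightarrow> 4 dvd A \<and> 4 dvd B \<and> 4 dvd C \<and> 4 dvd D"
    "m mod 8 = 1 \<longrightarrow> 4 dvd B - D \<and> 2 dvd C - D \<and> 4 dvd A + C - 2 * D"
    "m mod 8 = 5 \<longrightarrow> 2 dvd C \<and> 2 dvd D \<and> 4 dvd A + C \<and> 4 dvd B + D"
    by (rule quartic_coords[OF odd int r(1)])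
  have d: "4 dvd A" "4 dvd B" "4 dvd C" "4 dvd D" using d(1) m by auto
  have ex: "\<exists>n :: int. of_int x / 4 = (of_int n :: complex)" if "4 dvd x" for x :: int
    using that by (auto elim!: dvdE)
  show "\<exists>n :: int. of_int (\<alpha> i) / of_nat 2 ^ T = (of_int n :: complex)"
    using r(2) ex[OF d(1)] ex[OF d(2)] ex[OF d(3)] ex[OF d(4)] unfolding c[symmetric] by blast
qed

lemma cubic_basis:
  assumes m: "\<not> 3 dvd m" "9 dvd m\<^sup>2 - 1"
  shows "pure12_triangular m \<theta> 3
    (\<lambda>i. if i < 8 then \<theta> ^ i else \<theta> ^ (i - 8) * (\<theta> ^ 8 + of_int m * \<theta> ^ 4 + 1) / 3)
    (\<lambda>i j. if i < 8 then 0 else if j = i - 8 then 1 else if j = i - 4 then m else 0)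
    (\<lambda>i. if i < 8 then 0 else 1)"
    (is "pure12_triangular m \<theta> 3 ?b ?B ?k")
proof
  show "prime (3::nat)" by (rule three_is_prime_nat)
  define h where "h = (\<theta> ^ 8 + of_int m * \<theta> ^ 4 + 1) / 3"
  obtain l where l: "m\<^sup>2 = 1 + 9 * l" using m(2) by (auto simp: dvd_def algebra_simps)
  have lc: "(of_int m)\<^sup>2 = (1 + 9 * of_int l :: complex)"
    using arg_cong[OF l, of "of_int :: int \<Rightarrow> complex"] by simp
  define x where "x = \<theta> ^ 4"
  have x3: "of_int m = x ^ 3" by (simp add: x_def flip: root power_mult)
  have h3: "3 * h = x\<^sup>2 + x ^ 4 + 1"
    unfolding h_def x3 by (simp add: x_def flip: power_mult power_add)
  have "x ^ 6 = 1 + 9 * of_int l" using lc by (simp add: x3 flip: power_mult)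
  \<comment> \<open>For y = x^2 = \<theta>^8 one has y^3 = m^2 = 1 + 9 l and 3 h = y^2 + y + 1, so
    (y - 1) h = 3 l. Eliminating y from the last two relations gives this monic cubic.\<close>
  with h3 have "h ^ 3 = h\<^sup>2 + 3 * of_int l * h + 3 * (of_int l)\<^sup>2" by Groebner_Basis.algebra
  then have "h ^ 4 = h * (h\<^sup>2 + 3 * of_int l * h + 3 * (of_int l)\<^sup>2)"
    by Groebner_Basis.algebra
  then have "h ^ 4 = of_int 1 * h ^ 3 + of_int (3 * l) * h\<^sup>2 + of_int (3 * l\<^sup>2) * h + of_int 0"
    by (simp add: algebra_simps power2_eq_square power3_eq_cube)
  then have h: "algebraic_int h" by (rule algebraic_int_monic_quartic)
  fix i :: nat assume i: "i < 12"
  show "algebraic_int (?b i)"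
    using algebraic_int_power[OF algebraic_int_theta] algebraic_int_mult[OF algebraic_int_power[OF algebraic_int_theta] h]
    by (simp add: h_def)
  show "?b i = ((\<Sum>j<i. of_int (?B i j) * \<theta> ^ j) + \<theta> ^ i) / of_nat 3 ^ ?k i"
  proof (cases "i < 8")
    case False
    have "(\<Sum>j<i. of_int (?B i j) * \<theta> ^ j)
        = (\<Sum>j<i. (if j = i - 8 then \<theta> ^ j else 0) + (if j = i - 4 then of_int m * \<theta> ^ j else 0))"
      using False by (intro sum.cong) auto
    also have "\<dots> = \<theta> ^ (i - 8) + of_int m * \<theta> ^ (i - 4)"
      using False by (simp add: sum.distrib)
    also have "\<theta> ^ (i - 4) = \<theta> ^ (i - 8) * \<theta> ^ 4" using False by (simp flip: power_add)
    moreover have "\<theta> ^ i = \<theta> ^ (i - 8) * \<theta> ^ 8" using False by (simp flip: power_add)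
    ultimately show ?thesis using False by (simp add: algebra_simps)
  qed simp
next
  fix \<alpha> :: "nat \<Rightarrow> int" and T :: nat
  assume int: "loc_int 3 (\<Sum>i<12. of_int (\<alpha> i) / of_nat 3 ^ T * \<theta> ^ i)"
  let ?h = "\<theta> ^ 8 + of_int m * \<theta> ^ 4 + 1"
  let ?a = "\<lambda>i. of_int (\<alpha> i) / of_nat 3 ^ T :: complex"
  have "\<exists>s t u :: int. ?a r * \<theta> ^ r + ?a (r + 4) * \<theta> ^ (r + 4) + ?a (r + 8) * \<theta> ^ (r + 8)
    = of_int s * \<theta> ^ r + of_int t * \<theta> ^ (r + 4) + of_int u * (\<theta> ^ r * ?h / 3)" if r: "r < 4" for r
  proof -
    obtain A B C :: int where c: "?a r = of_int A / 3" "?a (r + 4) = of_int B / 3" "?a (r + 8) = of_int C / 3"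
      and d: "3 dvd A - C" "3 dvd B - m * C" "\<not> 9 dvd m\<^sup>2 - 1 \<longrightarrow> 3 dvd C"
      by (rule cubic_coords[OF m(1) int r(1)])
    obtain s where s: "A - C = 3 * s" using d(1) by (rule dvdE)
    obtain t where t: "B - m * C = 3 * t" using d(2) by (rule dvdE)
    have A: "A = C + 3 * s" and B: "B = m * C + 3 * t" using s t by auto
    have Ac: "(of_int A :: complex) = of_int C + 3 * of_int s"
      and Bc: "(of_int B :: complex) = of_int m * of_int C + 3 * of_int t" by (simp_all add: A B)
    show ?thesis unfolding c power_add using cubic_combination[OF Ac Bc] by blast
  qed
  then have "\<forall>r. r < 4 \<longrightarrow> (\<exists>s t u :: int. ?a r * \<theta> ^ r + ?a (r + 4) * \<theta> ^ (r + 4) + ?a (r + 8) * \<theta> ^ (r + 8)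
    = of_int s * \<theta> ^ r + of_int t * \<theta> ^ (r + 4) + of_int u * (\<theta> ^ r * ?h / 3))" by blast
  then obtain s t u :: "nat \<Rightarrow> int" where
    stu: "\<And>r. r < 4 \<Longrightarrow> ?a r * \<theta> ^ r + ?a (r + 4) * \<theta> ^ (r + 4) + ?a (r + 8) * \<theta> ^ (r + 8)
      = of_int (s r) * \<theta> ^ r + of_int (t r) * \<theta> ^ (r + 4) + of_int (u r) * (\<theta> ^ r * ?h / 3)"
    unfolding choice_iff' by blast
  define c where "c i = (if i < 4 then s i else if i < 8 then t (i - 4) else u (i - 8))" for i
  have "(\<Sum>i<12. ?a i * \<theta> ^ i) = (\<Sum>i<12. of_int (c i) * ?b i)"
    unfolding sum_lessThan_12(1) by (intro sum.cong refl, subst stu) (simp_all add: c_def add.commute)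
  then show "\<exists>c :: nat \<Rightarrow> int. (\<Sum>i<12. ?a i * \<theta> ^ i) = (\<Sum>i<12. of_int (c i) * ?b i)" by blast
qed

lemma quadratic_integer:
  assumes "m mod 4 = 1"
  shows "algebraic_int ((\<theta> ^ 6 - 1) / 2)"
proof -
  define k where "k = m div 4"
  have k: "m = 4 * k + 1" using assms unfolding k_def by presburger
  have mc: "of_int m = (4 * of_int k + 1 :: complex)" unfolding k by simp
  define w where "w = (\<theta> ^ 6 - 1) / 2"
  have w2: "2 * w = \<theta> ^ 6 - 1" by (simp add: w_def)
  \<comment> \<open>With \<theta>^6 as a square root of m, w is a root of X^2 + X - (m -
    1)/4.\<close>
  have w: "w\<^sup>2 + w - of_int k = 0" using root mc w2 by Groebner_Basis.algebra
  have "w ^ 4 = - (w ^ 3) + of_int k * w\<^sup>2" using w by Groebner_Basis.algebra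
  then have "w ^ 4 = of_int (- 1) * w ^ 3 + of_int k * w\<^sup>2 + of_int 0 * w + of_int 0" by simp
  then show ?thesis unfolding w_def by (rule algebraic_int_monic_quartic)
qed

lemma quartic_basis_5:
  assumes m: "m mod 8 = 5"
  shows "pure12_triangular m \<theta> 2
    (\<lambda>i. if i < 6 then \<theta> ^ i else \<theta> ^ (i - 6) * (\<theta> ^ 6 - 1) / 2)
    (\<lambda>i j. if i < 6 then 0 else if j = i - 6 then - 1 else 0)
    (\<lambda>i. if i < 6 then 0 else 1)"
    (is "pure12_triangular m \<theta> 2 ?b ?B ?k")
proof
  show "prime (2::nat)" by (rule two_is_prime_nat)
  have "m mod 4 = 1" using m by presburger
  note w = quadratic_integer[OF this]
  fix i :: nat assume i: "i < 12"
  show "algebraic_int (?b i)"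
    using algebraic_int_power[OF algebraic_int_theta] algebraic_int_mult[OF algebraic_int_power[OF algebraic_int_theta] w]
    by simp
  show "?b i = ((\<Sum>j<i. of_int (?B i j) * \<theta> ^ j) + \<theta> ^ i) / of_nat 2 ^ ?k i"
  proof (cases "i < 6")
    case False
    have "(\<Sum>j<i. of_int (?B i j) * \<theta> ^ j) = (\<Sum>j<i. (if j = i - 6 then - (\<theta> ^ j) else 0))"
      using False by (intro sum.cong) auto
    also have "\<dots> = - (\<theta> ^ (i - 6))" using False by simp
    moreover have "\<theta> ^ i = \<theta> ^ (i - 6) * \<theta> ^ 6" using False by (simp flip: power_add)
    ultimately show ?thesis using False by (simp add: algebra_simps)
  qed simp
next
  have odd: "odd m" using m by presburger
  fix \<alpha> :: "nat \<Rightarrow> int" and T :: nat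
  assume int: "loc_int 2 (\<Sum>i<12. of_int (\<alpha> i) / of_nat 2 ^ T * \<theta> ^ i)"
  let ?w = "\<theta> ^ 6 - 1"
  let ?a = "\<lambda>i. of_int (\<alpha> i) / of_nat 2 ^ T :: complex"
  let ?P = "\<lambda>r s t u v. ?a r * \<theta> ^ r + ?a (r + 3) * \<theta> ^ (r + 3) + ?a (r + 6) * \<theta> ^ (r + 6) + ?a (r + 9) * \<theta> ^ (r + 9)
    = of_int s * \<theta> ^ r + of_int t * \<theta> ^ (r + 3) + of_int u * (\<theta> ^ r * ?w / 2) + of_int v * (\<theta> ^ (r + 3) * ?w / 2)"
  have "\<exists>s t u v :: int. ?P r s t u v" if r: "r < 3" for r
  proof -
    obtain A B C D :: int where c: "?a r = of_int A / 4" "?a (r + 3) = of_int B / 4"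
      "?a (r + 6) = of_int C / 4" "?a (r + 9) = of_int D / 4"
      and d: "m mod 4 = 3 \<longrightarrow> 4 dvd A \<and> 4 dvd B \<and> 4 dvd C \<and> 4 dvd D"
      "m mod 8 = 1 \<longrightarrow> 4 dvd B - D \<and> 2 dvd C - D \<and> 4 dvd A + C - 2 * D"
      "m mod 8 = 5 \<longrightarrow> 2 dvd C \<and> 2 dvd D \<and> 4 dvd A + C \<and> 4 dvd B + D"
      by (rule quartic_coords[OF odd int r])
    have d: "2 dvd C" "2 dvd D" "4 dvd A + C" "4 dvd B + D" using d(3) m by auto
    obtain u where u: "C = 2 * u" using d(1) by (rule dvdE)
    obtain v where v: "D = 2 * v" using d(2) by (rule dvdE)
    obtain s where s: "A + C = 4 * s" using d(3) by (rule dvdE)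
    obtain t where t: "B + D = 4 * t" using d(4) by (rule dvdE)
    have A: "A = 4 * s - 2 * u" and B: "B = 4 * t - 2 * v" using s t u v by auto
    have Ac: "(of_int A :: complex) = 4 * of_int s - 2 * of_int u" "(of_int B :: complex) = 4 * of_int t - 2 * of_int v"
      "(of_int C :: complex) = 2 * of_int u" "(of_int D :: complex) = 2 * of_int v" by (simp_all add: A B u v)
    show ?thesis unfolding c power_add using quartic_combination_5[OF Ac] by blast
  qed
  then have "\<forall>r. r < 3 \<longrightarrow> (\<exists>s t u v :: int. ?P r s t u v)" by blast
  then obtain s t u v :: "nat \<Rightarrow> int" where stu: "\<And>r. r < 3 \<Longrightarrow> ?P r (s r) (t r) (u r) (v r)"
    unfolding choice_iff' by blast
  define c where "c i = (if i < 3 then s i else if i < 6 then t (i - 3) else if i < 9 then u (i - 6) else v (i - 9))" for i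
  have "(\<Sum>i<12. ?a i * \<theta> ^ i) = (\<Sum>i<12. of_int (c i) * ?b i)"
    unfolding sum_lessThan_12(2) by (intro sum.cong refl, subst stu) (simp_all add: c_def add.commute)
  then show "\<exists>c :: nat \<Rightarrow> int. (\<Sum>i<12. ?a i * \<theta> ^ i) = (\<Sum>i<12. of_int (c i) * ?b i)" by blast
qed

lemma quartic_basis_1:
  assumes m: "m mod 8 = 1"
  shows "pure12_triangular m \<theta> 2
    (\<lambda>i. if i < 6 then \<theta> ^ i else if i < 9 then \<theta> ^ (i - 6) * (\<theta> ^ 6 - 1) / 2
      else \<theta> ^ (i - 9) * (\<theta> ^ 9 + \<theta> ^ 6 + \<theta> ^ 3 + 1) / 2 ^ 2)
    (\<lambda>i j. if i < 6 then 0 else if i < 9 then if j = i - 6 then - 1 else 0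
      else if j = i - 9 \<or> j = i - 6 \<or> j = i - 3 then 1 else 0)
    (\<lambda>i. if i < 6 then 0 else if i < 9 then 1 else 2)"
    (is "pure12_triangular m \<theta> 2 ?b ?B ?k")
proof
  show "prime (2::nat)" by (rule two_is_prime_nat)
  have "m mod 4 = 1" using m by presburger
  note w = quadratic_integer[OF this]
  define l where "l = m div 8"
  have l: "m = 8 * l + 1" using m unfolding l_def by presburger
  have mc: "of_int m = (8 * of_int l + 1 :: complex)" unfolding l by simp
  define g where "g = (\<theta> ^ 9 + \<theta> ^ 6 + \<theta> ^ 3 + 1) / 2 ^ 2"
  define \<phi> where "\<phi> = \<theta> ^ 3"
  have \<phi>: "\<phi> ^ 4 = 8 * of_int l + 1" using root mc by (simp add: \<phi>_def flip: power_mult)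
  have g4: "4 * g = \<phi> ^ 3 + \<phi>\<^sup>2 + \<phi> + 1" by (simp add: g_def \<phi>_def flip: power_mult)
  \<comment> \<open>As 4 g = \<phi>^3 + \<phi>^2 + \<phi> + 1 and \<phi>^4 = 1 + 8 l, one has
    (\<phi> - 1) g = 2 l. Eliminating \<phi> gives this monic quartic.\<close>
  have "g ^ 4 = 1 * g ^ 3 + (3 * of_int l) * g\<^sup>2 + (4 * (of_int l)\<^sup>2) * g + (2 * of_int l ^ 3)"
    using \<phi> g4 by Groebner_Basis.algebra
  then have "g ^ 4 = of_int 1 * g ^ 3 + of_int (3 * l) * g\<^sup>2 + of_int (4 * l\<^sup>2) * g + of_int (2 * l ^ 3)"
    by simp
  then have g: "algebraic_int g" by (rule algebraic_int_monic_quartic)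
  fix i :: nat assume i: "i < 12"
  show "algebraic_int (?b i)"
    using algebraic_int_power[OF algebraic_int_theta] algebraic_int_mult[OF algebraic_int_power[OF algebraic_int_theta] w]
      algebraic_int_mult[OF algebraic_int_power[OF algebraic_int_theta] g]
    by (simp add: g_def)
  consider "i < 6" | "6 \<le> i" "i < 9" | "9 \<le> i" by linarith
  then show "?b i = ((\<Sum>j<i. of_int (?B i j) * \<theta> ^ j) + \<theta> ^ i) / of_nat 2 ^ ?k i"
  proof cases
    case 2
    have "(\<Sum>j<i. of_int (?B i j) * \<theta> ^ j) = (\<Sum>j<i. (if j = i - 6 then - (\<theta> ^ j) else 0))"
      using 2 by (intro sum.cong) auto
    also have "\<dots> = - (\<theta> ^ (i - 6))" using 2 by simp
    moreover have "\<theta> ^ i = \<theta> ^ (i - 6) * \<theta> ^ 6" using 2 by (simp flip: power_add)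
    ultimately show ?thesis using 2 by (simp add: algebra_simps)
  next
    case 3
    have "(\<Sum>j<i. of_int (?B i j) * \<theta> ^ j) = (\<Sum>j<i. (if j = i - 9 then \<theta> ^ j else 0)
        + (if j = i - 6 then \<theta> ^ j else 0) + (if j = i - 3 then \<theta> ^ j else 0))"
      using 3 by (intro sum.cong) auto
    also have "\<dots> = \<theta> ^ (i - 9) + \<theta> ^ (i - 6) + \<theta> ^ (i - 3)" using 3 by (simp add: sum.distrib)
    also have "\<theta> ^ (i - 6) = \<theta> ^ (i - 9) * \<theta> ^ 3" using 3 by (simp flip: power_add)
    also have "\<theta> ^ (i - 3) = \<theta> ^ (i - 9) * \<theta> ^ 6" using 3 by (simp flip: power_add)
    moreover have "\<theta> ^ i = \<theta> ^ (i - 9) * \<theta> ^ 9" using 3 by (simp flip: power_add)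
    ultimately show ?thesis using 3 by (simp add: algebra_simps)
  qed simp
next
  have odd: "odd m" using m by presburger
  fix \<alpha> :: "nat \<Rightarrow> int" and T :: nat
  assume int: "loc_int 2 (\<Sum>i<12. of_int (\<alpha> i) / of_nat 2 ^ T * \<theta> ^ i)"
  let ?w = "\<theta> ^ 6 - 1"
  let ?g = "\<theta> ^ 9 + \<theta> ^ 6 + \<theta> ^ 3 + 1"
  let ?a = "\<lambda>i. of_int (\<alpha> i) / of_nat 2 ^ T :: complex"
  let ?P = "\<lambda>r s t u v. ?a r * \<theta> ^ r + ?a (r + 3) * \<theta> ^ (r + 3) + ?a (r + 6) * \<theta> ^ (r + 6) + ?a (r + 9) * \<theta> ^ (r + 9)
    = of_int s * \<theta> ^ r + of_int t * \<theta> ^ (r + 3) + of_int u * (\<theta> ^ r * ?w / 2) + of_int v * (\<theta> ^ r * ?g / 2 ^ 2)"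
  have "\<exists>s t u v :: int. ?P r s t u v" if r: "r < 3" for r
  proof -
    obtain A B C D :: int where c: "?a r = of_int A / 4" "?a (r + 3) = of_int B / 4"
      "?a (r + 6) = of_int C / 4" "?a (r + 9) = of_int D / 4"
      and d: "m mod 4 = 3 \<longrightarrow> 4 dvd A \<and> 4 dvd B \<and> 4 dvd C \<and> 4 dvd D"
      "m mod 8 = 1 \<longrightarrow> 4 dvd B - D \<and> 2 dvd C - D \<and> 4 dvd A + C - 2 * D"
      "m mod 8 = 5 \<longrightarrow> 2 dvd C \<and> 2 dvd D \<and> 4 dvd A + C \<and> 4 dvd B + D"
      by (rule quartic_coords[OF odd int r])
    have d: "4 dvd B - D" "2 dvd C - D" "4 dvd A + C - 2 * D" using d(2) m by auto
    obtain t where t: "B - D = 4 * t" using d(1) by (rule dvdE)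
    obtain u where u: "C - D = 2 * u" using d(2) by (rule dvdE)
    obtain s where s: "A + C - 2 * D = 4 * s" using d(3) by (rule dvdE)
    have B: "B = D + 4 * t" and C: "C = D + 2 * u" and A: "A = 4 * s + D - 2 * u" using s t u by auto
    have Ac: "(of_int A :: complex) = 4 * of_int s + of_int D - 2 * of_int u"
      "(of_int B :: complex) = of_int D + 4 * of_int t" "(of_int C :: complex) = of_int D + 2 * of_int u"
      by (simp_all add: A B C)
    show ?thesis unfolding c power_add using quartic_combination_1[OF Ac] by blast
  qed
  then have "\<forall>r. r < 3 \<longrightarrow> (\<exists>s t u v :: int. ?P r s t u v)" by blast
  then obtain s t u v :: "nat \<Rightarrow> int" where stu: "\<And>r. r < 3 \<Longrightarrow> ?P r (s r) (t r) (u r) (v r)"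
    unfolding choice_iff' by blast
  define c where "c i = (if i < 3 then s i else if i < 6 then t (i - 3) else if i < 9 then u (i - 6) else v (i - 9))" for i
  have "(\<Sum>i<12. ?a i * \<theta> ^ i) = (\<Sum>i<12. of_int (c i) * ?b i)"
    unfolding sum_lessThan_12(2) by (intro sum.cong refl, subst stu) (simp_all add: c_def add.commute)
  then show "\<exists>c :: nat \<Rightarrow> int. (\<Sum>i<12. ?a i * \<theta> ^ i) = (\<Sum>i<12. of_int (c i) * ?b i)" by blast
qed

end

text \<open>The sum counts lattice points on or below a line of slope v/12: the diagonal cuts the 11
  by v - 1 rectangle of interior points into equal halves and carries gcd(v, 12) - 1 of them. In the
  given range the eleven values of v are checked directly.\<close>

lemma slope_index:
  assumes "0 < v" "v < 12"
  shows "real (\<Sum>i<12. i * v div 12) = (11 * (real v - 1) + (real (gcd v 12) - 1)) / 2"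
proof -
  have sets: "{..<12::nat} = {0, 1, 2, 3, 4, 5, 6, 7, 8, 9, 10, 11}"
    by (simp add: set_eq_iff) arith
  have gcds: "gcd (Suc 0) 12 = 1" "gcd (2::nat) 12 = 2" "gcd (3::nat) 12 = 3" "gcd (4::nat) 12 = 4"
    "gcd (5::nat) 12 = 1" "gcd (6::nat) 12 = 6" "gcd (7::nat) 12 = 1" "gcd (8::nat) 12 = 4"
    "gcd (9::nat) 12 = 3" "gcd (10::nat) 12 = 2" "gcd (11::nat) 12 = 1"
    by (simp_all add: gcd_non_0_nat)
  have "v \<in> {..<12}" using assms by simp
  then show ?thesis
    using assms(1) unfolding sets by (elim insertE emptyE) (simp_all add: gcds)
qed

text \<open>g is the p-part of 12, that is 4, 3 or 1, and e is the part prime to p. As a power of p,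
  g is prime to v.\<close>

lemma coprime_factorization_of_12:
  assumes "prime p" "\<not> p dvd v"
  obtains e g :: nat where "e * g = 12" "coprime e g" "\<not> p dvd e" "coprime g v"
proof -
  consider "p = 2" | "p = 3" | "p \<noteq> 2" "p \<noteq> 3" by blast
  then show thesis
  proof cases
    case 1
    show thesis
    proof (rule that[of 3 4])
      show "coprime 3 (4::nat)" by (simp add: coprime_iff_gcd_eq_1 gcd_non_0_nat)
      have "coprime 2 v" using 1 assms prime_imp_coprime[of 2 v] by simp
      then have "coprime (2 ^ 2) v" by (simp only: coprime_power_left_iff simp_thms)
      moreover have "2 ^ 2 = (4::nat)" by simp
      ultimately show "coprime 4 v" by (simp only:)
    qed (use 1 in auto)
  next
    case 2
    show thesis
    proof (rule that[of 4 3])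
      show "coprime 4 (3::nat)" by (simp add: coprime_iff_gcd_eq_1 gcd_non_0_nat)
      show "coprime 3 v" using 2 assms prime_imp_coprime[of 3 v] by simp
    qed (use 2 in auto)
  next
    case 3
    have "\<not> p dvd 12"
    proof
      assume "p dvd 12"
      then have "p dvd 2 * 2 * 3" by simp
      then have "p dvd 2 \<or> p dvd 3" using assms(1) by (simp only: prime_dvd_mult_iff) blast
      then show False using 3 assms(1) primes_dvd_imp_eq two_is_prime_nat three_is_prime_nat by metis
    qed
    then show thesis by (intro that[of 12 1]) auto
  qed
qed

section \<open>Assembly of the four cases\<close>

theorem theorem2p2:
  fixes m :: int and \<theta> :: complex and p :: nat
  assumes free12: "\<forall>q :: int. q ^ 12 dvd m \<longrightarrow> is_unit q"
    and irr: "irreducible (monom (1 :: rat) 12 - [:of_int m:])"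
    and root: "\<theta> ^ 12 = of_int m"
    and prime_p: "prime p"
  defines "K \<equiv> gen_field \<theta>"
    and "idx \<equiv> subgroup_index (ring_of_integers (gen_field \<theta>)) (Zpow_basis_span 12 \<theta>)"
    and "v \<equiv> multiplicity (int p) m"
    and "d \<equiv> gcd (multiplicity (int p) m) 12"
  shows
   "(int p dvd m \<and> \<not> p dvd v \<longrightarrow>
      real (multiplicity p idx) = (11 * (real v - 1) + (real d - 1)) / 2 \<and>
      p_integral_basis p K 12 (\<lambda>i. \<theta> ^ i / of_nat p ^ nat \<lfloor>real (i * v) / 12\<rfloor>))
  \<and> (p = 3 \<and> \<not> 3 dvd m \<longrightarrow>
      multiplicity p idx = (if [m\<^sup>2 = 1] (mod 9) then 4 else 0) \<and>
      (if [m\<^sup>2 = 1] (mod 9)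
       then p_integral_basis p K 12
              (\<lambda>i. if i < 8 then \<theta> ^ i
                   else \<theta> ^ (i - 8) * (\<theta> ^ 8 + of_int m * \<theta> ^ 4 + 1) / 3)
       else p_integral_basis p K 12 (\<lambda>i. \<theta> ^ i)))
  \<and> (p = 2 \<and> \<not> 2 dvd m \<longrightarrow>
      (m mod 8 = 1 \<longrightarrow> multiplicity p idx = 9 \<and>
         p_integral_basis p K 12
           (\<lambda>i. if i < 6 then \<theta> ^ i
                else if i < 9 then \<theta> ^ (i - 6) * (\<theta> ^ 6 - 1) / 2
                else \<theta> ^ (i - 9) * (\<theta> ^ 9 + \<theta> ^ 6 + \<theta> ^ 3 + 1) / 2 ^ 2)) \<and>
      (m mod 8 = 5 \<longrightarrow> multiplicity p idx = 6 \<and>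
         p_integral_basis p K 12
           (\<lambda>i. if i < 6 then \<theta> ^ i else \<theta> ^ (i - 6) * (\<theta> ^ 6 - 1) / 2)) \<and>
      (m mod 4 = 3 \<longrightarrow> multiplicity p idx = 0 \<and>
         p_integral_basis p K 12 (\<lambda>i. \<theta> ^ i)))
  \<and> (\<not> int p dvd 12 * m \<longrightarrow>
      multiplicity p idx = 0 \<and> p_integral_basis p K 12 (\<lambda>i. \<theta> ^ i))"
proof -
  interpret pure12 m \<theta> by unfold_locales (fact irr, fact root)
  have result: "p_integral_basis q K 12 b \<and> multiplicity q idx = (\<Sum>i<12. k i)"
    if "pure12_triangular m \<theta> q b B k" for q b B k
  proof -
    interpret pure12_triangular m \<theta> q b B k by (fact that)
    show ?thesis using p_integral_basis multiplicity_index unfolding K_def idx_def by blast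
  qed
  have sets: "{..<12::nat} = {0, 1, 2, 3, 4, 5, 6, 7, 8, 9, 10, 11}"
    by (simp add: set_eq_iff) arith
  have np: "\<not> is_unit (int p)" using prime_gt_1_nat[OF prime_p] by auto
  have cong: "[m\<^sup>2 = 1] (mod 9) \<longleftrightarrow> 9 dvd m\<^sup>2 - 1" by (rule cong_iff_dvd_diff)
  show ?thesis
  proof (intro conjI impI)
    assume *: "int p dvd m \<and> \<not> p dvd v"
    obtain e g where "e * g = 12" "coprime e g" "\<not> p dvd e" "coprime g v"
      using coprime_factorization_of_12[OF prime_p] * by blast
    note R = result[OF tame_basis[OF prime_p this(1,2,3) v_def[THEN meta_eq_to_obj_eq] this(4)]]
    \<comment> \<open>This is where m being free of 12-th powers enters; it puts v into the range
      covered by \<open>slope_index\<close>.\<close>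
    have "v < 12"
    proof (rule ccontr)
      assume "\<not> v < 12"
      then have "int p ^ 12 dvd m" unfolding v_def by (intro multiplicity_dvd') simp
      then show False using free12 np by blast
    qed
    moreover have "v > 0" using * by (intro Nat.gr0I) auto
    ultimately show "real (multiplicity p idx) = (11 * (real v - 1) + (real d - 1)) / 2"
      using R slope_index unfolding d_def v_def by metis
    have "nat \<lfloor>real (i * v) / 12\<rfloor> = i * v div 12" for i
      using floor_divide_of_nat_eq[of "i * v" 12, where 'a = real] by simp
    then show "p_integral_basis p K 12 (\<lambda>i. \<theta> ^ i / of_nat p ^ nat \<lfloor>real (i * v) / 12\<rfloor>)"
      using R by simp
  next
    assume "p = 3 \<and> \<not> 3 dvd m"
    then have p: "p = 3" and m: "\<not> 3 dvd m" by auto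
    show "multiplicity p idx = (if [m\<^sup>2 = 1] (mod 9) then 4 else 0)"
    proof (cases "[m\<^sup>2 = 1] (mod 9)")
      case True
      then show ?thesis using result[OF cubic_basis[OF m]] unfolding p cong sets by simp
    next
      case False
      then show ?thesis using result[OF power_basis_3[OF m]] unfolding p cong by simp
    qed
    show "if [m\<^sup>2 = 1] (mod 9)
       then p_integral_basis p K 12
              (\<lambda>i. if i < 8 then \<theta> ^ i
                   else \<theta> ^ (i - 8) * (\<theta> ^ 8 + of_int m * \<theta> ^ 4 + 1) / 3)
       else p_integral_basis p K 12 (\<lambda>i. \<theta> ^ i)"
      using result[OF cubic_basis[OF m]] result[OF power_basis_3[OF m]] unfolding p cong by simp
  next
    assume *: "p = 2 \<and> \<not> 2 dvd m" and m: "m mod 8 = 1"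
    then have p: "p = 2" by simp
    note R = result[OF quartic_basis_1[OF m]]
    show "multiplicity p idx = 9" using R unfolding p sets by simp
    show "p_integral_basis p K 12
           (\<lambda>i. if i < 6 then \<theta> ^ i
                else if i < 9 then \<theta> ^ (i - 6) * (\<theta> ^ 6 - 1) / 2
                else \<theta> ^ (i - 9) * (\<theta> ^ 9 + \<theta> ^ 6 + \<theta> ^ 3 + 1) / 2 ^ 2)"
      using R unfolding p by blast
  next
    assume *: "p = 2 \<and> \<not> 2 dvd m" and m: "m mod 8 = 5"
    then have p: "p = 2" by simp
    note R = result[OF quartic_basis_5[OF m]]
    show "multiplicity p idx = 6" using R unfolding p sets by simp
    show "p_integral_basis p K 12 (\<lambda>i. if i < 6 then \<theta> ^ i else \<theta> ^ (i - 6) * (\<theta> ^ 6 - 1) / 2)"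
      using R unfolding p by blast
  next
    assume *: "p = 2 \<and> \<not> 2 dvd m" and m: "m mod 4 = 3"
    then have p: "p = 2" by simp
    note R = result[OF power_basis_2[OF m]]
    show "multiplicity p idx = 0" using R unfolding p by simp
    show "p_integral_basis p K 12 (\<lambda>i. \<theta> ^ i)" using R unfolding p by blast
  next
    assume "\<not> int p dvd 12 * m"
    then have m: "\<not> int p dvd m" and "\<not> int p dvd int 12" by (auto dest: dvd_mult)
    then have p12: "\<not> p dvd 12" by (simp only: int_dvd_int_iff not_False_eq_True)
    have v: "0 = multiplicity (int p) m" using m by (simp add: not_dvd_imp_multiplicity_0)
    \<comment> \<open>The primes not dividing 12 m are the degenerate tame case v = 0 with e = 12
      and g = 1, where all exponents of p vanish.\<close>
    have "pure12_triangular m \<theta> p (\<lambda>i. \<theta> ^ i / of_nat p ^ (i * 0 div 12)) (\<lambda>_ _. 0) (\<lambda>i. i * 0 div 12)"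
      by (rule tame_basis[OF prime_p _ _ p12 v, of 1]) auto
    from result[OF this] show "multiplicity p idx = 0" "p_integral_basis p K 12 (\<lambda>i. \<theta> ^ i)" by simp_all
  qed
qed

end
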